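(* For $a\in\mathbb{R}$ suppose $\int_0^\infty|\hat g(\xi)|e^{a\xi}\,d\xi<\infty$ and that the convolution kernel $k(t)=-\frac K2\hat g(t)$ satisfies $(\mathcal{L}k)(z)\neq-1$ for all $z\in\mathbb{C}$ with $\Re z=-a$. Then, for $u_{in}\in C(\mathbb{N}\times\mathbb{R})$, the solution $\eta$ to the Volterra equation $$\eta(t)+(k*\eta)(t)=u_{in}(1,t)\qquad(t\in\mathbb{R}^+)$$ is given by $$\eta(t)=u_{in}(1,t)-\int_0^\infty q(t-s)\,u_{in}(1,s)\,ds$$ with $$q(t)=r_s(t)+\sum_{i=1}^n\sum_{j=0}^{p_i-1}b_{i,j}\,t^je^{\lambda_it},$$ where $r_s$ is vanishing for negative arguments and satisfies $\int_0^\infty|r_s(t)|e^{at}\,dt<\infty$, $\lambda_1,\dots,\lambda_n$ are the finitely many zeros of $1+(\mathcal{L}k)(z)$ in $\Re z>-a$ with multiplicities $p_1,\dots,p_n$, and $b_{i,j}$ depends on the residues of $[1+(\mathcal{L}k)(z)]^{-1}$ at $\lambda_i$.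
   Context: $\mathbb{R}^+=[0,\infty)$, $\mathbb{N}=\{1,2,\dots\}$. The velocity distribution $g$ is a Borel probability measure on $\mathbb{R}$ with Fourier transform $\hat g(\xi)=\int_{\mathbb{R}}e^{i\xi\omega}g(d\omega)$, and $K\ge0$ is the coupling constant. The convolution is $(f*h)(t)=\int_0^tf(t-s)h(s)\,ds$ for $t\in\mathbb{R}^+$. The Laplace transform is $(\mathcal{L}k)(z)=\int_0^\infty k(t)e^{-tz}\,dt$.
   Formalization: The formula for q(t) is taken for t ≥ 0 only and q(t) = 0 for t < 0; with the exponential terms kept at negative arguments, the integral over [0,∞) can diverge or give a wrong value (e.g. g Cauchy, λ = K/2 − 1 > 0, u_in constant). *)

theory Defs
  imports "HOL-Probability.Probability" "HOL-Complex_Analysis.Complex_Analysis"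
begin

definition laplace :: "(real \<Rightarrow> complex) \<Rightarrow> complex \<Rightarrow> complex" where
  "laplace k z = (LINT t:{0..}|lborel. k t * exp (- (complex_of_real t * z)))"

definition conv :: "(real \<Rightarrow> complex) \<Rightarrow> (real \<Rightarrow> complex) \<Rightarrow> real \<Rightarrow> complex" where
  "conv f h t = (LINT s:{0..t}|lborel. f (t - s) * h s)"

text \<open>The Fourier transform of the measure \<open>g\<close>, with the sign convention
  \<open>exp (\<i> \<xi> \<omega>)\<close>, is the library's characteristic function \<open>char g\<close>.\<close>

definition coupling_kernel :: "real \<Rightarrow> real measure \<Rightarrow> real \<Rightarrow> complex" where
  "coupling_kernel K g t = - (complex_of_real (K / 2) * char g t)"

text \<open>Solutions are sought among the locally integrable functions on \<open>[0,\<infinity>)\<close>; without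
  local integrability, \<open>conv k \<eta>\<close> would silently take the default value \<open>0\<close> of
  the Bochner integral.\<close>

definition volterra_solution ::
    "(real \<Rightarrow> complex) \<Rightarrow> (real \<Rightarrow> complex) \<Rightarrow> (real \<Rightarrow> complex) \<Rightarrow> bool" where
  "volterra_solution k f \<eta> \<longleftrightarrow>
     (\<forall>T\<ge>0. set_integrable lborel {0..T} \<eta>) \<and>
     (\<forall>t\<ge>0. \<eta> t + conv k \<eta> t = f t)"

definition char_zeros :: "(real \<Rightarrow> complex) \<Rightarrow> real \<Rightarrow> complex set" where
  "char_zeros k a = {z. Re z > - a \<and> 1 + laplace k z = 0}"

definition zero_mult :: "(real \<Rightarrow> complex) \<Rightarrow> complex \<Rightarrow> nat" where
  "zero_mult k \<mu> = nat (zorder (\<lambda>z. 1 + laplace k z) \<mu>)"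

text \<open>The resolvent \<open>r\<close> of \<open>k\<close>, that is the solution of \<open>r + conv k r = k\<close>, has
  the Laplace transform \<open>1 - 1 / (1 + laplace k z)\<close> for \<open>Re z\<close> large, and
  that of \<open>t ^ j * exp (\<mu> t)\<close> is \<open>fact j / (z - \<mu>) ^ (j + 1)\<close>. The coefficient is obtained by
  matching principal parts at \<open>\<mu>\<close>: the residue below is the coefficient of
  \<open>(z - \<mu>) powi (- (j + 1))\<close> in the Laurent expansion of \<open>1 / (1 + laplace k z)\<close>.\<close>

definition pole_coeff :: "(real \<Rightarrow> complex) \<Rightarrow> complex \<Rightarrow> nat \<Rightarrow> complex" where
  "pole_coeff k \<mu> j =
     - residue (\<lambda>z. (z - \<mu>) ^ j * inverse (1 + laplace k z)) \<mu> / fact j"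

end

theory Submission
  imports Defs
begin

text \<open>
  Write \<open>f z = 1 + laplace k z\<close>. The resolvent \<open>q\<close>, which is determined almost everywhere by
  \<open>q + k * q = k\<close>, has the transform \<open>1 - 1 / f\<close> far to the right, and associativity of the
  convolution makes the Volterra equation equivalent to \<open>\<eta> = u - q * u\<close>
  (\<open>volterra_solution_iff_resolvent\<close>). Everything therefore rests on recognising \<open>1 / f\<close> as
  \<open>1\<close> plus the transform of a function whose shape is known.

  On the line \<open>Re z = - a\<close> the function \<open>f\<close> has no zero and tends to \<open>1\<close> at infinity, so by
  Wiener's lemma \<open>1 / f\<close> is there \<open>1\<close> plus the Fourier transform of some integrable \<open>m\<close>
  on the whole real axis (\<open>wiener_inverse\<close>). To the right of the line \<open>f\<close> has finitely many
  zeros (\<open>finite_char_zeros\<close>), and subtracting from \<open>1 / f\<close> the sum \<open>P\<close> of its principal parts,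
  whose coefficients are residues, leaves a holomorphic function
  (\<open>inverse_minus_principal_parts\<close>). Split \<open>m\<close> into its parts on the positive and on the negative
  axis. The transform of the first part is holomorphic to the right of the line, that of the second
  part to the left, and so \<open>1 / f - P - 1\<close> minus the first on the right and the second minus
  \<open>P\<close> on the left fit together to one entire function. It is bounded, hence constant by Liouville's
  theorem, and it tends to \<open>0\<close> along the negative real axis, so it vanishes. Thus
  \<open>1 / f = 1 + P + laplace r\<close> with \<open>r\<close> the weighted positive part of \<open>m\<close>
  (\<open>inverse_symbol_decomposition\<close>). Inverting the rational function \<open>P\<close> gives the exponential
  polynomials in \<open>q\<close>, the function \<open>- r\<close> is the stable part, and since a Fourier transform
  determines its function almost everywhere, the product of transforms turns back into the resolvent
  equation (\<open>resolvent_from_transform\<close>).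

  Wiener's lemma is proved by Newman's method, after multiplying \<open>k\<close> by \<open>exp (a t)\<close> to move the line
  to the imaginary axis. The new kernel is continuous, so it is approximated in \<open>L\<^sup>1\<close> by functions
  \<open>p\<close> that are polynomials in \<open>exp (- t)\<close>; their transforms are rational with quadratic decay. If \<open>\<bar>f\<bar> \<ge> \<delta>\<close> on the axis, then \<open>1 + laplace p\<close> stays above
  \<open>\<delta> / 2\<close> in absolute value in a strip around it, and Cauchy's integral formula on that strip exhibits the powers of its
  inverse as \<open>1\<close> plus Fourier transforms of norm \<open>O(n (2 / \<delta>) ^ n)\<close> (\<open>wiener_strip\<close>). As
  the kernel differs from \<open>p\<close> by less than \<open>\<delta> / 4\<close> in norm, the geometric series that expands
  \<open>1 / f\<close> around \<open>1 / (1 + laplace p)\<close> converges in norm.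
\<close>

section \<open>Convolution of integrable functions on the line\<close>

definition convolve :: "(real \<Rightarrow> complex) \<Rightarrow> (real \<Rightarrow> complex) \<Rightarrow> real \<Rightarrow> complex" where
  "convolve f h t = (LINT s|lborel. f (t - s) * h s)"

lemma integrable_translate:
  fixes f :: "real \<Rightarrow> 'a::{banach, second_countable_topology}"
  assumes "integrable lborel f"
  shows "integrable lborel (\<lambda>t. f (t - s))"
  using lborel_integrable_real_affine[OF assms, of 1 "-s"] by simp

lemma integral_translate:
  fixes f :: "real \<Rightarrow> 'a::{banach, second_countable_topology}"
  shows "(LINT t|lborel. f (t - s)) = (LINT t|lborel. f t)"
  using lborel_integral_real_affine[of 1 f "-s"] by simp

lemma integral_reflect:
  fixes f :: "real \<Rightarrow> 'a::{banach, second_countable_topology}"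
  shows "(LINT s|lborel. f (t - s)) = (LINT s|lborel. f s)"
  using lborel_integral_real_affine[of "-1" f t] by simp

lemma integrable_reflect:
  fixes f :: "real \<Rightarrow> 'a::{banach, second_countable_topology}"
  assumes "integrable lborel f"
  shows "integrable lborel (\<lambda>s. f (t - s))"
  using lborel_integrable_real_affine[OF assms, of "-1" t] by simp

lemma convolve_commute: "convolve f h = convolve h f"
proof
  fix t
  have "convolve f h t = (LINT s|lborel. (\<lambda>s. f (t - s) * h s) (t - s))"
    unfolding convolve_def by (rule integral_reflect[symmetric])
  then show "convolve f h t = convolve h f t"
    by (simp add: convolve_def mult.commute)
qed

lemma integrable_convolve_kernel:
  fixes f h :: "real \<Rightarrow> complex"
  assumes f: "integrable lborel f" and h: "integrable lborel h"
  shows "integrable (lborel \<Otimes>\<^sub>M lborel) (\<lambda>(s, t). f (t - s) * h s)"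
proof (rule lborel_pair.Fubini_integrable)
  have [measurable]: "f \<in> borel_measurable borel" "h \<in> borel_measurable borel"
    using f h by (auto dest: borel_measurable_integrable)
  show "(\<lambda>(s, t). f (t - s) * h s) \<in> borel_measurable (lborel \<Otimes>\<^sub>M lborel)"
    by measurable
  have "(LINT t|lborel. norm (f (t - s) * h s)) = norm (h s) * (LINT t|lborel. norm (f t))" for s
    using integral_translate[of "\<lambda>t. norm (f t)" s] by (simp add: norm_mult mult.commute)
  with h show "integrable lborel (\<lambda>s. LINT t|lborel. norm (case (s, t) of (s, t) \<Rightarrow> f (t - s) * h s))"
    by simp
  show "AE s in lborel. integrable lborel (\<lambda>t. case (s, t) of (s, t) \<Rightarrow> f (t - s) * h s)"
    using integrable_translate[OF f] by simp
qed

lemma integrable_convolve: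
  assumes f: "integrable lborel f" and h: "integrable lborel h"
  shows "integrable lborel (convolve f h)"
  using lborel_pair.integrable_snd[OF integrable_convolve_kernel[OF assms]]
  by (simp add: convolve_def[abs_def])

lemma integral_convolve:
  assumes f: "integrable lborel f" and h: "integrable lborel h"
  shows "(LINT t|lborel. convolve f h t) = (LINT t|lborel. f t) * (LINT t|lborel. h t)"
proof -
  have "(LINT t|lborel. convolve f h t) = (LINT s|lborel. LINT t|lborel. f (t - s) * h s)"
    unfolding convolve_def by (rule lborel_pair.Fubini_integral[OF integrable_convolve_kernel[OF assms]])
  also have "\<dots> = (LINT s|lborel. (LINT t|lborel. f t) * h s)"
    using integral_translate[of f] by simp
  finally show ?thesis by simp
qed

lemma convolve_norm_le:
  assumes f: "integrable lborel f" and h: "integrable lborel h"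
  shows "(LINT t|lborel. norm (convolve f h t)) \<le> (LINT t|lborel. norm (f t)) * (LINT t|lborel. norm (h t))"
proof -
  let ?f = "\<lambda>t. complex_of_real (norm (f t))" and ?h = "\<lambda>t. complex_of_real (norm (h t))"
  have int: "integrable lborel ?f" "integrable lborel ?h" using f h by auto
  have eq: "convolve ?f ?h t = of_real (LINT s|lborel. norm (f (t - s) * h s))" for t
    by (simp add: convolve_def norm_mult flip: of_real_mult)
  have "integrable lborel (\<lambda>t. LINT s|lborel. norm (f (t - s) * h s))"
    using integrable_convolve[OF int] unfolding eq by (metis complex_of_real_integrable_eq)
  then have "(LINT t|lborel. norm (convolve f h t)) \<le> (LINT t|lborel. LINT s|lborel. norm (f (t - s) * h s))"
    using integrable_convolve[OF assms]
    by (intro integral_mono integrable_norm) (auto simp: convolve_def[abs_def])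
  also have "complex_of_real \<dots> = (LINT t|lborel. ?f t) * (LINT t|lborel. ?h t)"
    using integral_convolve[OF int] unfolding eq by simp
  then have "(LINT t|lborel. LINT s|lborel. norm (f (t - s) * h s)) = (LINT t|lborel. norm (f t)) * (LINT t|lborel. norm (h t))"
    by (simp flip: of_real_mult)
  finally show ?thesis .
qed

text \<open>
  Boundedness of the middle factor makes the double integral absolutely convergent for each single
  \<open>t\<close>, so the identity holds everywhere and not only almost everywhere. Solutions of the Volterra
  equation are prescribed at every time, which is why this is needed.
\<close>

lemma convolve_assoc:
  fixes f g h :: "real \<Rightarrow> complex"
  assumes f: "integrable lborel f" and h: "integrable lborel h"
    and g[measurable]: "g \<in> borel_measurable borel" and B: "\<And>x. norm (g x) \<le> B"
  shows "convolve f (convolve g h) t = convolve (convolve f g) h t"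
proof -
  have [measurable]: "f \<in> borel_measurable borel" "h \<in> borel_measurable borel"
    using f h by (auto dest: borel_measurable_integrable)
  have ft: "integrable lborel (\<lambda>s. f (t - s))" using integrable_reflect[OF f] .
  have bd: "norm (f (t - s) * (g (s - r) * h r)) \<le> B * norm (f (t - s)) * norm (h r)" for s r
    using mult_right_mono[OF B[of "s - r"], of "norm (f (t - s)) * norm (h r)"]
    by (simp add: norm_mult mult_ac)
  have "integrable (lborel \<Otimes>\<^sub>M lborel) (\<lambda>(r, s). complex_of_real (B * norm (f (t - s)) * norm (h r)))"
  proof (rule lborel_pair.Fubini_integrable)
    show "integrable lborel (\<lambda>x. LINT y|lborel. norm (case (x, y) of (r, s) \<Rightarrow> complex_of_real (B * norm (f (t - s)) * norm (h r))))"
      using ft h by (simp add: norm_mult)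
    show "AE x in lborel. integrable lborel (\<lambda>y. case (x, y) of (r, s) \<Rightarrow> complex_of_real (B * norm (f (t - s)) * norm (h r)))"
      using ft by simp
  qed measurable
  then have int: "integrable (lborel \<Otimes>\<^sub>M lborel) (\<lambda>(r, s). f (t - s) * (g (s - r) * h r))"
  proof (rule Bochner_Integration.integrable_bound)
    show "AE x in lborel \<Otimes>\<^sub>M lborel. norm (case x of (r, s) \<Rightarrow> f (t - s) * (g (s - r) * h r))
        \<le> norm (case x of (r, s) \<Rightarrow> complex_of_real (B * norm (f (t - s)) * norm (h r)))"
      using bd order_trans[OF norm_ge_zero B] by (intro AE_I2) (auto simp: norm_mult)
  qed measurable
  have "convolve f (convolve g h) t = (LINT s|lborel. LINT r|lborel. f (t - s) * (g (s - r) * h r))"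
    by (simp add: convolve_def)
  also have "\<dots> = (LINT r|lborel. LINT s|lborel. f (t - s) * (g (s - r) * h r))"
    by (rule lborel_pair.Fubini_integral[OF int])
  also have "\<dots> = (LINT r|lborel. (LINT s|lborel. f (t - r - s) * g s) * h r)"
  proof (rule Bochner_Integration.integral_cong[OF refl])
    fix r
    have "(LINT s|lborel. f (t - s) * (g (s - r) * h r)) = (LINT s|lborel. (f (t - s) * g (s - r)) * h r)"
      by (simp add: mult.assoc)
    also have "\<dots> = (LINT s|lborel. f (t - s) * g (s - r)) * h r" by simp
    also have "(LINT s|lborel. f (t - s) * g (s - r)) = (LINT s|lborel. (\<lambda>s. f (t - r - s) * g s) (s - r))"
      by (simp add: algebra_simps)
    also have "\<dots> = (LINT s|lborel. f (t - r - s) * g s)" by (rule integral_translate)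
    finally show "(LINT s|lborel. f (t - s) * (g (s - r) * h r)) = (LINT s|lborel. f (t - r - s) * g s) * h r" .
  qed
  finally show ?thesis by (simp add: convolve_def)
qed

section \<open>Fourier transforms of integrable functions\<close>

definition fourier :: "(real \<Rightarrow> complex) \<Rightarrow> real \<Rightarrow> complex" where
  "fourier m \<omega> = (LINT t|lborel. m t * cis (- (\<omega> * t)))"

lemma integrable_mult_cis:
  fixes m :: "real \<Rightarrow> complex"
  assumes "integrable lborel m" shows "integrable lborel (\<lambda>t. m t * cis (\<omega> * t))"
proof (rule Bochner_Integration.integrable_bound[OF assms])
  have [measurable]: "m \<in> borel_measurable borel" "cis \<in> borel_measurable borel"
    using assms by (auto dest: borel_measurable_integrable intro!: borel_measurable_continuous_onI continuous_intros)
  show "(\<lambda>t. m t * cis (\<omega> * t)) \<in> borel_measurable lborel" by measurable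
qed (simp add: norm_mult)

lemma fourier_convolve:
  assumes f: "integrable lborel f" and h: "integrable lborel h"
  shows "fourier (convolve f h) \<omega> = fourier f \<omega> * fourier h \<omega>"
proof -
  let ?e = "\<lambda>m t. m t * cis (- \<omega> * t)"
  have "convolve (?e f) (?e h) t = convolve f h t * cis (- \<omega> * t)" for t
  proof -
    have "?e f (t - s) * ?e h s = (f (t - s) * h s) * cis (- \<omega> * t)" for s
    proof -
      have "cis (- \<omega> * (t - s)) * cis (- \<omega> * s) = cis (- \<omega> * t)"
        by (simp add: cis_mult algebra_simps)
      then show ?thesis by (simp add: algebra_simps)
    qed
    then show ?thesis unfolding convolve_def by (simp only: integral_mult_left_zero)
  qed
  moreover have "integrable lborel (?e f)" "integrable lborel (?e h)"
    using f h by (auto intro: integrable_mult_cis[of _ "- \<omega>", simplified])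
  ultimately show ?thesis
    using integral_convolve[of "?e f" "?e h"] by (simp add: fourier_def)
qed

text \<open>
  Membership in the algebra of Fourier transforms of integrable functions, together with a bound on
  the norm. Keeping the bound explicit reduces convergence of series in the algebra to summability of
  real numbers.
\<close>

definition wiener :: "(real \<Rightarrow> complex) \<Rightarrow> real \<Rightarrow> bool" where
  "wiener F c \<longleftrightarrow> (\<exists>m. integrable lborel m \<and> (LINT t|lborel. norm (m t)) \<le> c \<and> F = fourier m)"

lemma wiener_mult:
  assumes "wiener F c" "wiener G d" shows "wiener (\<lambda>\<omega>. F \<omega> * G \<omega>) (c * d)"
proof -
  obtain m n where m: "integrable lborel m" "(LINT t|lborel. norm (m t)) \<le> c" "F = fourier m"
    and n: "integrable lborel n" "(LINT t|lborel. norm (n t)) \<le> d" "G = fourier n"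
    using assms by (auto simp: wiener_def)
  have "(LINT t|lborel. norm (convolve m n t)) \<le> c * d"
    using m n by (intro order_trans[OF convolve_norm_le] mult_mono)
      (auto intro!: Bochner_Integration.integral_nonneg order_trans[OF Bochner_Integration.integral_nonneg m(2)])
  then show ?thesis
    using m n unfolding wiener_def
    by (intro exI[of _ "convolve m n"]) (auto simp: integrable_convolve fourier_convolve)
qed

lemma wiener_power:
  assumes "wiener F c" "n > 0" shows "wiener (\<lambda>\<omega>. F \<omega> ^ n) (c ^ n)"
  using assms(2)
proof (induction n rule: nat_induct_non_zero)
  case (Suc n)
  then show ?case using wiener_mult[OF assms(1) Suc.IH] by simp
qed (use assms(1) in simp)

lemma wiener_add:
  assumes "wiener F c" "wiener G d" shows "wiener (\<lambda>\<omega>. F \<omega> + G \<omega>) (c + d)"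
proof -
  obtain m n where m: "integrable lborel m" "(LINT t|lborel. norm (m t)) \<le> c" "F = fourier m"
    and n: "integrable lborel n" "(LINT t|lborel. norm (n t)) \<le> d" "G = fourier n"
    using assms by (auto simp: wiener_def)
  have "(LINT t|lborel. norm (m t + n t)) \<le> (LINT t|lborel. norm (m t) + norm (n t))"
    using m n by (intro integral_mono) (auto intro: norm_triangle_ineq)
  also have "\<dots> \<le> c + d" using m n by simp
  finally have "(LINT t|lborel. norm (m t + n t)) \<le> c + d" .
  moreover have "fourier m \<omega> + fourier n \<omega> = fourier (\<lambda>t. m t + n t) \<omega>" for \<omega>
    using integrable_mult_cis[OF m(1), of "-\<omega>"] integrable_mult_cis[OF n(1), of "-\<omega>"]
    by (simp add: fourier_def distrib_right)
  ultimately show ?thesis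
    using m n unfolding wiener_def by (intro exI[of _ "\<lambda>t. m t + n t"]) auto
qed

lemma wiener_mono: "wiener F c \<Longrightarrow> c \<le> d \<Longrightarrow> wiener F d"
  unfolding wiener_def by fastforce

text \<open>
  Completeness of \<open>L\<^sup>1\<close>: the norms of the summands have a summable integral, so the series of
  functions converges absolutely at almost every point and may be integrated term by term.
\<close>

lemma wiener_sums:
  assumes W: "\<And>n. wiener (F n) (c n)" and c: "summable c"
    and G: "\<And>\<omega>. (\<lambda>n. F n \<omega>) sums G \<omega>"
  shows "\<exists>d. wiener G d"
proof -
  from W obtain m where m: "\<And>n. integrable lborel (m n)"
      "\<And>n. (LINT t|lborel. norm (m n t)) \<le> c n" "\<And>n. F n = fourier (m n)"
    unfolding wiener_def by metis
  have [measurable]: "m n \<in> borel_measurable borel" for n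
    using m(1)[of n] by (auto dest: borel_measurable_integrable)
  have s: "summable (\<lambda>n. LINT t|lborel. norm (m n t))"
    by (rule summable_comparison_test'[OF c, of 0]) (use m(2) in simp)
  have "(\<integral>\<^sup>+t. (\<Sum>n. ennreal (norm (m n t))) \<partial>lborel) = (\<Sum>n. \<integral>\<^sup>+t. ennreal (norm (m n t)) \<partial>lborel)"
    by (rule nn_integral_suminf) measurable
  also have "\<dots> = (\<Sum>n. ennreal (LINT t|lborel. norm (m n t)))"
    by (intro arg_cong[where f=suminf] ext nn_integral_eq_integral) (auto simp: m(1))
  also have "\<dots> \<noteq> \<infinity>"
    unfolding infinity_ennreal_def by (rule ennreal_suminf_neq_top[OF s]) simp
  finally have "AE t in lborel. (\<Sum>n. ennreal (norm (m n t))) \<noteq> \<infinity>"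
    by (intro nn_integral_PInf_AE) auto
  then have ae: "AE t in lborel. summable (\<lambda>n. norm (m n t))"
    by eventually_elim (auto intro: summable_suminf_not_top)
  define M where "M t = (\<Sum>n. m n t)" for t
  have iM: "integrable lborel M" unfolding M_def by (rule integrable_suminf[OF m(1) ae s])
  have "G \<omega> = fourier M \<omega>" for \<omega>
  proof -
    have i: "integrable lborel (\<lambda>t. m n t * cis (- (\<omega> * t)))" for n
      using integrable_mult_cis[OF m(1), of n "-\<omega>"] by simp
    have "(\<lambda>n. F n \<omega>) sums (LINT t|lborel. (\<Sum>n. m n t * cis (- (\<omega> * t))))"
      unfolding m(3) fourier_def
    proof (rule sums_integral[OF i])
      show "AE t in lborel. summable (\<lambda>n. norm (m n t * cis (- (\<omega> * t))))"
        using ae by (simp add: norm_mult)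
      show "summable (\<lambda>n. LINT t|lborel. norm (m n t * cis (- (\<omega> * t))))"
        using s by (simp add: norm_mult)
    qed
    also have "(LINT t|lborel. (\<Sum>n. m n t * cis (- (\<omega> * t)))) = fourier M \<omega>"
      unfolding fourier_def M_def
    proof (rule integral_cong_AE)
      show "AE t in lborel. (\<Sum>n. m n t * cis (- (\<omega> * t))) = (\<Sum>n. m n t) * cis (- (\<omega> * t))"
        using ae by eventually_elim (auto intro!: suminf_mult2[symmetric] summable_norm_cancel)
      have [measurable]: "cis \<in> borel_measurable borel"
        by (auto intro!: borel_measurable_continuous_onI continuous_intros)
      show "(\<lambda>t. \<Sum>n. m n t * cis (- (\<omega> * t))) \<in> borel_measurable lborel"
           "(\<lambda>t. (\<Sum>n. m n t) * cis (- (\<omega> * t))) \<in> borel_measurable lborel"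
        by measurable
    qed
    finally show ?thesis using G[of \<omega>] sums_unique2 by blast
  qed
  then have "G = fourier M" by blast
  then show ?thesis using iM unfolding wiener_def by blast
qed

text \<open>
  The positive and the negative part of \<open>u\<close> have equal transforms, in particular equal mass. If the
  mass is zero, both vanish; otherwise, divided by it, they become probability densities with the same characteristic function, and Levy's
  uniqueness theorem identifies them.
\<close>

lemma fourier_zero_real:
  fixes u :: "real \<Rightarrow> real"
  assumes u: "integrable lborel u" and z: "\<And>\<omega>. fourier (\<lambda>t. of_real (u t)) \<omega> = 0"
  shows "AE t in lborel. u t = 0"
proof -
  have [measurable]: "u \<in> borel_measurable borel" using u by (auto dest: borel_measurable_integrable)
  define p where "p t = max 0 (u t)" for t
  define n where "n t = max 0 (- u t)" for t
  have [measurable]: "p \<in> borel_measurable borel" "n \<in> borel_measurable borel"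
    unfolding p_def[abs_def] n_def[abs_def] by measurable
  have pn: "p t \<ge> 0" "n t \<ge> 0" "u t = p t - n t" for t by (auto simp: p_def n_def)
  have ip: "integrable lborel p" "integrable lborel n"
    unfolding p_def[abs_def] n_def[abs_def] using u by (auto intro!: integrable_max)
  have eqF: "fourier (\<lambda>t. of_real (p t)) \<omega> = fourier (\<lambda>t. of_real (n t)) \<omega>" for \<omega>
  proof -
    have "fourier (\<lambda>t. of_real (u t)) \<omega> = fourier (\<lambda>t. of_real (p t)) \<omega> - fourier (\<lambda>t. of_real (n t)) \<omega>"
      using integrable_mult_cis[of "\<lambda>t. of_real (p t)" "-\<omega>"] integrable_mult_cis[of "\<lambda>t. of_real (n t)" "-\<omega>"] ip
      by (simp add: fourier_def pn(3) left_diff_distrib)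
    then show ?thesis using z[of \<omega>] by simp
  qed
  define c where "c = (LINT t|lborel. p t)"
  have "complex_of_real c = of_real (LINT t|lborel. n t)" using eqF[of 0] by (simp add: fourier_def c_def)
  then have cn: "c = (LINT t|lborel. n t)" using of_real_eq_iff by blast
  have "AE t in lborel. p t = n t"
  proof (cases "c = 0")
    case True
    then have "AE t in lborel. p t = 0" "AE t in lborel. n t = 0"
      using integral_nonneg_eq_0_iff_AE[OF ip(1)] integral_nonneg_eq_0_iff_AE[OF ip(2)] pn cn
      by (auto simp: c_def)
    then show ?thesis by eventually_elim simp
  next
    case False
    have "c \<ge> 0" unfolding c_def using pn by (intro Bochner_Integration.integral_nonneg) auto
    with False have c: "c > 0" by simp
    have dist: "real_distribution (density lborel (\<lambda>t. ennreal (v t / c)))"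
      and chr: "char (density lborel (\<lambda>t. ennreal (v t / c))) \<omega> = fourier (\<lambda>t. of_real (v t)) (- \<omega>) / c"
      if v: "\<And>t. v t \<ge> 0" "integrable lborel v" "c = (LINT t|lborel. v t)" for v \<omega>
    proof -
      have [measurable]: "v \<in> borel_measurable borel" using v(2) by (auto dest: borel_measurable_integrable)
      have "emeasure (density lborel (\<lambda>t. ennreal (v t / c))) UNIV = (\<integral>\<^sup>+t. ennreal (v t / c) \<partial>lborel)"
        by (simp add: emeasure_density)
      also have "\<dots> = ennreal (LINT t|lborel. v t / c)"
        using v c by (intro nn_integral_eq_integral) auto
      also have "\<dots> = 1" using v(3) c by simp
      finally have "prob_space (density lborel (\<lambda>t. ennreal (v t / c)))" by (intro prob_spaceI) simp
      then show "real_distribution (density lborel (\<lambda>t. ennreal (v t / c)))"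
        by (simp add: real_distribution_def real_distribution_axioms_def)
      have "char (density lborel (\<lambda>t. ennreal (v t / c))) \<omega> = (LINT t|lborel. (v t / c) *\<^sub>R iexp (\<omega> * t))"
        unfolding char_def using v(1) c by (subst integral_density) auto
      also have "\<dots> = (LINT t|lborel. of_real (v t) * cis (- (- \<omega> * t)) / c)"
        by (intro Bochner_Integration.integral_cong refl) (simp add: cis_conv_exp scaleR_conv_of_real)
      finally show "char (density lborel (\<lambda>t. ennreal (v t / c))) \<omega> = fourier (\<lambda>t. of_real (v t)) (- \<omega>) / c"
        by (simp add: fourier_def)
    qed
    have "density lborel (\<lambda>t. ennreal (p t / c)) = density lborel (\<lambda>t. ennreal (n t / c))"
    proof (rule Levy_uniqueness)
      show "char (density lborel (\<lambda>t. ennreal (p t / c))) = char (density lborel (\<lambda>t. ennreal (n t / c)))"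
        using chr[of p] chr[of n] pn ip cn eqF by (simp add: c_def fun_eq_iff)
    qed (use dist[of p] dist[of n] pn ip cn in \<open>auto simp: c_def\<close>)
    then have "AE t in lborel. ennreal (p t / c) = ennreal (n t / c)"
      by (intro sigma_finite_measure.density_unique[OF sigma_finite_lborel]) auto
    then show ?thesis
    proof eventually_elim
      case (elim t)
      then have "p t / c = n t / c" using pn[of t] c by (subst (asm) ennreal_inj) auto
      then show ?case using c by simp
    qed
  qed
  then show ?thesis by eventually_elim (simp add: pn(3))
qed

text \<open>
  The transform of the complex conjugate at \<open>\<omega>\<close> is the conjugate of the transform at \<open>- \<omega>\<close>,
  so the real and the imaginary part have vanishing transforms as well.
\<close>

lemma fourier_inj:
  fixes d :: "real \<Rightarrow> complex"
  assumes d: "integrable lborel d" and z: "\<And>\<omega>. fourier d \<omega> = 0"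
  shows "AE t in lborel. d t = 0"
proof -
  note i = integrable_mult_cis[OF d]
  have zc: "(LINT t|lborel. cnj (d t) * cis (- (\<omega> * t))) = 0" for \<omega>
  proof -
    have "(LINT t|lborel. cnj (d t) * cis (- (\<omega> * t))) = (LINT t|lborel. cnj (d t * cis (- (- \<omega> * t))))"
      by (simp add: cis_cnj)
    also have "\<dots> = cnj (fourier d (- \<omega>))" unfolding fourier_def by (rule Bochner_Integration.integral_cnj)
    finally show ?thesis using z by simp
  qed
  have ic: "integrable lborel (\<lambda>t. cnj (d t) * cis (- (\<omega> * t)))" for \<omega>
    using integrable_mult_cis[of "\<lambda>t. cnj (d t)" "-\<omega>"] d by (simp add: integrable_cnj)
  have "fourier (\<lambda>t. of_real (Re (d t))) \<omega> = 0" for \<omega>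
  proof -
    have "fourier (\<lambda>t. of_real (Re (d t))) \<omega> = (LINT t|lborel. (d t * cis (- (\<omega> * t)) + cnj (d t) * cis (- (\<omega> * t))) / 2)"
      unfolding fourier_def
      by (intro Bochner_Integration.integral_cong refl) (simp add: distrib_right[symmetric] complex_add_cnj)
    also have "\<dots> = (fourier d \<omega> + (LINT t|lborel. cnj (d t) * cis (- (\<omega> * t)))) / 2"
      using i[of "-\<omega>"] ic[of \<omega>] by (simp add: fourier_def)
    finally show ?thesis using z zc by simp
  qed
  then have 1: "AE t in lborel. Re (d t) = 0" using d by (intro fourier_zero_real) auto
  have "fourier (\<lambda>t. of_real (Im (d t))) \<omega> = 0" for \<omega>
  proof -
    have "fourier (\<lambda>t. of_real (Im (d t))) \<omega> = (LINT t|lborel. (d t * cis (- (\<omega> * t)) - cnj (d t) * cis (- (\<omega> * t))) / (2 * \<i>))"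
      unfolding fourier_def
    proof (intro Bochner_Integration.integral_cong refl)
      fix t
      have "complex_of_real (Im (d t)) = (d t - cnj (d t)) / (2 * \<i>)" unfolding complex_diff_cnj by (simp add: complex_eq_iff)
      then show "complex_of_real (Im (d t)) * cis (- (\<omega> * t)) = (d t * cis (- (\<omega> * t)) - cnj (d t) * cis (- (\<omega> * t))) / (2 * \<i>)"
        by (simp only: left_diff_distrib[symmetric] times_divide_eq_left)
    qed
    also have "\<dots> = (fourier d \<omega> - (LINT t|lborel. cnj (d t) * cis (- (\<omega> * t)))) / (2 * \<i>)"
      using i[of "-\<omega>"] ic[of \<omega>] by (simp add: fourier_def)
    finally show ?thesis using z zc by simp
  qed
  then have 2: "AE t in lborel. Im (d t) = 0" using d by (intro fourier_zero_real) auto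
  show ?thesis using 1 2 by eventually_elim (simp add: complex_eq_iff)
qed

section \<open>Exponentials on the half-line\<close>

lemma integrable_ray_iff:
  fixes f :: "real \<Rightarrow> 'a::{banach, second_countable_topology}"
  assumes [measurable]: "f \<in> borel_measurable borel"
  shows "set_integrable lborel {0<..} f \<longleftrightarrow> set_integrable lborel {0..} f"
    and "(LINT t:{0<..}|lborel. f t) = (LINT t:{0..}|lborel. f t)"
proof -
  have ae: "AE t in lborel. indicator {0<..} t *\<^sub>R f t = indicator {0..} t *\<^sub>R f t"
    using AE_lborel_singleton[of "0::real"] by eventually_elim (auto simp: indicator_def)
  show "set_integrable lborel {0<..} f \<longleftrightarrow> set_integrable lborel {0..} f"
    unfolding set_integrable_def by (rule integrable_cong_AE[OF _ _ ae]) measurable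
  show "(LINT t:{0<..}|lborel. f t) = (LINT t:{0..}|lborel. f t)"
    unfolding set_lebesgue_integral_def by (rule integral_cong_AE[OF _ _ ae]) measurable
qed

lemma exp_ray_integrable:
  assumes "u > (0::real)" shows "set_integrable lborel {0..} (\<lambda>t. exp (- (t * u)))"
  using integrable_I0i_exp_mscale[OF assms] by (subst integrable_ray_iff(1)[symmetric]) auto

lemma cexp_ray_integrable:
  assumes "Re c > 0" shows "set_integrable lborel {0..} (\<lambda>t. exp (- (of_real t * c)))"
  unfolding set_integrable_def
proof (rule Bochner_Integration.integrable_bound[OF exp_ray_integrable[OF assms, unfolded set_integrable_def]])
  show "AE t in lborel. norm (indicator {0..} t *\<^sub>R exp (- (complex_of_real t * c)))
      \<le> norm (indicator {0..} t *\<^sub>R exp (- (t * Re c)))"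
    by (simp add: indicator_def)
qed measurable

lemma cexp_ray_integral:
  assumes c: "Re c > 0" shows "(LINT t:{0..}|lborel. exp (- (of_real t * c))) = 1 / c"
proof -
  let ?F = "\<lambda>t. - exp (- (complex_of_real t * c)) / c"
  have c0: "c \<noteq> 0" using c by auto
  have "(LBINT t=0..\<infinity>. exp (- (complex_of_real t * c))) = 0 - ?F 0"
  proof (rule interval_integral_FTC_integrable)
    show "(?F has_vector_derivative exp (- (complex_of_real t * c))) (at t)" for t
      using c0 by (auto intro!: derivative_eq_intros has_vector_derivative_real_field simp: field_simps)
    show "isCont (\<lambda>t. exp (- (complex_of_real t * c))) t" for t by (intro continuous_intros)
    show "set_integrable lborel (einterval 0 \<infinity>) (\<lambda>t. exp (- (complex_of_real t * c)))"
      using cexp_ray_integrable[OF c] by (subst (asm) integrable_ray_iff(1)[symmetric]) (auto simp: zero_ereal_def)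
    show "((?F \<circ> real_of_ereal) \<longlongrightarrow> 0) (at_left \<infinity>)"
      unfolding ereal_tendsto_simps
    proof (rule tendsto_norm_zero_cancel)
      have "((\<lambda>t. exp (- (t * Re c))) \<longlongrightarrow> 0) at_top"
        using c by real_asymp
      then have "((\<lambda>t. exp (- (t * Re c)) / norm c) \<longlongrightarrow> 0) at_top"
        by (rule tendsto_divide_zero)
      then show "((\<lambda>t. norm (?F t)) \<longlongrightarrow> 0) at_top"
        by (simp add: norm_divide)
    qed
    show "((?F \<circ> real_of_ereal) \<longlongrightarrow> ?F 0) (at_right 0)"
      unfolding zero_ereal_def ereal_tendsto_simps using c0 by (intro tendsto_intros)
  qed simp
  then show ?thesis
    using integrable_ray_iff(2)[of "\<lambda>t. exp (- (complex_of_real t * c))"]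
    by (simp add: interval_lebesgue_integral_def zero_ereal_def)
qed

lemma exp_ray_integral:
  assumes "u > (0::real)" shows "(LINT t:{0..}|lborel. exp (- (t * u))) = 1 / u"
proof -
  have "complex_of_real (LINT t:{0..}|lborel. exp (- (t * u))) = (LINT t:{0..}|lborel. exp (- (of_real t * of_real u)))"
    unfolding set_lebesgue_integral_def
    by (subst integral_complex_of_real[symmetric])
       (auto intro!: Bochner_Integration.integral_cong simp: scaleR_conv_of_real exp_of_real simp flip: of_real_mult of_real_minus)
  also have "\<dots> = of_real (1 / u)" using assms by (subst cexp_ray_integral) auto
  finally show ?thesis using of_real_eq_iff by blast
qed

lemma power_exp_ray_integrable:
  assumes u: "u > (0::real)"
  shows "set_integrable lborel {0..} (\<lambda>t. t ^ j * exp (- (t * u)))"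
proof -
  have "integrable lborel (\<lambda>t::real. t ^ j * exp (- t) * indicator {0..} t)"
    using has_bochner_integral_I0i_power_exp_m'[of j] by (rule integrable.intros)
  from lborel_integrable_real_affine[OF this, of u 0]
  have "integrable lborel (\<lambda>t::real. (u * t) ^ j * exp (- (u * t)) * indicator {0..} (u * t) / u ^ j)"
    using u by (intro integrable_divide_zero) simp
  moreover have "(u * t) ^ j * exp (- (u * t)) * indicator {0..} (u * t) / u ^ j
      = indicator {0..} t *\<^sub>R (t ^ j * exp (- (t * u)))" for t
    using u by (simp add: indicator_def power_mult_distrib zero_le_mult_iff mult.commute)
  ultimately show ?thesis unfolding set_integrable_def by (simp only:)
qed

lemma power_cexp_ray_integrable:
  assumes c: "Re c > 0"
  shows "set_integrable lborel {0..} (\<lambda>t. of_real t ^ j * exp (- (of_real t * c)))"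
proof (rule set_integrable_bound[OF power_exp_ray_integrable[OF c, of j]])
  show "set_borel_measurable lborel {0..} (\<lambda>t. of_real t ^ j * exp (- (complex_of_real t * c)))"
    unfolding set_borel_measurable_def by measurable
qed (auto simp: norm_mult norm_power)

lemma power_exp_ray_tendsto_0:
  assumes u: "u > (0::real)"
  shows "((\<lambda>t. t ^ j * exp (- (t * u))) \<longlongrightarrow> 0) at_top"
proof -
  have "filterlim (\<lambda>t. u * t) at_top at_top"
    using u by (intro filterlim_tendsto_pos_mult_at_top[OF tendsto_const _ filterlim_ident])
  from filterlim_compose[OF tendsto_power_div_exp_0 this, of j]
  have "((\<lambda>t. (u * t) ^ j / exp (u * t) / u ^ j) \<longlongrightarrow> 0 / u ^ j) at_top"
    using u by (intro tendsto_divide tendsto_const) auto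
  moreover have "(u * t) ^ j / exp (u * t) / u ^ j = t ^ j * exp (- (t * u))" for t
    using u by (simp add: power_mult_distrib exp_minus field_simps)
  ultimately show ?thesis by simp
qed

text \<open>
  Integration by parts: the derivative of \<open>- t ^ (j + 1) * exp (- t c) / c\<close> is the integrand for
  \<open>j + 1\<close> minus \<open>(j + 1) / c\<close> times the one for \<open>j\<close>, and its boundary values vanish.
\<close>

lemma power_cexp_ray_integral:
  assumes c: "Re c > 0"
  shows "(LINT t:{0..}|lborel. of_real t ^ j * exp (- (of_real t * c))) = fact j / c ^ Suc j"
proof (induction j)
  case 0
  then show ?case using cexp_ray_integral[OF c] by simp
next
  case (Suc j)
  have c0: "c \<noteq> 0" using c by auto
  let ?g = "\<lambda>j t. complex_of_real t ^ j * exp (- (of_real t * c))"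
  let ?F = "\<lambda>t. - ?g (Suc j) t / c"
  let ?f = "\<lambda>t. ?g (Suc j) t - (of_nat (Suc j) / c) * ?g j t"
  have int: "set_integrable lborel {0..} ?f"
    by (intro set_integral_diff(1) set_integrable_mult_right power_cexp_ray_integrable c)
  have fm: "?f \<in> borel_measurable borel" by measurable
  have "(LBINT t=0..\<infinity>. ?f t) = 0 - ?F 0"
  proof (rule interval_integral_FTC_integrable)
    show "(?F has_vector_derivative ?f t) (at t)" for t
    proof -
      have "((\<lambda>z. - (z ^ Suc j * exp (- (z * c))) / c) has_field_derivative ?f t) (at (of_real t))"
        using c0 by (auto intro!: derivative_eq_intros simp: field_simps simp del: power_Suc of_nat_Suc)
      then show ?thesis by (rule has_vector_derivative_real_field)
    qed
    show "isCont ?f t" for t by (intro continuous_intros)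
    show "set_integrable lborel (einterval 0 \<infinity>) ?f"
      using int integrable_ray_iff(1)[OF fm] by (simp add: zero_ereal_def)
    show "((?F \<circ> real_of_ereal) \<longlongrightarrow> 0) (at_left \<infinity>)"
      unfolding ereal_tendsto_simps
    proof (rule tendsto_norm_zero_cancel, rule Lim_transform_eventually)
      show "((\<lambda>t. t ^ Suc j * exp (- (t * Re c)) / norm c) \<longlongrightarrow> 0) at_top"
        by (rule tendsto_divide_zero[OF power_exp_ray_tendsto_0[OF c]])
      show "eventually (\<lambda>t. t ^ Suc j * exp (- (t * Re c)) / norm c = norm (?F t)) at_top"
        using eventually_ge_at_top[of "0::real"]
        by eventually_elim (simp add: norm_divide norm_mult norm_power)
    qed
    show "((?F \<circ> real_of_ereal) \<longlongrightarrow> ?F 0) (at_right 0)"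
      unfolding zero_ereal_def ereal_tendsto_simps using c0 by (intro tendsto_intros)
  qed simp
  then have "(LINT t:{0..}|lborel. ?f t) = 0"
    using integrable_ray_iff(2)[OF fm] by (simp add: interval_lebesgue_integral_def zero_ereal_def)
  moreover have "(LINT t:{0..}|lborel. ?f t) = (LINT t:{0..}|lborel. ?g (Suc j) t) - (of_nat (Suc j) / c) * (LINT t:{0..}|lborel. ?g j t)"
    by (subst set_integral_diff(2)) (intro set_integrable_mult_right power_cexp_ray_integrable c | simp only: set_integral_mult_right)+
  ultimately have "(LINT t:{0..}|lborel. ?g (Suc j) t) = (of_nat (Suc j) / c) * (fact j / c ^ Suc j)"
    unfolding Suc.IH by simp
  also have "\<dots> = fact (Suc j) / c ^ Suc (Suc j)" by (simp add: fact_Suc)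
  finally show ?case .
qed

section \<open>Cauchy's formula on a strip\<close>

lemma integrable_inverse_square: "integrable lborel (\<lambda>x::real. inverse (1 + x\<^sup>2))"
  and integral_inverse_square: "(LINT x|lborel. inverse (1 + x\<^sup>2)) = pi"
  using integrable_inverse_1_plus_square LBINT_inverse_1_plus_square
  by (auto simp: interval_lebesgue_integral_def set_integrable_def set_lebesgue_integral_def)

text \<open>
  Cauchy's formula on the rectangle with corners \<open>\<plusminus>e \<plusminus> \<i>n\<close>. The quadratic decay of \<open>H\<close> makes the
  horizontal sides disappear as \<open>n\<close> grows and the vertical integrals converge.
\<close>

lemma Cauchy_strip:
  fixes H :: "complex \<Rightarrow> complex"
  assumes e: "e > 0" and H: "H holomorphic_on {z. \<bar>Re z\<bar> < 2 * e}"
    and bd: "\<And>z. \<bar>Re z\<bar> < 2 * e \<Longrightarrow> norm (H z) \<le> C / (1 + (Im z)\<^sup>2)"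
    and z: "Re z = 0"
  shows "2 * pi * H z = (LINT \<omega>|lborel. H (Complex e \<omega>) / (Complex e \<omega> - z))
     - (LINT \<omega>|lborel. H (Complex (-e) \<omega>) / (Complex (-e) \<omega> - z))"
proof -
  define f where "f w = H w / (w - z)" for w
  let ?S = "{z. \<bar>Re z\<bar> < 2 * e}"
  have S: "convex ?S" "open ?S"
  proof -
    have eq: "?S = {z. Re z < 2 * e} \<inter> {z. Re z > - (2 * e)}" by auto
    show "convex ?S" unfolding eq by (intro convex_Int convex_halfspace_Re_lt convex_halfspace_Re_gt)
    show "open ?S" unfolding eq by (intro open_Int open_halfspace_Re_lt open_halfspace_Re_gt)
  qed
  have C: "C \<ge> 0" using order_trans[OF norm_ge_zero bd[of 0]] e by simp
  have contH: "continuous_on ?S H" using H by (rule holomorphic_on_imp_continuous_on)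
  have cont: "continuous_on UNIV (\<lambda>\<omega>. f (Complex x \<omega>))" if "\<bar>x\<bar> = e" for x
    unfolding f_def using that e z
    by (intro continuous_intros continuous_on_compose2[OF contH]) (auto simp: complex_eq_iff)
  have bound: "norm (f (Complex x \<omega>)) \<le> C / e * inverse (1 + \<omega>\<^sup>2)" if "\<bar>x\<bar> = e" for x \<omega>
  proof -
    have "e \<le> norm (Complex x \<omega> - z)" using abs_Re_le_cmod[of "Complex x \<omega> - z"] that z by simp
    then have "norm (f (Complex x \<omega>)) \<le> (C / (1 + \<omega>\<^sup>2)) / e"
      unfolding f_def norm_divide using bd[of "Complex x \<omega>"] that e C by (intro frac_le) auto
    then show ?thesis by (simp add: field_simps)
  qed
  have int: "integrable lborel (\<lambda>\<omega>. f (Complex x \<omega>))" if "\<bar>x\<bar> = e" for x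
  proof (rule Bochner_Integration.integrable_bound)
    show "integrable lborel (\<lambda>\<omega>::real. C / e * inverse (1 + \<omega>\<^sup>2))"
      using integrable_inverse_square by simp
    show "(\<lambda>\<omega>. f (Complex x \<omega>)) \<in> borel_measurable lborel"
      using cont[OF that] by (simp add: borel_measurable_continuous_onI)
    show "AE \<omega> in lborel. norm (f (Complex x \<omega>)) \<le> norm (C / e * inverse (1 + \<omega>\<^sup>2))"
      using order_trans[OF bound[OF that] abs_ge_self] by simp
  qed
  have lim: "(\<lambda>n. integral {- real n..real n} (\<lambda>\<omega>. f (Complex x \<omega>))) \<longlonglongrightarrow> (LINT \<omega>|lborel. f (Complex x \<omega>))"
    if x: "\<bar>x\<bar> = e" for x
  proof -
    have "(\<lambda>n. LINT \<omega>|lborel. indicator {- real n..real n} \<omega> *\<^sub>R f (Complex x \<omega>)) \<longlonglongrightarrow> (LINT \<omega>|lborel. f (Complex x \<omega>))"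
    proof (rule integral_dominated_convergence)
      have [measurable]: "(\<lambda>\<omega>. f (Complex x \<omega>)) \<in> borel_measurable borel"
        using cont[OF x] by (simp add: borel_measurable_continuous_onI)
      show "integrable lborel (\<lambda>\<omega>. norm (f (Complex x \<omega>)))" using int[OF x] by simp
      show "AE \<omega> in lborel. (\<lambda>n. indicator {- real n..real n} \<omega> *\<^sub>R f (Complex x \<omega>)) \<longlonglongrightarrow> f (Complex x \<omega>)"
      proof (rule AE_I2)
        fix \<omega> :: real
        have "eventually (\<lambda>n. indicator {- real n..real n} \<omega> *\<^sub>R f (Complex x \<omega>) = f (Complex x \<omega>)) sequentially"
          using eventually_ge_at_top[of "nat \<lceil>\<bar>\<omega>\<bar>\<rceil>"] by eventually_elim (auto simp: indicator_def; linarith)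
        then show "(\<lambda>n. indicator {- real n..real n} \<omega> *\<^sub>R f (Complex x \<omega>)) \<longlonglongrightarrow> f (Complex x \<omega>)"
          by (rule tendsto_eventually)
      qed
      show "(\<lambda>\<omega>. f (Complex x \<omega>)) \<in> borel_measurable lborel"
        "\<And>n. (\<lambda>\<omega>. indicator {- real n..real n} \<omega> *\<^sub>R f (Complex x \<omega>)) \<in> borel_measurable lborel" by measurable
    qed (auto simp: indicator_def)
    moreover have "(LINT \<omega>|lborel. indicator {- real n..real n} \<omega> *\<^sub>R f (Complex x \<omega>))
        = integral {- real n..real n} (\<lambda>\<omega>. f (Complex x \<omega>))" for n
    proof -
      have "set_integrable lborel {- real n..real n} (\<lambda>\<omega>. f (Complex x \<omega>))"
        unfolding set_integrable_def using integrable_mult_indicator[OF _ int[OF x]] by simp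
      from set_borel_integral_eq_integral(2)[OF this] show ?thesis
        by (simp add: set_lebesgue_integral_def)
    qed
    ultimately show ?thesis by simp
  qed
  have holf: "f holomorphic_on ?S - {z}"
    unfolding f_def by (intro holomorphic_intros holomorphic_on_subset[OF H]) auto
  have hbound: "norm (contour_integral (linepath a b) f) \<le> C / real n * (2 * e)"
    if n: "real n \<ge> \<bar>Im z\<bar> + 1" and ab: "Re a \<in> {-e, e}" "Re b = - Re a" "\<bar>Im a\<bar> = n" "Im b = Im a" for a b n
  proof -
    have seg: "\<bar>Re w\<bar> \<le> e \<and> Im w = Im a" if "w \<in> closed_segment a b" for w
    proof -
      have "closed_segment a b = {w. Im w = Im a \<and> Re w \<in> closed_segment (Re a) (Re b)}"
        using ab by (intro closed_segment_same_Im) simp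
      then have "Im w = Im a" "Re w \<in> closed_segment (Re a) (Re b)" using that by auto
      then show ?thesis using ab e by (auto simp: closed_segment_eq_real_ivl split: if_splits)
    qed
    have n1: "real n \<ge> 1" using n by simp
    have zn: "1 \<le> norm (w - z)" if "w \<in> closed_segment a b" for w
      using abs_Im_le_cmod[of "w - z"] seg[OF that] n ab by simp
    have "norm (contour_integral (linepath a b) f) \<le> C / real n * norm (b - a)"
    proof (rule contour_integral_bound_linepath)
      show "f contour_integrable_on linepath a b"
        using zn seg e
        by (intro contour_integrable_continuous_linepath continuous_on_subset[OF holomorphic_on_imp_continuous_on[OF holf]]) force
      show "norm (f w) \<le> C / real n" if w: "w \<in> closed_segment a b" for w
      proof -
        have "norm (H w) \<le> C / (1 + (Im w)\<^sup>2)" using bd[of w] seg[OF w] e by auto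
        also have "\<dots> = C / (1 + (real n)\<^sup>2)" using seg[OF w] ab(3) by (metis power2_abs)
        also have "\<dots> \<le> C / real n" using n1 C order_trans[OF self_le_power[OF n1, of 2], of "1 + (real n)\<^sup>2"] by (intro frac_le) auto
        finally have "norm (H w) / norm (w - z) \<le> (C / real n) / 1"
          using zn[OF w] C n1 by (intro frac_le) auto
        then show ?thesis by (simp add: f_def norm_divide)
      qed
    qed (use C in auto)
    also have "norm (b - a) = 2 * e"
    proof -
      have "b - a = complex_of_real (Re b - Re a)" using ab by (simp add: complex_eq_iff)
      then show ?thesis using ab e by (auto simp only: norm_of_real)
    qed
    finally show ?thesis .
  qed
  let ?l = "\<lambda>a b. contour_integral (linepath a b) f"
  have rect: "2 * pi * \<i> * H z = ?l (Complex (-e) (-n)) (Complex e (-n))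
       + \<i> * integral {- n..n} (\<lambda>\<omega>. f (Complex e \<omega>))
       + ?l (Complex e n) (Complex (-e) n)
       - \<i> * integral {- n..n} (\<lambda>\<omega>. f (Complex (-e) \<omega>))" if n: "n \<ge> \<bar>Im z\<bar> + 1" for n
  proof -
    let ?a = "Complex (-e) (-n)" and ?b = "Complex e n"
    have box: "z \<in> box ?a ?b" using n e z by (auto simp: in_box_complex_iff)
    have sub: "path_image (rectpath ?a ?b) \<subseteq> ?S - {z}"
    proof -
      have "path_image (rectpath ?a ?b) = cbox ?a ?b - box ?a ?b"
        using n e by (intro path_image_rectpath_cbox_minus_box) auto
      moreover have "cbox ?a ?b \<subseteq> ?S" using e by (auto simp: in_cbox_complex_iff)
      ultimately show ?thesis using box by blast
    qed
    have "(f has_contour_integral (2 * pi * \<i> * winding_number (rectpath ?a ?b) z * H z)) (rectpath ?a ?b)"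
      unfolding f_def
      by (rule Cauchy_integral_formula_convex_simple[OF S(1) H _ _ sub]) (use S z e in \<open>auto simp: interior_open\<close>)
    then have 1: "contour_integral (rectpath ?a ?b) f = 2 * pi * \<i> * H z"
      using winding_number_rectpath[OF box] by (simp add: contour_integral_unique)
    have ci: "f contour_integrable_on linepath p q"
      if "closed_segment p q \<subseteq> path_image (rectpath ?a ?b)" for p q
      using that sub
      by (intro contour_integrable_continuous_linepath continuous_on_subset[OF holomorphic_on_imp_continuous_on[OF holf]]) blast
    have image_eq: "path_image (rectpath ?a ?b) = closed_segment ?a (Complex e (-n)) \<union> closed_segment (Complex e (-n)) ?b
       \<union> closed_segment ?b (Complex (-e) n) \<union> closed_segment (Complex (-e) n) ?a"
      by (simp add: rectpath_def Let_def path_image_join Un_assoc)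
    then have cis: "f contour_integrable_on linepath ?a (Complex e (-n))" "f contour_integrable_on linepath (Complex e (-n)) ?b"
      "f contour_integrable_on linepath ?b (Complex (-e) n)" "f contour_integrable_on linepath (Complex (-e) n) ?a"
      by (intro ci; blast)+
    have "contour_integral (rectpath ?a ?b) f = ?l ?a (Complex e (-n)) + ?l (Complex e (-n)) ?b
       + ?l ?b (Complex (-e) n) + ?l (Complex (-e) n) ?a"
      using cis by (simp add: rectpath_def Let_def)
    also have "?l (Complex e (-n)) ?b = \<i> * integral {- n..n} (\<lambda>\<omega>. f (Complex e \<omega>))"
      using n by (intro contour_integral_linepath_same_Re) auto
    also have "?l (Complex (-e) n) ?a = - ?l ?a (Complex (-e) n)"
    proof (rule contour_integral_reverse_linepath)
      show "continuous_on (closed_segment (Complex (-e) n) ?a) f"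
        using sub unfolding image_eq
        by (intro continuous_on_subset[OF holomorphic_on_imp_continuous_on[OF holf]]) blast
    qed
    also have "?l ?a (Complex (-e) n) = \<i> * integral {- n..n} (\<lambda>\<omega>. f (Complex (-e) \<omega>))"
      using n by (intro contour_integral_linepath_same_Re) auto
    finally show ?thesis using 1 by simp
  qed
  have zero: "(\<lambda>n. ?l (Complex (-e) (- real n)) (Complex e (- real n))) \<longlonglongrightarrow> 0"
    "(\<lambda>n. ?l (Complex e (real n)) (Complex (-e) (real n))) \<longlonglongrightarrow> 0"
  proof -
    have ev: "eventually (\<lambda>n. real n \<ge> \<bar>Im z\<bar> + 1) sequentially" by real_asymp
    have t: "(\<lambda>n. C / real n * (2 * e)) \<longlonglongrightarrow> 0" by real_asymp
    show "(\<lambda>n. ?l (Complex (-e) (- real n)) (Complex e (- real n))) \<longlonglongrightarrow> 0"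
      by (rule Lim_null_comparison[OF _ t]) (use ev in eventually_elim, rule hbound, auto)
    show "(\<lambda>n. ?l (Complex e (real n)) (Complex (-e) (real n))) \<longlonglongrightarrow> 0"
      by (rule Lim_null_comparison[OF _ t]) (use ev in eventually_elim, rule hbound, auto)
  qed
  have A: "(\<lambda>n. ?l (Complex (-e) (- real n)) (Complex e (- real n))
       + \<i> * integral {- real n..real n} (\<lambda>\<omega>. f (Complex e \<omega>))
       + ?l (Complex e (real n)) (Complex (-e) (real n))
       - \<i> * integral {- real n..real n} (\<lambda>\<omega>. f (Complex (-e) \<omega>)))
     \<longlonglongrightarrow> 0 + \<i> * (LINT \<omega>|lborel. f (Complex e \<omega>)) + 0 - \<i> * (LINT \<omega>|lborel. f (Complex (-e) \<omega>))"
    using e by (intro tendsto_intros zero lim) auto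
  have B: "eventually (\<lambda>n. ?l (Complex (-e) (- real n)) (Complex e (- real n))
       + \<i> * integral {- real n..real n} (\<lambda>\<omega>. f (Complex e \<omega>))
       + ?l (Complex e (real n)) (Complex (-e) (real n))
       - \<i> * integral {- real n..real n} (\<lambda>\<omega>. f (Complex (-e) \<omega>)) = 2 * pi * \<i> * H z) sequentially"
  proof -
    have "eventually (\<lambda>n. real n \<ge> \<bar>Im z\<bar> + 1) sequentially" by real_asymp
    then show ?thesis by eventually_elim (rule rect[symmetric])
  qed
  have "2 * pi * \<i> * H z = 0 + \<i> * (LINT \<omega>|lborel. f (Complex e \<omega>)) + 0 - \<i> * (LINT \<omega>|lborel. f (Complex (-e) \<omega>))"
    by (rule LIMSEQ_unique[OF tendsto_eventually[OF B] A])
  then have "\<i> * (2 * pi * H z) = \<i> * ((LINT \<omega>|lborel. f (Complex e \<omega>)) - (LINT \<omega>|lborel. f (Complex (-e) \<omega>)))"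
    by (simp add: algebra_simps)
  then show ?thesis unfolding f_def by simp
qed

lemma ray_kernel_integrable:
  fixes a :: "real \<Rightarrow> complex"
  assumes a: "integrable lborel a" and e: "e > 0"
  shows "integrable (lborel \<Otimes>\<^sub>M lborel)
    (\<lambda>(\<omega>, t). indicator {0..} t *\<^sub>R (a \<omega> * exp (- (of_real t * (of_real e + \<i> * of_real (\<omega>0 - \<omega>))))))"
proof (rule lborel_pair.Fubini_integrable)
  have [measurable]: "a \<in> borel_measurable borel" using a by (auto dest: borel_measurable_integrable)
  let ?k = "\<lambda>\<omega> t. indicator {0..} t *\<^sub>R (a \<omega> * exp (- (of_real t * (of_real e + \<i> * of_real (\<omega>0 - \<omega>)))))"
  show "(\<lambda>(\<omega>, t). ?k \<omega> t) \<in> borel_measurable (lborel \<Otimes>\<^sub>M lborel)"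
    unfolding split_beta' by measurable
  have n: "norm (?k \<omega> t) = norm (a \<omega>) * (indicator {0..} t *\<^sub>R exp (- (t * e)))" for \<omega> t
    by (simp add: norm_mult indicator_def)
  have "(LINT t|lborel. norm (?k \<omega> t)) = norm (a \<omega>) * (1 / e)" for \<omega>
    using exp_ray_integral[OF e] unfolding n set_lebesgue_integral_def by simp
  then show "integrable lborel (\<lambda>\<omega>. LINT t|lborel. norm (case (\<omega>, t) of (\<omega>, t) \<Rightarrow> ?k \<omega> t))"
    using a by simp
  have "integrable lborel (\<lambda>t. ?k \<omega> t)" for \<omega>
  proof -
    have "integrable lborel (\<lambda>t. a \<omega> * (indicator {0..} t *\<^sub>R exp (- (complex_of_real t * (of_real e + \<i> * of_real (\<omega>0 - \<omega>))))))"
      using cexp_ray_integrable[of "of_real e + \<i> * of_real (\<omega>0 - \<omega>)"] e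
      unfolding set_integrable_def by (intro integrable_mult_right) auto
    then show ?thesis by simp
  qed
  then show "AE \<omega> in lborel. integrable lborel (\<lambda>t. case (\<omega>, t) of (\<omega>, t) \<Rightarrow> ?k \<omega> t)"
    by simp
qed

text \<open>
  The contribution of one edge of the strip. For \<open>w = - e + \<i>\<omega>\<close> the Cauchy kernel
  \<open>- 1 / (w - \<i>\<omega>\<^sub>0)\<close> is the transform of \<open>t \<mapsto> exp (t w)\<close> on the positive axis, so Fubini's
  theorem turns the edge integral into the Fourier transform of a function on that axis. The distance
  \<open>e\<close> of the edge from the imaginary axis is the exponential decay rate of this function.
\<close>

lemma ray_part:
  fixes a :: "real \<Rightarrow> complex"
  assumes a: "integrable lborel a" and e: "e > 0"
    and M: "\<And>t. M t = indicator {0..} t *\<^sub>R (LINT \<omega>|lborel. a \<omega> * exp (of_real t * Complex (-e) \<omega>))"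
  shows "integrable lborel M" "(LINT t|lborel. norm (M t)) \<le> (LINT \<omega>|lborel. norm (a \<omega>)) / e"
    "fourier M \<omega>0 = - (LINT \<omega>|lborel. a \<omega> / (Complex (-e) \<omega> - Complex 0 \<omega>0))"
proof -
  let ?k = "\<lambda>\<omega>0 \<omega> t. indicator {0..} t *\<^sub>R (a \<omega> * exp (- (of_real t * (of_real e + \<i> * of_real (\<omega>0 - \<omega>)))))"
  have k: "?k \<omega>0 \<omega> t = indicator {0..} t *\<^sub>R (a \<omega> * exp (of_real t * Complex (-e) \<omega>)) * cis (- (\<omega>0 * t))" for \<omega>0 \<omega> t
    by (simp add: cis_conv_exp Complex_eq indicator_def algebra_simps flip: exp_add)
  have M': "M t = (LINT \<omega>|lborel. ?k 0 \<omega> t)" for t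
    unfolding M k by simp
  show "integrable lborel M"
    using lborel_pair.integrable_snd[OF ray_kernel_integrable[OF a e, of 0]] unfolding M'[abs_def] by simp
  have nM: "norm (M t) \<le> (LINT \<omega>|lborel. norm (a \<omega>)) * (indicator {0..} t *\<^sub>R exp (- (t * e)))" for t
  proof -
    have "norm (M t) \<le> (LINT \<omega>|lborel. norm (?k 0 \<omega> t))" unfolding M' by (rule integral_norm_bound)
    also have "\<dots> = (LINT \<omega>|lborel. norm (a \<omega>) * (indicator {0..} t *\<^sub>R exp (- (t * e))))"
      by (intro Bochner_Integration.integral_cong refl) (simp add: norm_mult indicator_def)
    finally show ?thesis by simp
  qed
  have "(LINT t|lborel. norm (M t)) \<le> (LINT t|lborel. (LINT \<omega>|lborel. norm (a \<omega>)) * (indicator {0..} t *\<^sub>R exp (- (t * e))))"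
    using \<open>integrable lborel M\<close> exp_ray_integrable[OF e] nM unfolding set_integrable_def
    by (intro integral_mono) auto
  also have "\<dots> = (LINT \<omega>|lborel. norm (a \<omega>)) / e"
    using exp_ray_integral[OF e] by (simp add: set_lebesgue_integral_def)
  finally show "(LINT t|lborel. norm (M t)) \<le> (LINT \<omega>|lborel. norm (a \<omega>)) / e" .
  have "fourier M \<omega>0 = (LINT t|lborel. LINT \<omega>|lborel. ?k \<omega>0 \<omega> t)"
    unfolding fourier_def M k by simp
  also have "\<dots> = (LINT \<omega>|lborel. LINT t|lborel. ?k \<omega>0 \<omega> t)"
    by (rule lborel_pair.Fubini_integral[OF ray_kernel_integrable[OF a e]])
  also have "\<dots> = (LINT \<omega>|lborel. - (a \<omega> / (Complex (-e) \<omega> - Complex 0 \<omega>0)))"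
  proof (intro Bochner_Integration.integral_cong refl)
    fix \<omega>
    let ?c = "of_real e + \<i> * of_real (\<omega>0 - \<omega>)"
    have "(LINT t|lborel. ?k \<omega>0 \<omega> t) = a \<omega> * (LINT t:{0..}|lborel. exp (- (of_real t * ?c)))"
      unfolding set_lebesgue_integral_def by (simp flip: integral_mult_right_zero)
    also have "\<dots> = a \<omega> / ?c" using e by (subst cexp_ray_integral) auto
    also have "a \<omega> / ?c = - (a \<omega> / (Complex (-e) \<omega> - Complex 0 \<omega>0))"
    proof -
      have "?c = - (Complex (-e) \<omega> - Complex 0 \<omega>0)" by (simp add: complex_eq_iff)
      then show ?thesis by (simp only: divide_minus_right)
    qed
    finally show "(LINT t|lborel. ?k \<omega>0 \<omega> t) = - (a \<omega> / (Complex (-e) \<omega> - Complex 0 \<omega>0))" .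
  qed
  finally show "fourier M \<omega>0 = - (LINT \<omega>|lborel. a \<omega> / (Complex (-e) \<omega> - Complex 0 \<omega>0))" by simp
qed

text \<open>
  The left edge of the strip produces a function on the positive axis and the right edge, after
  reflection, one on the negative axis.
\<close>

lemma wiener_strip:
  fixes H :: "complex \<Rightarrow> complex"
  assumes e: "e > 0" and H: "H holomorphic_on {z. \<bar>Re z\<bar> < 2 * e}"
    and bd: "\<And>z. \<bar>Re z\<bar> < 2 * e \<Longrightarrow> norm (H z) \<le> C / (1 + (Im z)\<^sup>2)"
  shows "wiener (\<lambda>\<omega>. H (Complex 0 \<omega>)) (C / e)"
proof -
  have int: "integrable lborel (\<lambda>\<omega>. H (Complex x \<omega>))"
    and nrm: "(LINT \<omega>|lborel. norm (H (Complex x \<omega>))) \<le> C * pi" if x: "\<bar>x\<bar> = e" for x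
  proof -
    have "continuous_on UNIV (\<lambda>\<omega>. H (Complex x \<omega>))"
      using x e by (intro continuous_on_compose2[OF holomorphic_on_imp_continuous_on[OF H]] continuous_intros) auto
    then have [measurable]: "(\<lambda>\<omega>. H (Complex x \<omega>)) \<in> borel_measurable borel"
      by (rule borel_measurable_continuous_onI)
    have b: "norm (H (Complex x \<omega>)) \<le> C * inverse (1 + \<omega>\<^sup>2)" for \<omega>
      using bd[of "Complex x \<omega>"] x e by (simp add: divide_inverse)
    have i: "integrable lborel (\<lambda>\<omega>::real. C * inverse (1 + \<omega>\<^sup>2))"
      using integrable_inverse_square by simp
    show *: "integrable lborel (\<lambda>\<omega>. H (Complex x \<omega>))"
      using order_trans[OF b abs_ge_self] by (intro Bochner_Integration.integrable_bound[OF i]) auto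
    have "(LINT \<omega>|lborel. norm (H (Complex x \<omega>))) \<le> (LINT \<omega>|lborel. C * inverse (1 + \<omega>\<^sup>2))"
      using * i b by (intro integral_mono) auto
    then show "(LINT \<omega>|lborel. norm (H (Complex x \<omega>))) \<le> C * pi"
      using integral_inverse_square by simp
  qed
  define M where "M t = indicator {0..} t *\<^sub>R (LINT \<omega>|lborel. H (Complex (-e) \<omega>) * exp (of_real t * Complex (-e) \<omega>))" for t
  define N where "N t = indicator {0..} t *\<^sub>R (LINT \<omega>|lborel. H (Complex e (- \<omega>)) * exp (of_real t * Complex (-e) \<omega>))" for t
  have intN: "integrable lborel (\<lambda>\<omega>. H (Complex e (- \<omega>)))"
    using integrable_reflect[OF int[of e], of 0] e by simp
  have nrmN: "(LINT \<omega>|lborel. norm (H (Complex e (- \<omega>)))) \<le> C * pi"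
    using integral_reflect[of "\<lambda>\<omega>. norm (H (Complex e \<omega>))" 0] nrm[of e] e by simp
  note Mp = ray_part[OF int[of "-e"] e M_def] and Np = ray_part[OF intN e N_def]
  define m where "m t = (M t + N (- t)) / (2 * pi)" for t
  have iM: "integrable lborel M" and iN: "integrable lborel N" "integrable lborel (\<lambda>t. N (- t))"
    using Mp(1) Np(1) integrable_reflect[OF Np(1), of 0] e by auto
  have im: "integrable lborel m" unfolding m_def[abs_def] using iM iN by simp
  have "(LINT t|lborel. norm (m t)) \<le> (LINT t|lborel. (norm (M t) + norm (N (- t))) / (2 * pi))"
    using iM iN im by (intro integral_mono) (auto simp: m_def norm_divide norm_mult intro!: divide_right_mono norm_triangle_ineq)
  also have "\<dots> = ((LINT t|lborel. norm (M t)) + (LINT t|lborel. norm (N t))) / (2 * pi)"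
    using iM iN integral_reflect[of "\<lambda>t. norm (N t)" 0] by simp
  also have "\<dots> \<le> (C * pi / e + C * pi / e) / (2 * pi)"
    using e nrm[of "-e"] nrmN
    by (intro divide_right_mono add_mono order_trans[OF Mp(2)] order_trans[OF Np(2)]) auto
  also have "\<dots> = C / e" by (simp add: field_simps)
  finally have "(LINT t|lborel. norm (m t)) \<le> C / e" .
  moreover have "H (Complex 0 \<omega>0) = fourier m \<omega>0" for \<omega>0
  proof -
    have "fourier (\<lambda>t. N (- t)) \<omega>0 = fourier N (- \<omega>0)"
      using integral_reflect[of "\<lambda>t. N t * cis (\<omega>0 * t)" 0] by (simp add: fourier_def)
    also have "\<dots> = - (LINT \<omega>|lborel. H (Complex e (- \<omega>)) / (Complex (-e) \<omega> - Complex 0 (- \<omega>0)))"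
      by (rule Np(3))
    also have "\<dots> = - (LINT \<omega>|lborel. - (H (Complex e (- \<omega>)) / (Complex e (- \<omega>) - Complex 0 \<omega>0)))"
    proof -
      have "Complex (-e) \<omega> - Complex 0 (- \<omega>0) = - (Complex e (- \<omega>) - Complex 0 \<omega>0)" for \<omega>
        by (simp add: complex_eq_iff)
      then show ?thesis by (simp only: divide_minus_right)
    qed
    also have "\<dots> = (LINT \<omega>|lborel. H (Complex e \<omega>) / (Complex e \<omega> - Complex 0 \<omega>0))"
      using integral_reflect[of "\<lambda>\<omega>. H (Complex e \<omega>) / (Complex e \<omega> - Complex 0 \<omega>0)" 0] by simp
    finally have N: "fourier (\<lambda>t. N (- t)) \<omega>0 = (LINT \<omega>|lborel. H (Complex e \<omega>) / (Complex e \<omega> - Complex 0 \<omega>0))" .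
    have "fourier m \<omega>0 = (fourier M \<omega>0 + fourier (\<lambda>t. N (- t)) \<omega>0) / (2 * pi)"
      using integrable_mult_cis[OF iM, of "-\<omega>0"] integrable_mult_cis[OF iN(2), of "-\<omega>0"]
      by (simp add: fourier_def m_def distrib_right add_divide_distrib)
    also have "fourier M \<omega>0 + fourier (\<lambda>t. N (- t)) \<omega>0 = 2 * pi * H (Complex 0 \<omega>0)"
      using Cauchy_strip[OF e H bd, of "Complex 0 \<omega>0"] Mp(3)[of \<omega>0] e by (simp add: N)
    finally show ?thesis by simp
  qed
  ultimately show ?thesis using im unfolding wiener_def by (intro exI[of _ m]) auto
qed

section \<open>The Laplace transform in a weighted half-plane\<close>

lemma laplace_integrable:
  assumes [measurable]: "r \<in> borel_measurable borel"
    and r: "set_integrable lborel {0..} (\<lambda>t. norm (r t) * exp (a * t))" and z: "Re z \<ge> - a"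
  shows "set_integrable lborel {0..} (\<lambda>t. r t * exp (- (of_real t * z)))"
proof (rule set_integrable_bound[OF r])
  show "set_borel_measurable lborel {0..} (\<lambda>t. r t * exp (- (complex_of_real t * z)))"
    unfolding set_borel_measurable_def by measurable
  have "norm (r t * exp (- (complex_of_real t * z))) \<le> norm (r t) * exp (a * t)" if "t \<ge> 0" for t
    using mult_right_mono[OF z, of t] that by (auto simp: norm_mult algebra_simps intro!: mult_left_mono)
  then show "AE t in lborel. t \<in> {0..} \<longrightarrow> norm (r t * exp (- (complex_of_real t * z))) \<le> norm (norm (r t) * exp (a * t))"
    by simp
qed

lemma norm_laplace_le:
  assumes [measurable]: "r \<in> borel_measurable borel"
    and r: "set_integrable lborel {0..} (\<lambda>t. norm (r t) * exp (a * t))" and z: "Re z \<ge> - a"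
  shows "norm (laplace r z) \<le> (LINT t:{0..}|lborel. norm (r t) * exp (a * t))"
proof -
  have "norm (laplace r z) \<le> (LINT t:{0..}|lborel. norm (r t * exp (- (of_real t * z))))"
    unfolding laplace_def by (rule set_integral_norm_bound[OF laplace_integrable[OF assms]])
  also have "\<dots> \<le> (LINT t:{0..}|lborel. norm (r t) * exp (a * t))"
  proof (rule set_integral_mono[OF _ r])
    show "set_integrable lborel {0..} (\<lambda>t. norm (r t * exp (- (of_real t * z))))"
      using laplace_integrable[OF assms] by (rule set_integrable_norm)
    show "norm (r t * exp (- (complex_of_real t * z))) \<le> norm (r t) * exp (a * t)" if "t \<in> {0..}" for t
      using mult_right_mono[OF z, of t] that by (auto simp: norm_mult algebra_simps intro!: mult_left_mono)
  qed
  finally show ?thesis .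
qed

lemma continuous_on_laplace:
  assumes [measurable]: "r \<in> borel_measurable borel"
    and r: "set_integrable lborel {0..} (\<lambda>t. norm (r t) * exp (a * t))"
  shows "continuous_on {z. Re z \<ge> - a} (laplace r)"
  unfolding continuous_on_sequentially
proof (intro allI ballI impI, elim conjE)
  fix Z z assume z: "z \<in> {z. Re z \<ge> - a}" "\<forall>n. Z n \<in> {z. Re z \<ge> - a}" "Z \<longlonglongrightarrow> z"
  show "(laplace r \<circ> Z) \<longlonglongrightarrow> laplace r z"
    unfolding comp_def laplace_def set_lebesgue_integral_def
  proof (rule integral_dominated_convergence[OF _ _ r[unfolded set_integrable_def]])
    show "AE t in lborel. (\<lambda>n. indicator {0..} t *\<^sub>R (r t * exp (- (complex_of_real t * Z n))))
        \<longlonglongrightarrow> indicator {0..} t *\<^sub>R (r t * exp (- (complex_of_real t * z)))"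
      using z(3) by (intro AE_I2 tendsto_intros)
    show "AE t in lborel. norm (indicator {0..} t *\<^sub>R (r t * exp (- (complex_of_real t * Z n))))
        \<le> indicator {0..} t *\<^sub>R (norm (r t) * exp (a * t))" for n
    proof (rule AE_I2)
      fix t :: real
      have "- a \<le> Re (Z n)" using z(2) by auto
      then have "t \<ge> 0 \<Longrightarrow> - (t * Re (Z n)) \<le> a * t"
        using mult_right_mono[of "- a" "Re (Z n)" t] by (simp add: algebra_simps)
      then show "norm (indicator {0..} t *\<^sub>R (r t * exp (- (complex_of_real t * Z n))))
          \<le> indicator {0..} t *\<^sub>R (norm (r t) * exp (a * t))"
        by (auto simp: norm_mult indicator_def intro!: mult_left_mono)
    qed
  qed measurable
qed

text \<open>
  The majorant for differentiating under the integral. The quotient costs a factor \<open>t\<close>, which is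
  paid for by the factor \<open>exp (- t d)\<close> that is left because \<open>z\<close> lies \<open>2 * d\<close> to the right of
  the line \<open>Re z = - a\<close> while \<open>w\<close> moves by at most \<open>d\<close>.
\<close>

lemma norm_exp_difference_quotient:
  assumes t: "t \<ge> 0" and d: "d > 0" and w: "w \<noteq> z" "norm (w - z) \<le> d" and z: "Re z = 2 * d - a"
  shows "norm ((exp (- (complex_of_real t * w)) - exp (- (complex_of_real t * z))) / (w - z)) \<le> exp (a * t) / d"
proof -
  let ?u = "- (complex_of_real t * (w - z))"
  have nu: "norm ?u \<le> t * norm (w - z)" using t by (simp add: norm_mult)
  have "norm (exp ?u - 1) \<le> exp \<bar>Re ?u\<bar> * norm ?u" using Taylor_exp[of ?u 0] by simp
  also have "\<bar>Re ?u\<bar> \<le> t * d"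
    using abs_Re_le_cmod[of ?u] nu mult_left_mono[OF w(2) t] by linarith
  then have "exp \<bar>Re ?u\<bar> * norm ?u \<le> exp (t * d) * (t * norm (w - z))"
    using nu by (intro mult_mono) auto
  finally have 1: "norm (exp ?u - 1) / norm (w - z) \<le> exp (t * d) * t"
    using w by (simp add: field_simps)
  have "exp (- (complex_of_real t * w)) - exp (- (complex_of_real t * z)) = exp (- (complex_of_real t * z)) * (exp ?u - 1)"
    by (simp add: algebra_simps flip: exp_add)
  then have "norm ((exp (- (complex_of_real t * w)) - exp (- (complex_of_real t * z))) / (w - z))
      = exp (- (t * Re z)) * (norm (exp ?u - 1) / norm (w - z))"
    by (simp add: norm_mult norm_divide)
  also have "\<dots> \<le> exp (- (t * Re z)) * (exp (t * d) * t)"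
    using 1 by (intro mult_left_mono) auto
  also have "\<dots> = exp (a * t) * (t * exp (- (t * d)))"
    unfolding z by (simp add: algebra_simps mult_exp_exp flip: exp_add)
  also have "t * exp (- (t * d)) \<le> 1 / d"
  proof -
    have "t * d \<le> exp (t * d)" using exp_ge_add_one_self[of "t * d"] by linarith
    then show ?thesis using d by (simp add: exp_minus field_simps)
  qed
  finally show ?thesis by (simp add: mult_left_mono)
qed

lemma holomorphic_on_laplace:
  assumes rm[measurable]: "r \<in> borel_measurable borel"
    and r: "set_integrable lborel {0..} (\<lambda>t. norm (r t) * exp (a * t))"
  shows "laplace r holomorphic_on {z. Re z > - a}"
proof (rule holomorphic_onI)
  fix z assume "z \<in> {z. Re z > - a}"
  define d where "d = (Re z + a) / 2"
  have d: "d > 0" and zd: "Re z = 2 * d - a" using \<open>z \<in> _\<close> by (auto simp: d_def field_simps)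
  let ?D = "LINT t:{0..}|lborel. r t * (- complex_of_real t * exp (- (of_real t * z)))"
  have "((\<lambda>w. (laplace r w - laplace r z) / (w - z)) \<longlongrightarrow> ?D) (at z)"
    unfolding tendsto_at_iff_sequentially
  proof (intro allI impI)
    fix Z assume Z: "\<forall>i. Z i \<in> UNIV - {z}" "Z \<longlonglongrightarrow> z"
    obtain N where N: "\<And>n. n \<ge> N \<Longrightarrow> dist (Z n) z < d"
      using metric_LIMSEQ_D[OF Z(2) d] by blast
    (* A tail of the sequence stays within d of z, where the majorant is valid. *)
    define W where "W n = Z (n + N)" for n
    have W: "W \<longlonglongrightarrow> z" "\<And>n. W n \<noteq> z" "\<And>n. norm (W n - z) < d"
      using Z N LIMSEQ_ignore_initial_segment[OF Z(2), of N] by (auto simp: W_def[abs_def] dist_norm)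
    let ?q = "\<lambda>w t. (exp (- (complex_of_real t * w)) - exp (- (complex_of_real t * z))) / (w - z)"
    have eq: "(laplace r (W n) - laplace r z) / (W n - z) = (LINT t|lborel. indicator {0..} t *\<^sub>R (r t * ?q (W n) t))" for n
    proof -
      have "Re (W n) \<ge> - a" using W(3)[of n] abs_Re_le_cmod[of "W n - z"] d zd by simp
      then have "set_integrable lborel {0..} (\<lambda>t. r t * exp (- (of_real t * W n)))"
        "set_integrable lborel {0..} (\<lambda>t. r t * exp (- (of_real t * z)))"
        using d zd by (auto intro!: laplace_integrable[OF rm r])
      then have "laplace r (W n) - laplace r z = (LINT t|lborel. indicator {0..} t *\<^sub>R (r t * exp (- (of_real t * W n)))
          - indicator {0..} t *\<^sub>R (r t * exp (- (of_real t * z))))"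
        by (simp add: laplace_def set_lebesgue_integral_def set_integrable_def)
      then have "(laplace r (W n) - laplace r z) / (W n - z) = (LINT t|lborel. (indicator {0..} t *\<^sub>R (r t * exp (- (of_real t * W n)))
          - indicator {0..} t *\<^sub>R (r t * exp (- (of_real t * z)))) / (W n - z))"
        by simp
      also have "\<dots> = (LINT t|lborel. indicator {0..} t *\<^sub>R (r t * ?q (W n) t))"
        by (intro Bochner_Integration.integral_cong refl) (simp add: indicator_def diff_divide_distrib right_diff_distrib)
      finally show ?thesis .
    qed
    have "(\<lambda>n. LINT t|lborel. indicator {0..} t *\<^sub>R (r t * ?q (W n) t)) \<longlonglongrightarrow> ?D"
      unfolding set_lebesgue_integral_def
    proof (rule integral_dominated_convergence)
      show "integrable lborel (\<lambda>t. (indicator {0..} t *\<^sub>R (norm (r t) * exp (a * t))) / d)"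
        using r unfolding set_integrable_def by (rule integrable_divide_zero)
      have "(\<lambda>n. ?q (W n) t) \<longlonglongrightarrow> - complex_of_real t * exp (- (complex_of_real t * z))" for t
      proof -
        have "((\<lambda>w. exp (- (complex_of_real t * w))) has_field_derivative - complex_of_real t * exp (- (complex_of_real t * z))) (at z)"
          by (auto intro!: derivative_eq_intros)
        then have "((\<lambda>w. ?q w t) \<longlongrightarrow> - complex_of_real t * exp (- (complex_of_real t * z))) (at z)"
          by (simp add: has_field_derivative_iff)
        then show ?thesis using W(1,2) unfolding tendsto_at_iff_sequentially comp_def by simp
      qed
      then show "AE t in lborel. (\<lambda>n. indicator {0..} t *\<^sub>R (r t * ?q (W n) t))
          \<longlonglongrightarrow> indicator {0..} t *\<^sub>R (r t * (- complex_of_real t * exp (- (complex_of_real t * z))))"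
        by (intro AE_I2 tendsto_scaleR tendsto_mult tendsto_const)
      show "AE t in lborel. norm (indicator {0..} t *\<^sub>R (r t * ?q (W n) t))
          \<le> (indicator {0..} t *\<^sub>R (norm (r t) * exp (a * t))) / d" for n
      proof (rule AE_I2)
        fix t :: real
        have "norm (r t * ?q (W n) t) \<le> norm (r t) * (exp (a * t) / d)" if "t \<ge> 0"
          unfolding norm_mult[of "r t"]
          using norm_exp_difference_quotient[OF that d W(2) less_imp_le[OF W(3)] zd] by (intro mult_left_mono) auto
        then show "norm (indicator {0..} t *\<^sub>R (r t * ?q (W n) t))
          \<le> (indicator {0..} t *\<^sub>R (norm (r t) * exp (a * t))) / d"
          by (simp add: indicator_def)
      qed
    qed measurable
    then have "(\<lambda>n. (laplace r (W n) - laplace r z) / (W n - z)) \<longlonglongrightarrow> ?D"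
      by (simp add: eq)
    then show "((\<lambda>w. (laplace r w - laplace r z) / (w - z)) \<circ> Z) \<longlonglongrightarrow> ?D"
      unfolding W_def comp_def by (rule LIMSEQ_offset)
  qed
  then have "(laplace r has_field_derivative ?D) (at z)"
    by (simp add: has_field_derivative_iff)
  then show "laplace r field_differentiable at z within {z. Re z > - a}"
    using field_differentiable_at_within field_differentiable_def by blast
qed

section \<open>Approximation by exponential polynomials\<close>

text \<open>
  In terms of \<open>x = exp (- t)\<close> this is \<open>x * (1 - x) * (\<Sum>j<N. c j * x ^ j)\<close>. The factor \<open>x\<close>
  makes the function integrable. The factor \<open>1 - x\<close> makes it vanish at \<open>t = 0\<close>, to which the
  transform owes its quadratic decay.
\<close>

definition exp_poly :: "nat \<Rightarrow> (nat \<Rightarrow> complex) \<Rightarrow> real \<Rightarrow> complex" where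
  "exp_poly N c t = (\<Sum>j<N. c j * (exp (- (of_real t * (of_nat j + 1))) - exp (- (of_real t * (of_nat j + 2)))))"

definition exp_poly_transform :: "nat \<Rightarrow> (nat \<Rightarrow> complex) \<Rightarrow> complex \<Rightarrow> complex" where
  "exp_poly_transform N c z = (\<Sum>j<N. c j * (1 / (z + of_nat j + 1) - 1 / (z + of_nat j + 2)))"

lemma exp_poly_measurable [measurable]: "exp_poly N c \<in> borel_measurable borel"
  unfolding exp_poly_def[abs_def] by measurable

lemma exp_poly_laplace:
  assumes z: "Re z > - 1"
  shows "set_integrable lborel {0..} (\<lambda>t. exp_poly N c t * exp (- (of_real t * z)))"
    and "laplace (exp_poly N c) z = exp_poly_transform N c z"
proof -
  have pos: "Re (z + of_nat j + 1) > 0" "Re (z + of_nat j + 2) > 0" for j using z by auto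
  let ?E = "\<lambda>j k t. indicator {0..} t *\<^sub>R exp (- (complex_of_real t * (z + of_nat j + k)))"
  have eq: "indicator {0..} t *\<^sub>R (exp_poly N c t * exp (- (of_real t * z))) = (\<Sum>j<N. c j * (?E j 1 t - ?E j 2 t))" for t
    unfolding exp_poly_def sum_distrib_right scaleR_sum_right
    by (intro sum.cong refl) (simp add: algebra_simps flip: exp_add)
  have i: "integrable lborel (?E j 1)" "integrable lborel (?E j 2)" for j
    using cexp_ray_integrable[OF pos(1)] cexp_ray_integrable[OF pos(2)] unfolding set_integrable_def by auto
  show "set_integrable lborel {0..} (\<lambda>t. exp_poly N c t * exp (- (of_real t * z)))"
    unfolding set_integrable_def eq using i by (intro Bochner_Integration.integrable_sum integrable_mult_right Bochner_Integration.integrable_diff)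
  have "laplace (exp_poly N c) z = (\<Sum>j<N. LINT t|lborel. c j * (?E j 1 t - ?E j 2 t))"
    unfolding laplace_def set_lebesgue_integral_def eq using i
    by (intro Bochner_Integration.integral_sum integrable_mult_right Bochner_Integration.integrable_diff)
  also have "\<dots> = exp_poly_transform N c z"
    unfolding exp_poly_transform_def using i cexp_ray_integral[OF pos(1)] cexp_ray_integral[OF pos(2)]
    by (intro sum.cong refl) (simp add: set_lebesgue_integral_def)
  finally show "laplace (exp_poly N c) z = exp_poly_transform N c z" .
qed

lemma exp_poly_transform_eq:
  assumes z: "Re z > - 1"
  shows "exp_poly_transform N c z = (\<Sum>j<N. c j / ((z + of_nat j + 1) * (z + of_nat j + 2)))"
proof -
  have "z + of_nat j + 1 \<noteq> 0" "z + of_nat j + 2 \<noteq> 0" for j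
    using z by (auto simp: complex_eq_iff)
  then show ?thesis unfolding exp_poly_transform_def by (intro sum.cong refl) (simp add: field_simps)
qed

lemma exp_poly_transform_bound:
  assumes z: "Re z \<ge> - 1 / 2"
  shows "norm (exp_poly_transform N c z) \<le> 4 * (\<Sum>j<N. norm (c j)) / (1 + (Im z)\<^sup>2)"
proof -
  have arith: "1 / 4 \<le> A \<Longrightarrow> 0 \<le> B \<Longrightarrow> (1 + B) / 4 \<le> A + B" for A B :: real
    by simp
  have q: "(1 + (Im z)\<^sup>2) / 4 \<le> norm ((z + of_nat j + 1) * (z + of_nat j + 2))" for j
  proof -
    have "1/4 \<le> (Re z + (real j + 1))\<^sup>2"
      using power_mono[of "1/2" "Re z + (real j + 1)" 2] z by (simp add: power2_eq_square)
    then have "(1 + (Im z)\<^sup>2) / 4 \<le> (Re z + (real j + 1))\<^sup>2 + (Im z)\<^sup>2"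
      by (rule arith) simp
    also have "\<dots> = (norm (z + of_nat j + 1))\<^sup>2"
      by (simp add: cmod_power2 add.assoc)
    also have "\<dots> \<le> norm (z + of_nat j + 1) * norm (z + of_nat j + 2)"
      unfolding power2_eq_square using z by (intro mult_left_mono) (auto simp: cmod_def intro!: power_mono)
    finally show ?thesis by (simp add: norm_mult)
  qed
  have p: "(1 + (Im z)\<^sup>2) / 4 > 0" by (simp add: add_pos_nonneg)
  have "norm (c j / ((z + of_nat j + 1) * (z + of_nat j + 2))) \<le> norm (c j) / ((1 + (Im z)\<^sup>2) / 4)" for j
    unfolding norm_divide by (rule divide_left_mono[OF q _ mult_pos_pos[OF less_le_trans[OF p q] p]]) simp
  then have "norm (exp_poly_transform N c z) \<le> (\<Sum>j<N. norm (c j) / ((1 + (Im z)\<^sup>2) / 4))"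
    using z by (subst exp_poly_transform_eq) (auto intro!: sum_norm_le)
  also have "\<dots> = 4 * (\<Sum>j<N. norm (c j)) / (1 + (Im z)\<^sup>2)"
    by (simp add: sum_divide_distrib[symmetric] sum_distrib_left mult.commute)
  finally show ?thesis .
qed

lemma exp_poly_transform_decay:
  assumes z: "Re z \<ge> 0" "z \<noteq> 0"
  shows "norm (exp_poly_transform N c z) \<le> (\<Sum>j<N. norm (c j)) / (norm z)\<^sup>2"
proof -
  have "norm z \<le> norm (z + of_nat j + 1)" "norm z \<le> norm (z + of_nat j + 2)" for j
    using z by (auto simp: cmod_def intro!: power_mono)
  then have "(norm z)\<^sup>2 \<le> norm ((z + of_nat j + 1) * (z + of_nat j + 2))" for j
    unfolding norm_mult power2_eq_square by (intro mult_mono) auto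
  moreover have z2: "(norm z)\<^sup>2 > 0" using z by simp
  ultimately have "norm (c j / ((z + of_nat j + 1) * (z + of_nat j + 2))) \<le> norm (c j) / (norm z)\<^sup>2" for j
    unfolding norm_divide by (intro divide_left_mono mult_pos_pos less_le_trans[OF z2]) simp_all
  then have "norm (exp_poly_transform N c z) \<le> (\<Sum>j<N. norm (c j) / (norm z)\<^sup>2)"
    using z by (subst exp_poly_transform_eq) (auto intro!: sum_norm_le)
  then show ?thesis by (simp add: sum_divide_distrib)
qed

text \<open>
  Uniform continuity across the imaginary axis: it carries a lower bound for \<open>1 + laplace p\<close> from
  the axis to a strip.
\<close>

lemma exp_poly_transform_lipschitz:
  assumes z: "Re z \<ge> - 1 / 2" and w: "Re w \<ge> - 1 / 2"
  shows "norm (exp_poly_transform N c z - exp_poly_transform N c w) \<le> 8 * (\<Sum>j<N. norm (c j)) * norm (z - w)"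
proof -
  have *: "norm (1 / (z + b) - 1 / (w + b)) \<le> 4 * norm (z - w)" if b: "Re b \<ge> 1" for b
  proof -
    have n: "norm (z + b) \<ge> 1/2" "norm (w + b) \<ge> 1/2"
      using b z w abs_Re_le_cmod[of "z + b"] abs_Re_le_cmod[of "w + b"] by auto
    then have "z + b \<noteq> 0" "w + b \<noteq> 0" by auto
    then have "1 / (z + b) - 1 / (w + b) = (w - z) / ((z + b) * (w + b))"
      by (simp add: field_simps)
    then have "norm (1 / (z + b) - 1 / (w + b)) = norm (z - w) / (norm (z + b) * norm (w + b))"
      by (simp add: norm_divide norm_mult norm_minus_commute)
    also have "\<dots> \<le> norm (z - w) / (1/2 * (1/2))"
      using n by (intro divide_left_mono mult_mono mult_pos_pos) auto
    finally show ?thesis by (simp add: mult.commute)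
  qed
  have "norm (exp_poly_transform N c z - exp_poly_transform N c w)
    = norm (\<Sum>j<N. c j * ((1 / (z + (of_nat j + 1)) - 1 / (w + (of_nat j + 1))) - (1 / (z + (of_nat j + 2)) - 1 / (w + (of_nat j + 2)))))"
    unfolding exp_poly_transform_def sum_subtractf[symmetric] by (simp add: algebra_simps)
  also have "\<dots> \<le> (\<Sum>j<N. norm (c j) * (8 * norm (z - w)))"
  proof (rule sum_norm_le)
    fix j
    have "norm ((1 / (z + (of_nat j + 1)) - 1 / (w + (of_nat j + 1))) - (1 / (z + (of_nat j + 2)) - 1 / (w + (of_nat j + 2))))
      \<le> 4 * norm (z - w) + 4 * norm (z - w)"
      by (intro norm_triangle_le_diff add_mono *) auto
    then show "norm (c j * ((1 / (z + (of_nat j + 1)) - 1 / (w + (of_nat j + 1))) - (1 / (z + (of_nat j + 2)) - 1 / (w + (of_nat j + 2)))))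
      \<le> norm (c j) * (8 * norm (z - w))"
      unfolding norm_mult by (intro mult_left_mono) auto
  qed
  finally show ?thesis by (simp add: sum_distrib_right[symmetric] mult_ac)
qed

text \<open>
  The cutoff vanishes for \<open>t \<le> 1 / n\<close> and for \<open>t \<ge> n\<close>, that is, near both ends of the
  interval \<open>[0, 1]\<close> in which \<open>x = exp (- t)\<close> moves. This permits dividing by \<open>x * (1 - x)\<close>.
\<close>

lemma cutoff_approximation:
  assumes [measurable]: "k \<in> borel_measurable borel" and k: "set_integrable lborel {0..} (\<lambda>t. k t :: complex)" and e: "e > 0"
  obtains n :: nat where "n \<ge> 2"
    "(LINT t:{0..}|lborel. norm (k t - k t * of_real (max 0 (min 1 (real n * t - 1)) * max 0 (min 1 (real n - t))))) < e"
proof -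
  let ?cut = "\<lambda>n t. max 0 (min 1 (real n * t - 1)) * max 0 (min 1 (real n - t))"
  have cut: "0 \<le> ?cut n t" "?cut n t \<le> 1" for n t
    by (auto intro!: mult_nonneg_nonneg mult_le_one)
  have "(\<lambda>n. LINT t|lborel. indicator {0..} t *\<^sub>R norm (k t - k t * of_real (?cut n t))) \<longlonglongrightarrow> (LINT t|lborel. (\<lambda>_::real. 0::real) t)"
  proof (rule integral_dominated_convergence)
    show "integrable lborel (\<lambda>t. norm (indicator {0..} t *\<^sub>R k t))"
      using k unfolding set_integrable_def by (rule integrable_norm)
    show "AE t in lborel. (\<lambda>n. indicator {0..} t *\<^sub>R norm (k t - k t * of_real (?cut n t))) \<longlonglongrightarrow> 0"
      using AE_lborel_singleton[of "0::real"]
    proof eventually_elim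
      case (elim t)
      show ?case
      proof (cases "t > 0")
        case True
        have "eventually (\<lambda>n. real n * t - 1 \<ge> 1) sequentially" "eventually (\<lambda>n. real n - t \<ge> 1) sequentially"
          using True by real_asymp+
        then have "eventually (\<lambda>n. indicator {0..} t *\<^sub>R norm (k t - k t * of_real (?cut n t)) = 0) sequentially"
          by eventually_elim simp
        then show ?thesis by (rule tendsto_eventually)
      qed (use elim in \<open>auto simp: indicator_def\<close>)
    qed
    show "AE t in lborel. norm (indicator {0..} t *\<^sub>R norm (k t - k t * of_real (?cut n t))) \<le> norm (indicator {0..} t *\<^sub>R k t)" for n
    proof (rule AE_I2)
      fix t
      have "k t - k t * of_real (?cut n t) = k t * of_real (1 - ?cut n t)" by (simp add: algebra_simps)
      then have "norm (k t - k t * of_real (?cut n t)) = norm (k t) * \<bar>1 - ?cut n t\<bar>"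
        by (simp only: norm_mult norm_of_real)
      also have "\<dots> \<le> norm (k t) * 1" using cut[of n t] by (intro mult_left_mono) auto
      finally show "norm (indicator {0..} t *\<^sub>R norm (k t - k t * of_real (?cut n t))) \<le> norm (indicator {0..} t *\<^sub>R k t)"
        by (simp add: indicator_def)
    qed
  qed measurable
  then have "eventually (\<lambda>n. (LINT t:{0..}|lborel. norm (k t - k t * of_real (?cut n t))) < e) sequentially"
    unfolding set_lebesgue_integral_def using e by (intro order_tendstoD) simp_all
  then have "eventually (\<lambda>n. n \<ge> 2 \<and> (LINT t:{0..}|lborel. norm (k t - k t * of_real (?cut n t))) < e) sequentially"
    using eventually_ge_at_top[of 2] by eventually_elim simp
  then obtain n where "n \<ge> 2 \<and> (LINT t:{0..}|lborel. norm (k t - k t * of_real (?cut n t))) < e"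
    unfolding eventually_sequentially by blast
  then show ?thesis using that by blast
qed

lemma complex_Weierstrass:
  fixes h :: "real \<Rightarrow> complex"
  assumes h: "continuous_on {0..1} h" and e: "e > 0"
  obtains N c where "\<And>x. x \<in> {0..1} \<Longrightarrow> norm (h x - (\<Sum>j<N. c j * of_real x ^ j)) < e"
proof -
  obtain f g where f: "real_polynomial_function f" "\<And>x. x \<in> {0..1} \<Longrightarrow> \<bar>Re (h x) - f x\<bar> < e / 2"
    and g: "real_polynomial_function g" "\<And>x. x \<in> {0..1} \<Longrightarrow> \<bar>Im (h x) - g x\<bar> < e / 2"
    using Stone_Weierstrass_real_polynomial_function[of "{0..1::real}" "\<lambda>x. Re (h x)" "e / 2"]
      Stone_Weierstrass_real_polynomial_function[of "{0..1::real}" "\<lambda>x. Im (h x)" "e / 2"]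
      h e by (metis compact_Icc continuous_on_Re continuous_on_Im half_gt_zero)
  obtain a n b m where a: "f = (\<lambda>x. \<Sum>i\<le>n. a i * x^i)" and b: "g = (\<lambda>x. \<Sum>i\<le>m. b i * x^i)"
    using f(1) g(1) unfolding real_polynomial_function_iff_sum by blast
  define N where "N = Suc (max n m)"
  define a' where "a' i = (if i \<le> n then a i else 0)" for i
  define b' where "b' i = (if i \<le> m then b i else 0)" for i
  have f': "f x = (\<Sum>j<N. a' j * x ^ j)" for x
    unfolding a by (intro sum.mono_neutral_cong_left) (auto simp: a'_def N_def)
  have g': "g x = (\<Sum>j<N. b' j * x ^ j)" for x
    unfolding b by (intro sum.mono_neutral_cong_left) (auto simp: b'_def N_def)
  have "norm (h x - (\<Sum>j<N. Complex (a' j) (b' j) * of_real x ^ j)) < e" if x: "x \<in> {0..1}" for x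
  proof -
    have "(\<Sum>j<N. Complex (a' j) (b' j) * of_real x ^ j) = of_real (f x) + \<i> * of_real (g x)"
      unfolding f' g' by (simp add: Complex_eq algebra_simps sum.distrib sum_distrib_left)
    then have "norm (h x - (\<Sum>j<N. Complex (a' j) (b' j) * of_real x ^ j)) \<le> \<bar>Re (h x) - f x\<bar> + \<bar>Im (h x) - g x\<bar>"
      using cmod_le[of "h x - (of_real (f x) + \<i> * of_real (g x))"] by simp
    then show ?thesis using f(2)[OF x] g(2)[OF x] by simp
  qed
  then show ?thesis by (rule that)
qed

text \<open>
  After the cutoff, \<open>k\<close> divided by \<open>x * (1 - x)\<close> is a continuous function of
  \<open>x = exp (- t)\<close> on \<open>[0, 1]\<close>, and the Weierstrass theorem applies to it. Multiplying the uniform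
  error by \<open>x * (1 - x) \<le> exp (- t)\<close> gives an integrable error.
\<close>

lemma exp_poly_dense:
  assumes km[measurable]: "k \<in> borel_measurable borel" and kc: "continuous_on {0..} k"
    and k: "set_integrable lborel {0..} k" and e: "e > 0"
  obtains N c where "(LINT t:{0..}|lborel. norm (k t - exp_poly N c t)) < e"
proof -
  obtain n :: nat where n: "n \<ge> 2"
    "(LINT t:{0..}|lborel. norm (k t - k t * of_real (max 0 (min 1 (real n * t - 1)) * max 0 (min 1 (real n - t))))) < e / 2"
    using cutoff_approximation[OF km k, of "e / 2"] e by auto
  define cut where "cut t = complex_of_real (max 0 (min 1 (real n * t - 1)) * max 0 (min 1 (real n - t)))" for t
  have [measurable]: "cut \<in> borel_measurable borel" unfolding cut_def[abs_def] by measurable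
  have cut0: "cut t = 0" if "t \<le> 1 / real n \<or> t \<ge> real n" for t
    using that n(1) by (auto simp: cut_def field_simps)
  have cut1: "norm (cut t) \<le> 1" for t
    unfolding cut_def norm_of_real by (auto simp: abs_mult intro!: mult_le_one)
  define \<alpha> \<beta> where "\<alpha> = exp (- real n)" and "\<beta> = exp (- 1 / real n)"
  have \<alpha>\<beta>: "0 < \<alpha>" "\<alpha> \<le> \<beta>" "\<beta> < 1"
  proof -
    have "1 / real n \<le> real n" using n(1) by (simp add: field_simps) (metis le_trans mult_le_mono nat_mult_1 of_nat_1 of_nat_le_iff of_nat_mult one_le_numeral)
    then show "\<alpha> \<le> \<beta>" by (simp add: \<alpha>_def \<beta>_def)
  qed (use n(1) in \<open>auto simp: \<alpha>_def \<beta>_def\<close>)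
  define \<psi> where "\<psi> x = k (- ln x) * cut (- ln x) / (of_real x * (1 - of_real x))" for x
  (* Clamping to [\<alpha>, \<beta>] extends \<psi> continuously by 0, since the cutoff vanishes at both ends. *)
  define h where "h x = \<psi> (max \<alpha> (min \<beta> x))" for x
  have "continuous_on {\<alpha>..\<beta>} \<psi>"
    unfolding \<psi>_def cut_def using \<alpha>\<beta>
    by (intro continuous_intros continuous_on_compose2[OF kc]) (auto simp: ln_le_zero_iff)
  then have hc: "continuous_on {0..1} h"
    unfolding h_def using \<alpha>\<beta> by (elim continuous_on_compose2) (auto intro!: continuous_intros)
  obtain N c where Nc: "\<And>x. x \<in> {0..1} \<Longrightarrow> norm (h x - (\<Sum>j<N. c j * of_real x ^ j)) < e / 2"
    by (rule complex_Weierstrass[OF hc half_gt_zero[OF e]]) (rule that)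
  have bd: "norm (k t * cut t - exp_poly N c t) \<le> e / 2 * exp (- (t * 1))" if t: "t > 0" for t
  proof -
    define x where "x = exp (- t)"
    have x: "0 < x" "x < 1" "ln x = - t" using t by (auto simp: x_def)
    have 1: "k t * cut t = of_real x * (1 - of_real x) * h x"
    proof (cases "x \<le> \<alpha> \<or> x \<ge> \<beta>")
      case True
      then have "t \<le> 1 / real n \<or> t \<ge> real n" by (auto simp: x_def \<alpha>_def \<beta>_def)
      then have "cut t = 0" by (rule cut0)
      moreover have "cut (- ln \<alpha>) = 0" "cut (- ln \<beta>) = 0" by (auto intro!: cut0 simp: \<alpha>_def \<beta>_def)
      then have "h x = 0" using True \<alpha>\<beta> by (auto simp: h_def \<psi>_def max_def min_def)
      ultimately show ?thesis by simp
    next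
      case False
      then have "h x = \<psi> x" by (simp add: h_def max_def min_def)
      moreover have "complex_of_real x \<noteq> 0" "1 - complex_of_real x \<noteq> 0" using x by (auto simp: complex_eq_iff)
      ultimately show ?thesis by (simp add: \<psi>_def x)
    qed
    have 2: "exp_poly N c t = of_real x * (1 - of_real x) * (\<Sum>j<N. c j * of_real x ^ j)"
      unfolding exp_poly_def sum_distrib_left
    proof (intro sum.cong refl)
      fix j
      have "exp (- (complex_of_real t * (of_nat j + 1))) = of_real x * of_real x ^ j"
        by (simp add: x_def exp_of_real[symmetric] exp_of_nat_mult[symmetric] algebra_simps flip: exp_add)
      moreover have "exp (- (complex_of_real t * (of_nat j + 2))) = of_real x * of_real x * of_real x ^ j"
        by (simp add: x_def exp_of_real[symmetric] exp_of_nat_mult[symmetric] algebra_simps flip: exp_add)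
      ultimately show "c j * (exp (- (complex_of_real t * (of_nat j + 1))) - exp (- (complex_of_real t * (of_nat j + 2))))
         = of_real x * (1 - of_real x) * (c j * of_real x ^ j)"
        by (simp add: algebra_simps)
    qed
    have "norm (k t * cut t - exp_poly N c t) = x * (1 - x) * norm (h x - (\<Sum>j<N. c j * of_real x ^ j))"
    proof -
      have "k t * cut t - exp_poly N c t = of_real (x * (1 - x)) * (h x - (\<Sum>j<N. c j * of_real x ^ j))"
        unfolding 1 2 by (simp add: algebra_simps)
      then show ?thesis using x by (simp only: norm_mult norm_of_real) simp
    qed
    also have "\<dots> \<le> x * 1 * (e / 2)"
      using Nc[of x] x by (intro mult_mono) auto
    finally show ?thesis by (simp add: x_def mult.commute)
  qed
  have ie: "set_integrable lborel {0..} (exp_poly N c)"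
    using exp_poly_laplace(1)[of 0 N c] by simp
  have ik: "set_integrable lborel {0..} (\<lambda>t. k t * cut t)"
  proof (rule set_integrable_bound[OF k])
    show "set_borel_measurable lborel {0..} (\<lambda>t. k t * cut t)" unfolding set_borel_measurable_def by measurable
    show "AE t in lborel. t \<in> {0..} \<longrightarrow> norm (k t * cut t) \<le> norm (k t)"
      using cut1 by (auto simp: norm_mult intro!: mult_left_le)
  qed
  note ii = set_integrable_norm[OF set_integral_diff(1)[OF k ik]] set_integrable_norm[OF set_integral_diff(1)[OF ik ie]]
    set_integrable_norm[OF set_integral_diff(1)[OF k ie]]
  have "(LINT t:{0..}|lborel. norm (k t - exp_poly N c t)) \<le> (LINT t:{0..}|lborel. norm (k t - k t * cut t) + norm (k t * cut t - exp_poly N c t))"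
    using ii by (intro set_integral_mono set_integral_add(1)) (auto intro: norm_triangle_le_diff order_trans[OF _ norm_triangle_ineq])
  also have "\<dots> = (LINT t:{0..}|lborel. norm (k t - k t * cut t)) + (LINT t:{0..}|lborel. norm (k t * cut t - exp_poly N c t))"
    using ii by (intro set_integral_add(2))
  also have "(LINT t:{0..}|lborel. norm (k t * cut t - exp_poly N c t)) \<le> (LINT t:{0..}|lborel. e / 2 * exp (- (t * 1)))"
  proof (rule set_integral_mono_AE[OF ii(2)])
    show "set_integrable lborel {0..} (\<lambda>t. e / 2 * exp (- (t * 1)))"
      by (intro set_integrable_mult_right impI exp_ray_integrable) simp
    show "AE t\<in>{0..} in lborel. norm (k t * cut t - exp_poly N c t) \<le> e / 2 * exp (- (t * 1))"
      using AE_lborel_singleton[of "0::real"] by eventually_elim (use bd in force)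
  qed
  also have "\<dots> = e / 2" using exp_ray_integral[of 1] by simp
  finally have "(LINT t:{0..}|lborel. norm (k t - exp_poly N c t)) < e"
    using n(2) unfolding cut_def by linarith
  then show ?thesis using that by blast
qed

section \<open>Wiener's lemma on the imaginary axis\<close>

lemma laplace_eq_fourier:
  "laplace r (Complex 0 \<omega>) = fourier (\<lambda>t. indicator {0..} t *\<^sub>R r t) \<omega>"
  unfolding laplace_def fourier_def set_lebesgue_integral_def
  by (intro Bochner_Integration.integral_cong refl) (simp add: cis_conv_exp Complex_eq algebra_simps)

lemma wiener_laplace:
  assumes "set_integrable lborel {0..} r" "(LINT t:{0..}|lborel. norm (r t)) \<le> c"
  shows "wiener (\<lambda>\<omega>. laplace r (Complex 0 \<omega>)) c"
  unfolding wiener_def laplace_eq_fourier[abs_def]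
proof (intro exI[of _ "\<lambda>t. indicator {0..} t *\<^sub>R r t"] conjI)
  show "integrable lborel (\<lambda>t. indicator {0..} t *\<^sub>R r t)" using assms(1) by (simp add: set_integrable_def)
  show "(LINT t|lborel. norm (indicator {0..} t *\<^sub>R r t)) \<le> c"
    using assms(2) by (simp add: set_lebesgue_integral_def)
qed simp

lemma exp_poly_approx_transform:
  assumes km[measurable]: "k \<in> borel_measurable borel" and k: "set_integrable lborel {0..} k"
    and c: "(LINT t:{0..}|lborel. norm (k t - exp_poly N c t)) < e" and z: "Re z \<ge> 0"
  shows "norm (laplace k z - exp_poly_transform N c z) < e"
proof -
  have ie: "set_integrable lborel {0..} (exp_poly N c)"
    using exp_poly_laplace(1)[of 0 N c] by simp
  have int: "set_integrable lborel {0..} (\<lambda>t. norm (k t - exp_poly N c t) * exp (0 * t))"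
    using set_integrable_norm[OF set_integral_diff(1)[OF k ie]] by simp
  have "set_integrable lborel {0..} (\<lambda>t. k t * exp (- (of_real t * z)))"
    using laplace_integrable[OF km, of 0] set_integrable_norm[OF k] z by simp
  then have "laplace (\<lambda>t. k t - exp_poly N c t) z = laplace k z - exp_poly_transform N c z"
    using exp_poly_laplace[of z N c] z
    by (simp add: laplace_def left_diff_distrib set_integral_diff)
  moreover have "norm (laplace (\<lambda>t. k t - exp_poly N c t) z) \<le> (LINT t:{0..}|lborel. norm (k t - exp_poly N c t) * exp (0 * t))"
    by (rule norm_laplace_le[OF _ int]) (use z in auto)
  ultimately show ?thesis using c by simp
qed

text \<open>
  The transforms of exponential polynomials decay, and functions that are close in \<open>L\<^sup>1\<close> have
  transforms that are uniformly close on the closed half-plane.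
\<close>

lemma Riemann_Lebesgue_half_plane:
  assumes km: "k \<in> borel_measurable borel" and kc: "continuous_on {0..} k"
    and k: "set_integrable lborel {0..} k" and e: "e > 0"
  obtains R where "\<And>z. Re z \<ge> 0 \<Longrightarrow> norm z \<ge> R \<Longrightarrow> norm (laplace k z) < e"
proof -
  obtain N c where c: "(LINT t:{0..}|lborel. norm (k t - exp_poly N c t)) < e / 2"
    by (rule exp_poly_dense[OF km kc k half_gt_zero[OF e]]) (rule that)
  define S where "S = (\<Sum>j<N. norm (c j))"
  have S: "S \<ge> 0" by (simp add: S_def sum_nonneg)
  have "norm (laplace k z) < e" if z: "Re z \<ge> 0" "norm z \<ge> max 1 (2 * S / e)" for z
  proof -
    have z1: "norm z \<ge> 1" "2 * S / e \<le> norm z" using z by auto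
    have "norm (exp_poly_transform N c z) \<le> S / (norm z)\<^sup>2"
      unfolding S_def using z z1 by (intro exp_poly_transform_decay) auto
    also have "\<dots> \<le> S / norm z"
      using S z1(1) self_le_power[OF z1(1), of 2] by (intro divide_left_mono mult_pos_pos) auto
    also have "\<dots> \<le> e / 2" using z1 e by (simp add: divide_simps mult.commute split: if_splits)
    finally have "norm (exp_poly_transform N c z) \<le> e / 2" .
    then show ?thesis
      using exp_poly_approx_transform[OF km k c z(1)] norm_triangle_sub[of "laplace k z" "exp_poly_transform N c z"] by simp
  qed
  then show ?thesis by (rule that)
qed

lemma transform_bounded_below_on_axis:
  assumes km: "k \<in> borel_measurable borel" and kc: "continuous_on {0..} k"
    and k: "set_integrable lborel {0..} k"
    and nz: "\<And>\<omega>. 1 + laplace k (Complex 0 \<omega>) \<noteq> 0"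
  obtains \<delta> where "0 < \<delta>" "\<delta> \<le> 1" "\<And>\<omega>. \<delta> \<le> norm (1 + laplace k (Complex 0 \<omega>))"
proof -
  obtain R where R: "\<And>z. Re z \<ge> 0 \<Longrightarrow> norm z \<ge> R \<Longrightarrow> norm (laplace k z) < 1 / 2"
    by (rule Riemann_Lebesgue_half_plane[OF km kc k, of "1/2"]) (simp, rule that)
  have cont: "continuous_on {z. Re z \<ge> - 0} (laplace k)"
    by (rule continuous_on_laplace[OF km]) (use set_integrable_norm[OF k] in simp)
  let ?h = "\<lambda>\<omega>. norm (1 + laplace k (Complex 0 \<omega>))"
  have "continuous_on {-\<bar>R\<bar>..\<bar>R\<bar>} ?h"
    by (intro continuous_intros continuous_on_compose2[OF cont]) auto
  then obtain x where x: "\<forall>y \<in> {-\<bar>R\<bar>..\<bar>R\<bar>}. ?h x \<le> ?h y"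
    using continuous_attains_inf[of "{-\<bar>R\<bar>..\<bar>R\<bar>}" ?h] by auto
  have "min (1/2) (?h x) \<le> ?h \<omega>" for \<omega>
  proof (cases "\<bar>\<omega>\<bar> \<le> \<bar>R\<bar>")
    case True
    then have "?h x \<le> ?h \<omega>" using x by (auto simp: abs_le_iff)
    then show ?thesis by (rule min.coboundedI2)
  next
    case False
    then have "norm (laplace k (Complex 0 \<omega>)) < 1/2" by (intro R) (auto simp: cmod_def)
    then show ?thesis using norm_triangle_ineq4[of "1 + laplace k (Complex 0 \<omega>)" "laplace k (Complex 0 \<omega>)"] by simp
  qed
  then show ?thesis using nz[of x] by (intro that[of "min (1/2) (?h x)"]) auto
qed

text \<open>
  With \<open>y = 1 / F\<close>, this is \<open>y ^ n - 1 = (y - 1) * (\<Sum>i<n. y ^ i)\<close>. The factor \<open>F - 1\<close> is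
  kept because in the application it is what decays.
\<close>

lemma norm_inverse_power_minus_one_le:
  fixes F :: complex
  assumes F: "norm F \<ge> d" and d: "0 < d" "d \<le> 1"
  shows "norm (1 / F ^ n - 1) \<le> real n * (1 / d) ^ n * norm (F - 1)"
proof (cases n)
  case (Suc m)
  have F0: "F \<noteq> 0" using F d by auto
  have y: "norm (1 / F) \<le> 1 / d" using F d by (simp add: norm_divide frac_le)
  have d1: "1 \<le> 1 / d" using d by simp
  have "norm (\<Sum>i<n. (1 / F) ^ i) \<le> (\<Sum>i<n. (1 / d) ^ m)"
  proof (rule sum_norm_le)
    fix i assume "i \<in> {..<n}"
    have "norm ((1 / F) ^ i) \<le> (1 / d) ^ i" unfolding norm_power using y by (intro power_mono) auto
    also have "\<dots> \<le> (1 / d) ^ m" using d1 \<open>i \<in> _\<close> Suc by (intro power_increasing) auto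
    finally show "norm ((1 / F) ^ i) \<le> (1 / d) ^ m" .
  qed
  moreover have "norm (1 / F - 1) \<le> (1 / d) * norm (F - 1)"
  proof -
    have "1 / F - 1 = (1 / F) * (1 - F)" using F0 by (simp add: field_simps)
    then have "norm (1 / F - 1) = norm (1 / F) * norm (F - 1)" by (simp only: norm_mult norm_minus_commute)
    then show ?thesis using y by (simp only: mult_right_mono norm_ge_zero)
  qed
  ultimately have "norm (1 / F - 1) * norm (\<Sum>i<n. (1 / F) ^ i) \<le> ((1 / d) * norm (F - 1)) * (\<Sum>i<n. (1 / d) ^ m)"
    using d by (intro mult_mono) auto
  also have "\<dots> = real n * (1 / d) ^ n * norm (F - 1)" by (simp add: Suc)
  finally show ?thesis
    using power_diff_1_eq[of "1 / F" n] by (simp add: norm_mult power_one_over)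
qed simp

text \<open>
  Wiener's lemma by Newman's argument. Powers of \<open>1 / F\<close> are controlled in norm through their size
  in a strip, at the rate \<open>2 / \<delta>\<close>, while the remainder \<open>d\<close> has norm at most \<open>\<delta> / 4\<close>; their
  products decay like \<open>(1 / 2) ^ n\<close> up to a factor linear in \<open>n\<close>.
\<close>

theorem wiener_inverse:
  assumes km: "k \<in> borel_measurable borel" and kc: "continuous_on {0..} k"
    and k: "set_integrable lborel {0..} k"
    and nz: "\<And>\<omega>. 1 + laplace k (Complex 0 \<omega>) \<noteq> 0"
  obtains m where "integrable lborel m" "\<And>\<omega>. 1 / (1 + laplace k (Complex 0 \<omega>)) = 1 + fourier m \<omega>"
proof -
  obtain \<delta> where \<delta>: "0 < \<delta>" "\<delta> \<le> 1" "\<And>\<omega>. \<delta> \<le> norm (1 + laplace k (Complex 0 \<omega>))"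
    by (rule transform_bounded_below_on_axis[OF km kc k nz]) (rule that)
  obtain N c where c: "(LINT t:{0..}|lborel. norm (k t - exp_poly N c t)) < \<delta> / 4"
    by (rule exp_poly_dense[OF km kc k, of "\<delta> / 4"]) (use \<delta> in simp, rule that)
  define P where "P = exp_poly_transform N c"
  define F where "F z = 1 + P z" for z
  define d where "d \<omega> = P (Complex 0 \<omega>) - laplace k (Complex 0 \<omega>)" for \<omega>
  have d_bound: "norm (d \<omega>) \<le> \<delta> / 4" for \<omega>
    using exp_poly_approx_transform[OF km k c, of "Complex 0 \<omega>"] by (simp add: d_def P_def norm_minus_commute)
  have wd: "wiener d (\<delta> / 4)"
  proof -
    have ie: "set_integrable lborel {0..} (exp_poly N c)"
      using exp_poly_laplace(1)[of 0 N c] by simp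
    have "d = (\<lambda>\<omega>. laplace (\<lambda>t. exp_poly N c t - k t) (Complex 0 \<omega>))"
    proof
      fix \<omega>
      have "set_integrable lborel {0..} (\<lambda>t. k t * exp (- (of_real t * Complex 0 \<omega>)))"
        using laplace_integrable[OF km, of 0] set_integrable_norm[OF k] by simp
      then show "d \<omega> = laplace (\<lambda>t. exp_poly N c t - k t) (Complex 0 \<omega>)"
        using exp_poly_laplace[of "Complex 0 \<omega>" N c]
        by (simp add: laplace_def left_diff_distrib set_integral_diff d_def P_def)
    qed
    moreover have "wiener (\<lambda>\<omega>. laplace (\<lambda>t. exp_poly N c t - k t) (Complex 0 \<omega>)) (\<delta> / 4)"
      using set_integral_diff(1)[OF ie k] c by (intro wiener_laplace) (auto simp: norm_minus_commute)
    ultimately show ?thesis by simp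
  qed
  define S where "S = (\<Sum>j<N. norm (c j))"
  have S: "S \<ge> 0" by (simp add: S_def sum_nonneg)
  have F_axis: "norm (F (Complex 0 \<omega>)) \<ge> 3 * \<delta> / 4" for \<omega>
  proof -
    have "1 + laplace k (Complex 0 \<omega>) = F (Complex 0 \<omega>) - d \<omega>" by (simp add: F_def d_def)
    then have "\<delta> \<le> norm (F (Complex 0 \<omega>)) + norm (d \<omega>)"
      using \<delta>(3)[of \<omega>] norm_triangle_ineq4[of "F (Complex 0 \<omega>)" "d \<omega>"] by simp
    then show ?thesis using d_bound[of \<omega>] by simp
  qed
  (* The transform varies by at most 8 * S times the distance to the axis, so this half-width 2 * e
     costs at most \<delta> / 4; the bound 1 / 4 keeps the strip away from the poles at negative integers. *)
  define e where "e = min (1/4) (\<delta> / (64 * (S + 1)))"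
  have e: "e > 0" "e \<le> 1/4" "16 * S * e \<le> \<delta> / 4"
  proof -
    show "e > 0" using \<delta>(1) S by (simp add: e_def)
    show "e \<le> 1/4" unfolding e_def by (rule min.cobounded1)
    have "16 * S * e \<le> 16 * (S + 1) * (\<delta> / (64 * (S + 1)))"
      using S \<delta>(1) \<open>e > 0\<close> by (intro mult_mono) (auto simp: e_def)
    also have "\<dots> = \<delta> / 4" using S by (simp add: field_simps)
    finally show "16 * S * e \<le> \<delta> / 4" .
  qed
  have strip: "Re z \<ge> - 1 / 2" if "\<bar>Re z\<bar> < 2 * e" for z using that e(2) by linarith
  have F_strip: "norm (F z) \<ge> \<delta> / 2" if z: "\<bar>Re z\<bar> < 2 * e" for z
  proof -
    have "norm (P z - P (Complex 0 (Im z))) \<le> 8 * S * norm (z - Complex 0 (Im z))"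
      unfolding P_def S_def using strip[OF z] by (intro exp_poly_transform_lipschitz) auto
    also have "norm (z - Complex 0 (Im z)) = \<bar>Re z\<bar>" by (simp add: cmod_def)
    also have "8 * S * \<bar>Re z\<bar> \<le> 8 * S * (2 * e)" using S z by (intro mult_left_mono) auto
    also have "\<dots> \<le> \<delta> / 4" using e(3) by simp
    finally have "norm (F z - F (Complex 0 (Im z))) \<le> \<delta> / 4" by (simp add: F_def)
    then show ?thesis
      using F_axis[of "Im z"] norm_triangle_sub[of "F (Complex 0 (Im z))" "F z"] by (simp add: norm_minus_commute)
  qed
  have F_holo: "F holomorphic_on {z. \<bar>Re z\<bar> < 2 * e}"
  proof -
    have "z + of_nat j + 1 \<noteq> 0" "z + of_nat j + 2 \<noteq> 0" if "\<bar>Re z\<bar> < 2 * e" for z j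
      using strip[OF that] by (auto simp: complex_eq_iff)
    then show ?thesis unfolding F_def[abs_def] P_def exp_poly_transform_def
      by (intro holomorphic_intros) auto
  qed
  define A where "A = 4 * S / e"
  have A: "A \<ge> 0" using S e by (simp add: A_def)
  have wG: "wiener (\<lambda>\<omega>. 1 / F (Complex 0 \<omega>) ^ n - 1) (real n * (2 / \<delta>) ^ n * A)" for n
  proof -
    have "wiener (\<lambda>\<omega>. 1 / F (Complex 0 \<omega>) ^ n - 1) ((real n * (2 / \<delta>) ^ n * (4 * S)) / e)"
    proof (rule wiener_strip[OF e(1)])
      have "F z \<noteq> 0" if "\<bar>Re z\<bar> < 2 * e" for z using F_strip[OF that] \<delta>(1) by auto
      then show "(\<lambda>z. 1 / F z ^ n - 1) holomorphic_on {z. \<bar>Re z\<bar> < 2 * e}"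
        using F_holo by (intro holomorphic_intros) auto
      fix z assume z: "\<bar>Re z\<bar> < 2 * e"
      have "norm (1 / F z ^ n - 1) \<le> real n * (1 / (\<delta> / 2)) ^ n * norm (F z - 1)"
        using F_strip[OF z] \<delta> by (intro norm_inverse_power_minus_one_le) auto
      also have "\<dots> \<le> real n * (1 / (\<delta> / 2)) ^ n * (4 * S / (1 + (Im z)\<^sup>2))"
        using exp_poly_transform_bound[OF strip[OF z], of N c] \<delta>(1)
        by (intro mult_left_mono) (auto simp: F_def P_def S_def)
      finally show "norm (1 / F z ^ n - 1) \<le> (real n * (2 / \<delta>) ^ n * (4 * S)) / (1 + (Im z)\<^sup>2)"
        by simp
    qed
    then show ?thesis by (simp add: A_def)
  qed
  (* The geometric series for 1 / (F - d), with the limit 1 at infinity taken off its first term. *)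
  define T where "T n \<omega> = d \<omega> ^ n / F (Complex 0 \<omega>) ^ Suc n - (if n = 0 then 1 else 0)" for n \<omega>
  define b where "b n = (\<delta> / 4) ^ n + (\<delta> / 4) ^ n * (real (Suc n) * (2 / \<delta>) ^ Suc n * A)" for n
  have wT: "wiener (T n) (b n)" for n
  proof (cases n)
    case 0
    show ?thesis using wiener_mono[OF wG[of 1], of "b 0"] 0 by (simp add: T_def[abs_def] b_def)
  next
    case (Suc m)
    have dn: "wiener (\<lambda>\<omega>. d \<omega> ^ n) ((\<delta> / 4) ^ n)" by (rule wiener_power[OF wd]) (simp add: Suc)
    have "T n = (\<lambda>\<omega>. d \<omega> ^ n + d \<omega> ^ n * (1 / F (Complex 0 \<omega>) ^ Suc n - 1))"
      using Suc by (simp add: T_def fun_eq_iff algebra_simps)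
    then show ?thesis unfolding b_def using wiener_add[OF dn wiener_mult[OF dn wG[of "Suc n"]]] by (simp only:)
  qed
  have sb: "summable b"
  proof -
    have eq: "b n = (\<delta> / 4) ^ n + (2 / \<delta> * A) * (real (Suc n) * (1 / 2) ^ n)" for n
    proof -
      have "(\<delta> / 4) ^ n * (2 / \<delta>) ^ n = (1 / 2) ^ n"
        unfolding power_mult_distrib[symmetric] using \<delta>(1) by simp
      moreover have "x * (k * (p * y) * A) = p * A * (k * (x * y))" for x y k p :: real
        by (simp only: mult_ac)
      ultimately show ?thesis unfolding b_def power_Suc by (simp only:)
    qed
    have "summable (\<lambda>n. real (Suc n) * (1 / 2) ^ n)"
      using geometric_deriv_sums[of "1/2 :: real"] by (simp add: sums_iff)
    then show ?thesis unfolding eq[abs_def] using \<delta>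
      by (intro summable_add summable_mult summable_geometric) auto
  qed
  have sT: "(\<lambda>n. T n \<omega>) sums (1 / (1 + laplace k (Complex 0 \<omega>)) - 1)" for \<omega>
  proof -
    let ?F = "F (Complex 0 \<omega>)"
    have F0: "?F \<noteq> 0" using F_axis[of \<omega>] \<delta>(1) by auto
    have "norm (d \<omega>) < norm ?F" using d_bound[of \<omega>] F_axis[of \<omega>] \<delta>(1) by linarith
    then have "norm (d \<omega> / ?F) < 1" using F0 by (simp add: norm_divide)
    from sums_divide[OF geometric_sums[OF this], of ?F]
    have "(\<lambda>n. d \<omega> ^ n / ?F ^ Suc n) sums (1 / (1 - d \<omega> / ?F) / ?F)"
      by (simp add: power_divide mult.commute)
    also have "1 - d \<omega> / ?F = (?F - d \<omega>) / ?F" using F0 by (simp add: diff_divide_distrib)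
    also have "1 / ((?F - d \<omega>) / ?F) / ?F = 1 / (?F - d \<omega>)" using F0 by simp
    also have "?F - d \<omega> = 1 + laplace k (Complex 0 \<omega>)" by (simp add: F_def d_def)
    finally show ?thesis unfolding T_def
      using sums_single[of 0 "\<lambda>_. 1 :: complex"] by (intro sums_diff) auto
  qed
  obtain C where "wiener (\<lambda>\<omega>. 1 / (1 + laplace k (Complex 0 \<omega>)) - 1) C"
    using wiener_sums[OF wT sb sT] by blast
  then obtain m where m: "integrable lborel m" "(\<lambda>\<omega>. 1 / (1 + laplace k (Complex 0 \<omega>)) - 1) = fourier m"
    unfolding wiener_def by blast
  have "1 / (1 + laplace k (Complex 0 \<omega>)) = 1 + fourier m \<omega>" for \<omega>
    using fun_cong[OF m(2), of \<omega>] by (simp add: algebra_simps)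
  with m(1) show ?thesis by (rule that)
qed

section \<open>Principal parts of a reciprocal\<close>

text \<open>
  Factor \<open>f w = g w * (w - \<mu>) ^ n\<close> with \<open>g \<mu> \<noteq> 0\<close>. The first \<open>n\<close> Taylor coefficients of
  \<open>1 / g\<close> are the residues that form the principal part; the rest of the Taylor series is \<open>\<psi>\<close>.
\<close>

lemma inverse_principal_part:
  fixes f :: "complex \<Rightarrow> complex"
  assumes f: "f holomorphic_on S" "open S" "connected S" "\<mu> \<in> S" and nz: "\<exists>w\<in>S. f w \<noteq> 0"
  obtains r \<psi> where "r > 0" "ball \<mu> r \<subseteq> S" "\<psi> holomorphic_on ball \<mu> r"
    "\<And>w. w \<in> ball \<mu> r \<Longrightarrow> w \<noteq> \<mu> \<Longrightarrow> f w \<noteq> 0 \<and> inverse (f w) =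
       \<psi> w + (\<Sum>j<nat (zorder f \<mu>). residue (\<lambda>z. (z - \<mu>) ^ j * inverse (f z)) \<mu> / (w - \<mu>) ^ Suc j)"
proof -
  define n where "n = nat (zorder f \<mu>)"
  define g where "g = zor_poly f \<mu>"
  obtain r where r: "r > 0" "cball \<mu> r \<subseteq> S" "g holomorphic_on cball \<mu> r"
    and fg: "\<And>w. w \<in> cball \<mu> r \<Longrightarrow> f w = g w * (w - \<mu>) ^ n \<and> g w \<noteq> 0"
    using zorder_exist_zero[OF f nz] unfolding n_def g_def by blast
  define \<phi> where "\<phi> w = inverse (g w)" for w
  have \<phi>: "\<phi> holomorphic_on ball \<mu> r"
    unfolding \<phi>_def using fg r(3) by (intro holomorphic_intros) (auto intro: holomorphic_on_subset)
  define c where "c i = (deriv ^^ i) \<phi> \<mu> / fact i" for i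
  have c: "(\<lambda>i. c i * (w - \<mu>) ^ i) sums \<phi> w" if "w \<in> ball \<mu> r" for w
    unfolding c_def by (rule holomorphic_power_series[OF \<phi> that])
  define \<psi> where "\<psi> w = (\<Sum>i. c (i + n) * (w - \<mu>) ^ i)" for w
  have \<psi>: "(\<lambda>i. c (i + n) * (w - \<mu>) ^ i) sums \<psi> w" if w: "w \<in> ball \<mu> r" for w
  proof (cases "w = \<mu>")
    case False
    have "summable (\<lambda>i. c (i + n) * (w - \<mu>) ^ (i + n) / (w - \<mu>) ^ n)"
      using c[OF w] by (intro summable_divide) (auto simp: summable_iff_shift[of "\<lambda>i. c i * (w - \<mu>) ^ i"] sums_iff)
    then show ?thesis unfolding \<psi>_def using False by (simp add: power_add summable_sums)
  next
    case True
    have "summable (\<lambda>i. c (i + n) * (w - \<mu>) ^ i)"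
      by (rule summable_finite[of "{0}"]) (use True in \<open>auto simp: power_0_left\<close>)
    then show ?thesis unfolding \<psi>_def by (rule summable_sums)
  qed
  have "\<psi> holomorphic_on ball \<mu> r" by (rule power_series_holomorphic[OF \<psi>])
  have \<phi>\<psi>: "\<phi> w = (\<Sum>i<n. c i * (w - \<mu>) ^ i) + (w - \<mu>) ^ n * \<psi> w" if w: "w \<in> ball \<mu> r" for w
  proof -
    have "(\<Sum>i. c (i + n) * (w - \<mu>) ^ (i + n)) = (\<Sum>i. (w - \<mu>) ^ n * (c (i + n) * (w - \<mu>) ^ i))"
      by (simp add: power_add mult_ac)
    also have "\<dots> = (w - \<mu>) ^ n * \<psi> w"
      using \<psi>[OF w] by (intro sums_unique[symmetric] sums_mult)
    finally show ?thesis
      using suminf_split_initial_segment[of "\<lambda>i. c i * (w - \<mu>) ^ i" n] c[OF w] by (simp add: sums_iff)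
  qed
  have res: "residue (\<lambda>z. (z - \<mu>) ^ j * inverse (f z)) \<mu> = c (n - Suc j)" if j: "j < n" for j
  proof -
    have "eventually (\<lambda>z. z \<in> ball \<mu> r) (at \<mu>)" "eventually (\<lambda>z. z \<noteq> \<mu>) (at \<mu>)"
      using r(1) by (intro eventually_at_in_open' eventually_neq_at_within; simp)+
    then have "eventually (\<lambda>z. (z - \<mu>) ^ j * inverse (f z) = \<phi> z / (z - \<mu>) ^ Suc (n - Suc j)) (at \<mu>)"
    proof eventually_elim
      case (elim z)
      have "(z - \<mu>) ^ n = (z - \<mu>) ^ j * (z - \<mu>) ^ Suc (n - Suc j)"
        using j by (simp only: power_add[symmetric]) simp
      moreover have "f z = g z * (z - \<mu>) ^ n" using fg[of z] elim by auto
      ultimately have "f z = g z * ((z - \<mu>) ^ j * (z - \<mu>) ^ Suc (n - Suc j))" by (simp only:)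
      then show ?case using elim(2) by (simp add: \<phi>_def divide_inverse del: power_Suc)
    qed
    then have "residue (\<lambda>z. (z - \<mu>) ^ j * inverse (f z)) \<mu> = residue (\<lambda>z. \<phi> z / (z - \<mu>) ^ Suc (n - Suc j)) \<mu>"
      by (intro residue_cong) auto
    also have "\<dots> = c (n - Suc j)"
      unfolding c_def using r(1) by (intro residue_holomorphic_over_power[OF _ _ \<phi>]) auto
    finally show ?thesis .
  qed
  have "f w \<noteq> 0 \<and> inverse (f w) = \<psi> w + (\<Sum>j<n. residue (\<lambda>z. (z - \<mu>) ^ j * inverse (f z)) \<mu> / (w - \<mu>) ^ Suc j)"
    if w: "w \<in> ball \<mu> r" "w \<noteq> \<mu>" for w
  proof -
    have f0: "f w \<noteq> 0" "inverse (f w) = \<phi> w / (w - \<mu>) ^ n"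
      using fg[of w] w by (auto simp: \<phi>_def field_simps)
    have "(\<Sum>i<n. c i * (w - \<mu>) ^ i) / (w - \<mu>) ^ n = (\<Sum>j<n. c (n - Suc j) * (w - \<mu>) ^ (n - Suc j)) / (w - \<mu>) ^ n"
      by (subst sum.nat_diff_reindex[symmetric]) simp
    also have "\<dots> = (\<Sum>j<n. residue (\<lambda>z. (z - \<mu>) ^ j * inverse (f z)) \<mu> / (w - \<mu>) ^ Suc j)"
      unfolding sum_divide_distrib
    proof (intro sum.cong refl)
      fix j assume "j \<in> {..<n}"
      then have j: "j < n" by simp
      have "(w - \<mu>) ^ n = (w - \<mu>) ^ (n - Suc j) * (w - \<mu>) ^ Suc j"
        using j by (simp only: power_add[symmetric]) simp
      then show "c (n - Suc j) * (w - \<mu>) ^ (n - Suc j) / (w - \<mu>) ^ n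
          = residue (\<lambda>z. (z - \<mu>) ^ j * inverse (f z)) \<mu> / (w - \<mu>) ^ Suc j"
        unfolding res[OF j] using w(2) by simp
    qed
    finally show ?thesis
      using f0 w \<phi>\<psi>[OF w(1)] by (simp add: add_divide_distrib)
  qed
  then show ?thesis
    using r \<open>\<psi> holomorphic_on ball \<mu> r\<close> unfolding n_def by (intro that[of r \<psi>]) auto
qed

definition principal_parts :: "(complex \<Rightarrow> complex) \<Rightarrow> complex set \<Rightarrow> complex \<Rightarrow> complex" where
  "principal_parts f Z w = (\<Sum>\<mu>\<in>Z. \<Sum>j<nat (zorder f \<mu>).
     residue (\<lambda>z. (z - \<mu>) ^ j * inverse (f z)) \<mu> / (w - \<mu>) ^ Suc j)"

lemma holomorphic_principal_parts: "principal_parts f Z holomorphic_on - Z"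
  unfolding principal_parts_def[abs_def] by (intro holomorphic_intros) auto

lemma principal_parts_at_infinity: "(principal_parts f Z \<longlongrightarrow> 0) at_infinity"
  unfolding principal_parts_def[abs_def]
proof (intro tendsto_null_sum)
  fix \<mu> :: complex and j :: nat
  have "filterlim (\<lambda>w. - \<mu> + w) at_infinity at_infinity"
    by (intro tendsto_add_filterlim_at_infinity[OF tendsto_const] filterlim_ident)
  then have "((\<lambda>w. inverse (- \<mu> + w)) \<longlongrightarrow> 0) at_infinity"
    by (rule filterlim_compose[OF tendsto_inverse_0])
  from tendsto_mult[OF tendsto_const tendsto_power[OF this, of "Suc j"], of "residue (\<lambda>z. (z - \<mu>) ^ j * inverse (f z)) \<mu>"]
  show "((\<lambda>w. residue (\<lambda>z. (z - \<mu>) ^ j * inverse (f z)) \<mu> / (w - \<mu>) ^ Suc j) \<longlongrightarrow> 0) at_infinity"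
    by (simp add: divide_inverse power_inverse del: power_Suc)
qed

text \<open>
  At each zero of \<open>f\<close> the polar part belonging to it cancels the pole of \<open>1 / f\<close>, and the other
  polar parts are holomorphic there, so all singularities are removable.
\<close>

lemma inverse_minus_principal_parts:
  fixes f :: "complex \<Rightarrow> complex"
  assumes f: "f holomorphic_on S" "open S" "connected S" and nz: "\<exists>w\<in>S. f w \<noteq> 0"
    and Z: "finite Z" "Z = {z\<in>S. f z = 0}"
  obtains E where "E holomorphic_on S" "\<And>w. w \<in> S - Z \<Longrightarrow> E w = inverse (f w) - principal_parts f Z w"
proof -
  let ?h = "\<lambda>w. inverse (f w) - principal_parts f Z w"
  define E where "E w = (if w \<in> Z then Lim (at w) ?h else ?h w)" for w
  have "E holomorphic_on S"
  proof (rule no_isolated_singularity'[OF _ _ f(2) Z(1)])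
    have "?h holomorphic_on S - Z"
      using f Z by (intro holomorphic_intros holomorphic_on_subset[OF holomorphic_principal_parts])
        (auto intro: holomorphic_on_subset)
    then show "E holomorphic_on S - Z"
      by (rule holomorphic_transform) (auto simp: E_def)
    fix \<mu> assume \<mu>: "\<mu> \<in> Z"
    then have "\<mu> \<in> S" using Z by auto
    obtain r \<psi> where r: "r > 0" "ball \<mu> r \<subseteq> S" "\<psi> holomorphic_on ball \<mu> r"
      and \<psi>: "\<And>w. w \<in> ball \<mu> r \<Longrightarrow> w \<noteq> \<mu> \<Longrightarrow> f w \<noteq> 0 \<and> inverse (f w) =
       \<psi> w + (\<Sum>j<nat (zorder f \<mu>). residue (\<lambda>z. (z - \<mu>) ^ j * inverse (f z)) \<mu> / (w - \<mu>) ^ Suc j)"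
      by (rule inverse_principal_part[OF f \<open>\<mu> \<in> S\<close> nz]) (rule that)
    define v where "v w = \<psi> w - principal_parts f (Z - {\<mu>}) w" for w
    have "isCont v \<mu>"
    proof -
      have "isCont \<psi> \<mu>" 
        by (rule continuous_on_interior[OF holomorphic_on_imp_continuous_on[OF r(3)]]) (use r(1) in simp)
      moreover have "isCont (principal_parts f (Z - {\<mu>})) \<mu>"
      proof -
        have "open (- (Z - {\<mu>}))" using Z(1) by (intro open_Compl finite_imp_closed) auto
        then show ?thesis using holomorphic_on_imp_continuous_on[OF holomorphic_principal_parts[of f "Z - {\<mu>}"]]
          by (simp add: continuous_on_eq_continuous_at)
      qed
      ultimately show ?thesis unfolding v_def by (intro continuous_intros)
    qed
    then have v: "(v \<longlongrightarrow> v \<mu>) (at \<mu>)" by (simp add: isCont_def)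
    have ev: "eventually (\<lambda>w. w \<in> ball \<mu> r) (at \<mu>)" "eventually (\<lambda>w. w \<noteq> \<mu>) (at \<mu>)"
      using r(1) by (intro eventually_at_in_open' eventually_neq_at_within; simp)+
    have ev1: "eventually (\<lambda>w. ?h w = v w \<and> E w = ?h w) (at \<mu>)"
      using ev
    proof eventually_elim
      case (elim w)
      have "principal_parts f Z w = (\<Sum>j<nat (zorder f \<mu>). residue (\<lambda>z. (z - \<mu>) ^ j * inverse (f z)) \<mu> / (w - \<mu>) ^ Suc j)
          + principal_parts f (Z - {\<mu>}) w"
        unfolding principal_parts_def by (rule sum.remove[OF Z(1) \<mu>])
      then have "?h w = v w" unfolding v_def using \<psi>[OF elim] by simp
      moreover have "w \<notin> Z" using \<psi>[OF elim] Z(2) by auto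
      ultimately show ?case by (simp add: E_def)
    qed
    have h: "(?h \<longlongrightarrow> v \<mu>) (at \<mu>)"
      using v by (rule Lim_transform_eventually) (use ev1 in eventually_elim, simp)
    then have "E \<mu> = v \<mu>" using \<mu> by (simp add: E_def tendsto_Lim)
    moreover have "(E \<longlongrightarrow> v \<mu>) (at \<mu>)"
      using h by (rule Lim_transform_eventually) (use ev1 in eventually_elim, simp)
    ultimately show "(E \<longlongrightarrow> E \<mu>) (at \<mu> within S)"
      using tendsto_mono[OF at_le[OF subset_UNIV]] by metis
  qed
  then show ?thesis by (rule that) (simp add: E_def)
qed

section \<open>Decomposition of the reciprocal symbol\<close>

text \<open>
  The two half-axes contribute Laplace transforms that continue to opposite half-planes.
\<close>

lemma fourier_split:
  fixes m :: "real \<Rightarrow> complex"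
  assumes m: "integrable lborel m"
  shows "fourier m \<omega> = laplace (\<lambda>t. m t) (Complex 0 \<omega>) + laplace (\<lambda>t. m (- t)) (- Complex 0 \<omega>)"
proof -
  have [measurable]: "m \<in> borel_measurable borel" using m by (auto dest: borel_measurable_integrable)
  let ?f = "\<lambda>t. m t * cis (- (\<omega> * t))"
  have f: "integrable lborel ?f" using integrable_mult_cis[OF m, of "-\<omega>"] by simp
  have i: "integrable lborel (\<lambda>t. indicator A t *\<^sub>R ?f t)" if "A \<in> sets borel" for A
    by (rule integrable_mult_indicator[OF _ f]) (use that in simp)
  have "fourier m \<omega> = (LINT t|lborel. indicator {0..} t *\<^sub>R ?f t + indicator {..<0} t *\<^sub>R ?f t)"
    unfolding fourier_def by (intro Bochner_Integration.integral_cong refl) (simp add: indicator_def)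
  also have "\<dots> = (LINT t|lborel. indicator {0..} t *\<^sub>R ?f t) + (LINT t|lborel. indicator {..<0} t *\<^sub>R ?f t)"
    by (intro Bochner_Integration.integral_add i) auto
  also have "(LINT t|lborel. indicator {0..} t *\<^sub>R ?f t) = laplace m (Complex 0 \<omega>)"
    unfolding laplace_def set_lebesgue_integral_def
    by (intro Bochner_Integration.integral_cong refl) (simp add: cis_conv_exp Complex_eq algebra_simps)
  also have "(LINT t|lborel. indicator {..<0} t *\<^sub>R ?f t) = (LINT t|lborel. indicator {..<0} (0 - t) *\<^sub>R ?f (0 - t))"
    by (rule integral_reflect[symmetric])
  also have "\<dots> = (LINT t:{0<..}|lborel. m (- t) * exp (- (complex_of_real t * - Complex 0 \<omega>)))"
    unfolding set_lebesgue_integral_def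
    by (intro Bochner_Integration.integral_cong refl) (simp add: indicator_def cis_conv_exp Complex_eq algebra_simps)
  also have "\<dots> = laplace (\<lambda>t. m (- t)) (- Complex 0 \<omega>)"
    unfolding laplace_def by (rule integrable_ray_iff(2)) measurable
  finally show ?thesis .
qed

lemma laplace_shift: "laplace (\<lambda>t. r t * exp (of_real (b * t))) z = laplace r (z - of_real b)"
  unfolding laplace_def set_lebesgue_integral_def
  by (intro Bochner_Integration.integral_cong refl) (simp add: algebra_simps flip: exp_add)

lemma laplace_along_real_axis:
  assumes rm[measurable]: "r \<in> borel_measurable borel"
    and r: "set_integrable lborel {0..} (\<lambda>t. norm (r t) * exp (a * t))"
  shows "(\<lambda>n. laplace r (of_nat n)) \<longlonglongrightarrow> 0"
proof -
  obtain N :: nat where N: "real N \<ge> - a" using real_arch_simple by blast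
  have "(\<lambda>n. laplace r (of_nat (n + N))) \<longlonglongrightarrow> (LINT t|lborel. (\<lambda>_::real. 0) t)"
    unfolding laplace_def set_lebesgue_integral_def
  proof (rule integral_dominated_convergence[OF _ _ r[unfolded set_integrable_def]])
    show "AE t in lborel. (\<lambda>n. indicator {0..} t *\<^sub>R (r t * exp (- (complex_of_real t * of_nat (n + N))))) \<longlonglongrightarrow> 0"
      using AE_lborel_singleton[of "0::real"]
    proof eventually_elim
      case (elim t)
      show ?case
      proof (cases "t > 0")
        case True
        have "(\<lambda>n. norm (r t) * exp (- (t * real (n + N)))) \<longlonglongrightarrow> norm (r t) * 0"
          using True by (intro tendsto_mult tendsto_const) real_asymp
        then have "(\<lambda>n. norm (indicator {0..} t *\<^sub>R (r t * exp (- (complex_of_real t * of_nat (n + N)))))) \<longlonglongrightarrow> 0"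
          using True by (simp add: norm_mult)
        then show ?thesis by (rule tendsto_norm_zero_cancel)
      qed (use elim in \<open>simp add: indicator_def\<close>)
    qed
    show "AE t in lborel. norm (indicator {0..} t *\<^sub>R (r t * exp (- (complex_of_real t * of_nat (n + N)))))
        \<le> indicator {0..} t *\<^sub>R (norm (r t) * exp (a * t))" for n
    proof (rule AE_I2)
      fix t :: real
      have "- a \<le> real (n + N)" using N by simp
      then have "t \<ge> 0 \<Longrightarrow> - (t * real (n + N)) \<le> a * t"
        using mult_right_mono[of "- a" "real (n + N)" t] by (simp add: algebra_simps)
      then show "norm (indicator {0..} t *\<^sub>R (r t * exp (- (complex_of_real t * of_nat (n + N)))))
        \<le> indicator {0..} t *\<^sub>R (norm (r t) * exp (a * t))"
        by (auto simp: norm_mult indicator_def intro!: mult_left_mono)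
    qed
  qed measurable
  then have "(\<lambda>n. laplace r (of_nat (n + N))) \<longlonglongrightarrow> 0" by simp
  then show ?thesis by (rule LIMSEQ_offset)
qed

text \<open>
  The zeros lie in a bounded set by the Riemann-Lebesgue lemma and off the line \<open>Re z = - a\<close> by
  hypothesis. They thus form a compact subset of the open half-plane, where they are isolated.
\<close>

lemma finite_char_zeros:
  assumes km: "k \<in> borel_measurable borel" and kc: "continuous_on {0..} k"
    and k: "set_integrable lborel {0..} (\<lambda>t. norm (k t) * exp (a * t))"
    and nz: "\<And>z. Re z = - a \<Longrightarrow> laplace k z \<noteq> - 1"
  obtains R where "\<And>z. Re z \<ge> - a \<Longrightarrow> norm z \<ge> R \<Longrightarrow> norm (laplace k z) < 1 / 2"
    "finite (char_zeros k a)"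
proof -
  let ?k = "\<lambda>t. k t * exp (complex_of_real (a * t))"
  have int: "set_integrable lborel {0..} ?k"
  proof (rule set_integrable_bound[OF k])
    show "set_borel_measurable lborel {0..} ?k"
      using km unfolding set_borel_measurable_def by measurable
  qed (simp add: norm_mult)
  have cont: "continuous_on {0..} ?k" by (intro continuous_intros kc)
  have meas: "?k \<in> borel_measurable borel" using km by measurable
  obtain R where R: "\<And>z. Re z \<ge> 0 \<Longrightarrow> norm z \<ge> R \<Longrightarrow> norm (laplace ?k z) < 1 / 2"
    by (rule Riemann_Lebesgue_half_plane[OF meas cont int, of "1/2"]) (simp, rule that)
  have far: "norm (laplace k z) < 1 / 2" if z: "Re z \<ge> - a" "norm z \<ge> R + \<bar>a\<bar>" for z
  proof -
    have "norm (z + of_real a) \<ge> R" using z(2) norm_triangle_ineq4[of "z + of_real a" "of_real a"] by simp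
    then show ?thesis using R[of "z + of_real a", unfolded laplace_shift] z(1) by simp
  qed
  let ?f = "\<lambda>z. 1 + laplace k z"
  let ?S = "{z. Re z > - a}"
  define C where "C = {z. Re z \<ge> - a} \<inter> cball 0 (R + \<bar>a\<bar>)"
  define Kc where "Kc = {z \<in> C. ?f z = 0}"
  have "closed {z. Re z \<ge> - a}" by (rule closed_halfspace_Re_ge)
  then have C: "compact C" unfolding C_def by (intro closed_Int_compact compact_cball)
  have "continuous_on C ?f"
    unfolding C_def by (intro continuous_intros continuous_on_subset[OF continuous_on_laplace[OF km k]]) auto
  then have "closedin (top_of_set C) Kc" unfolding Kc_def
    by (rule continuous_closedin_preimage_constant)
  then have "compact Kc" using C by (rule closedin_compact[rotated])
  have sub: "char_zeros k a \<subseteq> Kc" "Kc \<subseteq> ?S"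
  proof -
    show "char_zeros k a \<subseteq> Kc"
    proof
      fix z assume z: "z \<in> char_zeros k a"
      then have "laplace k z = - 1" by (simp add: char_zeros_def add_eq_0_iff)
      then have "\<not> norm z \<ge> R + \<bar>a\<bar>" using far[of z] z by (auto simp: char_zeros_def)
      then show "z \<in> Kc" using z by (auto simp: Kc_def C_def char_zeros_def)
    qed
    show "Kc \<subseteq> ?S"
    proof
      fix z assume z: "z \<in> Kc"
      then have "Re z \<noteq> - a" using nz[of z] by (auto simp: Kc_def add_eq_0_iff)
      then show "z \<in> ?S" using z by (auto simp: Kc_def C_def)
    qed
  qed
  have "finite (char_zeros k a)"
  proof (cases "?f constant_on ?S")
    case True
    then obtain c where c: "\<And>z. Re z > - a \<Longrightarrow> ?f z = c" unfolding constant_on_def by auto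
    define z0 where "z0 = complex_of_real (\<bar>a\<bar> + \<bar>R\<bar> + 1)"
    have "norm (laplace k z0) < 1/2"
      by (rule far) (simp_all add: z0_def del: of_real_add)
    then have "?f z0 \<noteq> 0" by (auto simp: add_eq_0_iff)
    moreover have "Re z0 > - a" by (simp add: z0_def)
    ultimately have "char_zeros k a = {}" using c by (auto simp: char_zeros_def)
    then show ?thesis by simp
  next
    case False
    have "finite {z \<in> Kc. ?f z = 0}"
    proof (rule holomorphic_compact_finite_zeros[OF _ _ _ \<open>compact Kc\<close> sub(2) False])
      show "?f holomorphic_on ?S" by (intro holomorphic_intros holomorphic_on_laplace[OF km k])
      show "open ?S" by (rule open_halfspace_Re_gt)
      show "connected ?S" by (intro convex_connected convex_halfspace_Re_gt)
    qed
    then show ?thesis by (rule finite_subset[rotated]) (use sub(1) in \<open>auto simp: char_zeros_def\<close>)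
  qed
  with far show ?thesis by (rule that)
qed

text \<open>
  The function \<open>\<Phi>\<close> of the proof is the entire function glued from both sides of the line
  \<open>Re z = - a\<close>; Liouville's theorem and its decay to the left show that it vanishes.
\<close>

theorem inverse_symbol_decomposition:
  assumes km: "k \<in> borel_measurable borel" and kc: "continuous_on {0..} k"
    and k: "set_integrable lborel {0..} (\<lambda>t. norm (k t) * exp (a * t))"
    and nz: "\<And>z. Re z = - a \<Longrightarrow> laplace k z \<noteq> - 1"
  obtains r where "r \<in> borel_measurable borel" "\<And>t. t < 0 \<Longrightarrow> r t = 0"
    "set_integrable lborel {0..} (\<lambda>t. norm (r t) * exp (a * t))"
    "\<And>z. Re z > - a \<Longrightarrow> 1 + laplace k z \<noteq> 0 \<Longrightarrow>
      inverse (1 + laplace k z) = 1 + principal_parts (\<lambda>z. 1 + laplace k z) (char_zeros k a) z + laplace r z"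
proof -
  let ?k = "\<lambda>t. k t * exp (complex_of_real (a * t))"
  obtain R where far: "\<And>z. Re z \<ge> - a \<Longrightarrow> norm z \<ge> R \<Longrightarrow> norm (laplace k z) < 1 / 2"
    and finite: "finite (char_zeros k a)"
    by (rule finite_char_zeros[OF km kc k nz]) (assumption, rule that)
  obtain m where m: "integrable lborel m" "\<And>\<omega>. 1 / (1 + laplace ?k (Complex 0 \<omega>)) = 1 + fourier m \<omega>"
  proof (rule wiener_inverse[of ?k])
    show "set_integrable lborel {0..} ?k"
    proof (rule set_integrable_bound[OF k])
      show "set_borel_measurable lborel {0..} ?k"
        using km unfolding set_borel_measurable_def by measurable
    qed (simp add: norm_mult)
    show "continuous_on {0..} ?k" by (intro continuous_intros kc)
    show "?k \<in> borel_measurable borel" using km by measurable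
    show "1 + laplace ?k (Complex 0 \<omega>) \<noteq> 0" for \<omega>
      unfolding laplace_shift using nz[of "Complex 0 \<omega> - of_real a"] by (simp add: add_eq_0_iff)
  qed (rule that)
  have mm[measurable]: "m \<in> borel_measurable borel" using m(1) by (auto dest: borel_measurable_integrable)
  define r where "r t = (if t < 0 then 0 else m t * exp (of_real (- a * t)))" for t
  define l where "l t = m (- t) * exp (of_real (a * t))" for t
  have rm[measurable]: "r \<in> borel_measurable borel" unfolding r_def[abs_def] by measurable
  have lm[measurable]: "l \<in> borel_measurable borel" unfolding l_def[abs_def] by measurable
  have ri: "set_integrable lborel {0..} (\<lambda>t. norm (r t) * exp (a * t))"
  proof -
    have "integrable lborel (\<lambda>t. indicator {0..} t *\<^sub>R norm (m t))"
      using integrable_mult_indicator[OF _ integrable_norm[OF m(1)], of "{0..}"] by simp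
    moreover have "indicator {0..} t *\<^sub>R (norm (r t) * exp (a * t)) = indicator {0..} t *\<^sub>R norm (m t)" for t
      by (simp add: r_def norm_mult indicator_def mult.assoc flip: exp_add)
    ultimately show ?thesis unfolding set_integrable_def by (simp only:)
  qed
  have li: "set_integrable lborel {0..} (\<lambda>t. norm (l t) * exp (- a * t))"
  proof -
    have "integrable lborel (\<lambda>t. m (- t))" using integrable_reflect[OF m(1), of 0] by simp
    then have "integrable lborel (\<lambda>t. indicator {0..} t *\<^sub>R norm (m (- t)))"
      using integrable_mult_indicator[OF _ integrable_norm, of "{0..}" lborel "\<lambda>t. m (- t)"] by simp
    moreover have "indicator {0..} t *\<^sub>R (norm (l t) * exp (- a * t)) = indicator {0..} t *\<^sub>R norm (m (- t))" for t
      by (simp add: l_def norm_mult indicator_def mult.assoc flip: exp_add)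
    ultimately show ?thesis unfolding set_integrable_def by (simp only:)
  qed
  define f where "f z = 1 + laplace k z" for z
  define Z where "Z = char_zeros k a"
  let ?S = "{z. Re z > - a}" and ?T = "{z. Re z \<ge> - a}"
  have fZ: "finite Z" using finite by (simp add: Z_def)
  have Z: "Z = {z \<in> ?S. f z = 0}" by (auto simp: Z_def char_zeros_def f_def)
  have boundary: "inverse (f z) = 1 + laplace r z + laplace l (- z)" if z: "Re z = - a" for z
  proof -
    have zc: "z = Complex 0 (Im z) - of_real a" using z by (simp add: complex_eq_iff)
    have "inverse (f z) = 1 / (1 + laplace ?k (Complex 0 (Im z)))"
      unfolding laplace_shift f_def using zc by (simp add: divide_inverse)
    also have "\<dots> = 1 + fourier m (Im z)" by (rule m(2))
    also have "fourier m (Im z) = laplace m (Complex 0 (Im z)) + laplace (\<lambda>t. m (- t)) (- Complex 0 (Im z))"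
      by (rule fourier_split[OF m(1)])
    also have "laplace m (Complex 0 (Im z)) = laplace r z"
    proof -
      have "laplace r z = laplace (\<lambda>t. m t * exp (of_real (- a * t))) z"
        unfolding laplace_def by (intro set_lebesgue_integral_cong) (auto simp: r_def)
      also have "\<dots> = laplace m (z - of_real (- a))" by (rule laplace_shift)
      also have "z - of_real (- a) = Complex 0 (Im z)" using z by (simp add: complex_eq_iff)
      finally show ?thesis by (rule sym)
    qed
    also have "laplace (\<lambda>t. m (- t)) (- Complex 0 (Im z)) = laplace l (- z)"
    proof -
      have "laplace l (- z) = laplace (\<lambda>t. m (- t)) (- z - of_real a)" unfolding l_def[abs_def] by (rule laplace_shift)
      also have "- z - of_real a = - Complex 0 (Im z)" using z by (simp add: complex_eq_iff)
      finally show ?thesis by simp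
    qed
    finally show ?thesis by (simp add: add.assoc)
  qed
  have f_holo: "f holomorphic_on ?S" unfolding f_def[abs_def]
    by (intro holomorphic_intros holomorphic_on_laplace[OF km k])
  have f_cont: "continuous_on ?T f" unfolding f_def[abs_def]
    by (intro continuous_intros continuous_on_laplace[OF km k])
  have oS: "open ?S" by (rule open_halfspace_Re_gt)
  have far_f: "norm (inverse (f z)) \<le> 2" "f z \<noteq> 0" if "Re z \<ge> - a" "norm z \<ge> R" for z
  proof -
    have "1 / 2 \<le> norm (f z)"
      using far[OF that] norm_triangle_ineq4[of "f z" "laplace k z"] by (simp add: f_def)
    then show "norm (inverse (f z)) \<le> 2" "f z \<noteq> 0"
      using le_imp_inverse_le[of "1/2" "norm (f z)"] by (auto simp: norm_inverse)
  qed
  have "\<exists>w\<in>?S. f w \<noteq> 0"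
  proof
    let ?w = "complex_of_real (\<bar>a\<bar> + \<bar>R\<bar> + 1)"
    show "?w \<in> ?S" by simp
    show "f ?w \<noteq> 0" by (rule far_f(2)) (simp_all del: of_real_add)
  qed
  then obtain E where E: "E holomorphic_on ?S" "\<And>w. w \<in> ?S - Z \<Longrightarrow> E w = inverse (f w) - principal_parts f Z w"
    using inverse_minus_principal_parts[OF f_holo oS _ _ fZ Z] convex_connected[OF convex_halfspace_Re_gt] by metis
  (* Off the zeros G extends continuously up to the line, which E alone does not provide. *)
  define G where "G z = (if z \<in> Z then E z else inverse (f z) - principal_parts f Z z)" for z
  have G_E: "G z = E z" if "Re z > - a" for z using E(2)[of z] that by (simp add: G_def)
  have contG: "continuous_on ?T G"
  proof -
    have eq: "?T = (?T - Z) \<union> ?S" using Z by auto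
    have o1: "openin (top_of_set ?T) (?T - Z)" using finite_imp_closed[OF fZ]
      by (metis Diff_eq open_Compl openin_open_Int)
    have o2: "openin (top_of_set ?T) ?S"
      by (rule open_subset[OF _ oS]) auto
    have f0: "f z \<noteq> 0" if "z \<in> ?T - Z" for z
    proof (cases "Re z = - a")
      case True then show ?thesis using nz[OF True] by (simp add: f_def add_eq_0_iff)
    next
      case False then show ?thesis using that Z by auto
    qed
    have c1: "continuous_on (?T - Z) G"
    proof -
      have "continuous_on (?T - Z) (\<lambda>z. inverse (f z) - principal_parts f Z z)"
        using f0 by (intro continuous_intros continuous_on_subset[OF f_cont]
            continuous_on_subset[OF holomorphic_on_imp_continuous_on[OF holomorphic_principal_parts]]) auto
      then show ?thesis by (rule continuous_on_eq) (simp add: G_def)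
    qed
    have c2: "continuous_on ?S G"
      using holomorphic_on_imp_continuous_on[OF E(1)] by (rule continuous_on_eq) (simp add: G_E)
    show ?thesis
      using continuous_on_Un_local_open[of "?T - Z" ?S G] o1 o2 c1 c2 eq by simp
  qed
  (* On the line itself the two branches agree by the Fourier representation of inverse f. *)
  define \<Phi> where "\<Phi> z = (if Re z \<ge> - a then G z - 1 - laplace r z else laplace l (- z) - principal_parts f Z z)" for z
  have cont_right: "continuous_on ?T (\<lambda>z. G z - 1 - laplace r z)"
    by (intro continuous_intros contG continuous_on_laplace[OF rm ri])
  have left_out: "z \<notin> Z" if "Re z \<le> - a" for z using Z that by auto
  then have left_sub: "{z. Re z \<le> - a} \<subseteq> - Z" by auto
  have cont_left: "continuous_on {z. Re z \<le> - a} (\<lambda>z. laplace l (- z) - principal_parts f Z z)"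
    using left_sub
    by (intro continuous_intros continuous_on_compose2[OF continuous_on_laplace[OF lm li]]
        continuous_on_subset[OF holomorphic_on_imp_continuous_on[OF holomorphic_principal_parts]]) auto
  have "continuous_on (?T \<union> {z. Re z \<le> - a}) \<Phi>"
    unfolding \<Phi>_def
  proof (rule continuous_on_cases[OF closed_halfspace_Re_ge closed_halfspace_Re_le cont_right cont_left])
    show "\<forall>x. x \<in> ?T \<and> \<not> - a \<le> Re x \<or> x \<in> {z. Re z \<le> - a} \<and> - a \<le> Re x \<longrightarrow>
        G x - 1 - laplace r x = laplace l (- x) - principal_parts f Z x"
      using boundary left_sub by (auto simp: G_def)
  qed
  moreover have "?T \<union> {z. Re z \<le> - a} = UNIV" by auto
  ultimately have cont: "continuous_on UNIV \<Phi>" by simp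
  have holo: "\<Phi> holomorphic_on UNIV"
  proof (rule holomorphic_on_paste_across_line[of UNIV 1 _ "- a"])
    have "(\<lambda>z. laplace l (- z) - principal_parts f Z z) holomorphic_on {z. Re z < - a}"
      using left_out
      by (intro holomorphic_intros holomorphic_on_compose_gen[OF _ holomorphic_on_laplace[OF lm li], unfolded comp_def]
          holomorphic_on_subset[OF holomorphic_principal_parts]) (auto dest: left_out)
    then have "\<Phi> holomorphic_on {z. Re z < - a}"
      by (rule holomorphic_transform) (auto simp: \<Phi>_def)
    then show "\<Phi> holomorphic_on UNIV \<inter> {z. 1 \<bullet> z < - a}" by (simp add: inner_complex_def)
    have "(\<lambda>z. E z - 1 - laplace r z) holomorphic_on ?S"
      by (intro holomorphic_intros E(1) holomorphic_on_laplace[OF rm ri])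
    then have "\<Phi> holomorphic_on ?S"
      by (rule holomorphic_transform) (auto simp: \<Phi>_def G_E)
    then show "\<Phi> holomorphic_on UNIV \<inter> {z. - a < 1 \<bullet> z}" by (simp add: inner_complex_def)
  qed (use cont in auto)
  define Br where "Br = (LINT t:{0..}|lborel. norm (r t) * exp (a * t))"
  define Bl where "Bl = (LINT t:{0..}|lborel. norm (l t) * exp (- a * t))"
  have "bounded (range \<Phi>)"
  proof -
    have "eventually (\<lambda>z. dist (principal_parts f Z z) 0 < 1) at_infinity"
      using principal_parts_at_infinity by (rule tendstoD) simp
    then obtain b where b: "\<And>z. norm z \<ge> b \<Longrightarrow> norm (principal_parts f Z z) < 1"
      unfolding eventually_at_infinity by auto
    have "\<exists>b'. \<forall>z\<in>Z. norm z \<le> b'" using finite_imp_bounded[OF fZ] unfolding bounded_iff by auto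
    then obtain b' where b': "\<And>z. z \<in> Z \<Longrightarrow> norm z \<le> b'" by blast
    define B where "B = max (max R b) (b' + 1)"
    have out: "norm (\<Phi> z) \<le> 4 + Br + Bl" if z: "norm z \<ge> B" for z
    proof -
      have zb: "norm z \<ge> R" "norm z \<ge> b" "z \<notin> Z" using z b'[of z] by (auto simp: B_def)
      have nn: "0 \<le> Br" "0 \<le> Bl" unfolding Br_def Bl_def set_lebesgue_integral_def
        by (auto intro!: Bochner_Integration.integral_nonneg)
      show ?thesis
      proof (cases "Re z \<ge> - a")
        case True
        have "norm (laplace r z) \<le> Br" unfolding Br_def by (rule norm_laplace_le[OF rm ri True])
        moreover have "\<Phi> z = inverse (f z) - principal_parts f Z z - 1 - laplace r z"
          using True zb by (simp add: \<Phi>_def G_def)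
        then have "norm (\<Phi> z) \<le> norm (inverse (f z)) + norm (principal_parts f Z z) + norm (1::complex) + norm (laplace r z)"
          using norm_triangle_ineq4[of "inverse (f z) - principal_parts f Z z - 1" "laplace r z"]
            norm_triangle_ineq4[of "inverse (f z) - principal_parts f Z z" 1]
            norm_triangle_ineq4[of "inverse (f z)" "principal_parts f Z z"] by simp
        ultimately show ?thesis using far_f(1)[OF True zb(1)] b[OF zb(2)] nn by simp
      next
        case False
        then have "norm (laplace l (- z)) \<le> Bl" unfolding Bl_def by (intro norm_laplace_le[OF lm li]) auto
        moreover have "norm (\<Phi> z) \<le> norm (laplace l (- z)) + norm (principal_parts f Z z)"
          using False norm_triangle_ineq4 by (simp add: \<Phi>_def)
        ultimately show ?thesis using b[OF zb(2)] nn by simp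
      qed
    qed
    have "bounded (\<Phi> ` cball 0 B)"
      by (intro compact_imp_bounded compact_continuous_image continuous_on_subset[OF cont]) auto
    then obtain B' where "\<forall>w\<in>\<Phi> ` cball 0 B. norm w \<le> B'" unfolding bounded_iff by blast
    then have B': "norm (\<Phi> z) \<le> B'" if "norm z \<le> B" for z using that by simp
    have "norm (\<Phi> z) \<le> max B' (4 + Br + Bl)" for z
      using out[of z] B'[of z] by (cases "norm z \<le> B") (auto intro: max.coboundedI1 max.coboundedI2)
    then show ?thesis unfolding bounded_iff by auto
  qed
  with holo obtain c where c: "\<And>z. \<Phi> z = c"
    using Liouville_theorem[of \<Phi>] unfolding constant_on_def by auto
  have "c = 0"
  proof -
    have "(\<lambda>n. laplace l (of_nat n)) \<longlonglongrightarrow> 0" by (rule laplace_along_real_axis[OF lm li])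
    moreover have "filterlim (\<lambda>n. - of_nat n :: complex) at_infinity sequentially"
      by (rule filterlim_norm_at_top_imp_at_infinity) (simp add: filterlim_real_sequentially)
    then have "(\<lambda>n. principal_parts f Z (- of_nat n)) \<longlonglongrightarrow> 0"
      by (rule filterlim_compose[OF principal_parts_at_infinity])
    ultimately have lim: "(\<lambda>n. laplace l (of_nat n) - principal_parts f Z (- of_nat n)) \<longlonglongrightarrow> 0 - 0"
      by (rule tendsto_diff)
    have ev: "eventually (\<lambda>n. laplace l (of_nat n) - principal_parts f Z (- of_nat n) = c) sequentially"
    proof -
      have "eventually (\<lambda>n. real n > a) sequentially" by real_asymp
      then show ?thesis
      proof eventually_elim
        case (elim n)
        then have "\<Phi> (- of_nat n) = laplace l (of_nat n) - principal_parts f Z (- of_nat n)"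
          by (simp add: \<Phi>_def)
        then show ?case by (simp add: c)
      qed
    qed
    show ?thesis using LIMSEQ_unique[OF tendsto_eventually[OF ev] lim] by simp
  qed
  have "inverse (1 + laplace k z) = 1 + principal_parts (\<lambda>z. 1 + laplace k z) (char_zeros k a) z + laplace r z"
    if z: "Re z > - a" "1 + laplace k z \<noteq> 0" for z
  proof -
    have "z \<notin> Z" using z Z by (auto simp: f_def)
    moreover have "f = (\<lambda>z. 1 + laplace k z)" by (simp add: f_def fun_eq_iff)
    ultimately show ?thesis
      using c[of z] \<open>c = 0\<close> z unfolding \<Phi>_def G_def Z_def by (simp add: algebra_simps)
  qed
  with rm _ ri show ?thesis by (rule that) (simp add: r_def)
qed

section \<open>Volterra equations and resolvents\<close>

lemma conv_eq_convolve:
  fixes f h F H :: "real \<Rightarrow> complex"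
  assumes F: "\<And>s. s \<in> {0..t} \<Longrightarrow> F s = f s" "\<And>s. s < 0 \<Longrightarrow> F s = 0"
    and H: "\<And>s. s \<in> {0..t} \<Longrightarrow> H s = h s" "\<And>s. s < 0 \<Longrightarrow> H s = 0"
  shows "conv f h t = convolve F H t"
  unfolding conv_def convolve_def set_lebesgue_integral_def
proof (intro Bochner_Integration.integral_cong refl)
  fix s
  consider "s < 0" | "s \<in> {0..t}" | "s > t" by force
  then show "indicator {0..t} s *\<^sub>R (f (t - s) * h s) = F (t - s) * H s"
    by cases (use F(1)[of "t - s"] F(2)[of "t - s"] H in auto)
qed

lemma convolve_negative:
  assumes "\<And>s. s < 0 \<Longrightarrow> F s = 0" "\<And>s. s < 0 \<Longrightarrow> H s = 0" "t < 0"
  shows "convolve F H t = 0"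
proof -
  have "F (t - s) * H s = 0" for s using assms(1)[of "t - s"] assms(2)[of s] assms(3) by (cases "s < 0") auto
  then have "(\<lambda>s. F (t - s) * H s) = (\<lambda>s. 0)" by (intro ext)
  then show ?thesis unfolding convolve_def by (simp only: Bochner_Integration.integral_zero)
qed

lemma integrable_convolve_at:
  fixes f g :: "real \<Rightarrow> complex"
  assumes f: "integrable lborel f" and g[measurable]: "g \<in> borel_measurable borel" and B: "\<And>s. norm (g s) \<le> B"
  shows "integrable lborel (\<lambda>s. f (t - s) * g s)" "integrable lborel (\<lambda>s. g (t - s) * f s)"
proof -
  have [measurable]: "f \<in> borel_measurable borel" using f by (auto dest: borel_measurable_integrable)
  have B0: "B \<ge> 0" using order_trans[OF norm_ge_zero B] .
  show *: "integrable lborel (\<lambda>s. f (t - s) * g s)"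
  proof (rule Bochner_Integration.integrable_bound)
    show "integrable lborel (\<lambda>s. B * norm (f (t - s)))" using integrable_reflect[OF f] by simp
    show "AE s in lborel. norm (f (t - s) * g s) \<le> norm (B * norm (f (t - s)))"
      using B B0 by (auto simp: norm_mult mult.commute intro!: mult_right_mono)
  qed measurable
  show "integrable lborel (\<lambda>s. g (t - s) * f s)"
    using integrable_reflect[OF *, of t] by (simp add: mult.commute)
qed

lemma norm_convolve_le:
  fixes f g :: "real \<Rightarrow> complex"
  assumes f: "integrable lborel f" and g[measurable]: "g \<in> borel_measurable borel" and B: "\<And>s. norm (g s) \<le> B"
  shows "norm (convolve g f t) \<le> B * (LINT s|lborel. norm (f s))"
proof -
  have "norm (convolve g f t) \<le> (LINT s|lborel. norm (g (t - s) * f s))"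
    unfolding convolve_def by (rule integral_norm_bound)
  also have "\<dots> \<le> (LINT s|lborel. B * norm (f s))"
    using integrable_norm[OF integrable_convolve_at(2)[OF assms]] f B
    by (intro integral_mono) (auto simp: norm_mult intro!: mult_right_mono)
  finally show ?thesis by simp
qed

text \<open>
  A convolution at \<open>T\<close> sees only values on \<open>[0, T]\<close>. Truncation makes locally integrable
  functions integrable, so that the calculus of convolutions on the whole line applies.
\<close>

definition restrict_to :: "real \<Rightarrow> (real \<Rightarrow> complex) \<Rightarrow> real \<Rightarrow> complex" where
  "restrict_to T f t = indicator {0..T} t *\<^sub>R f t"

lemma restrict_to_simps [simp]:
  "t \<in> {0..T} \<Longrightarrow> restrict_to T f t = f t" "t < 0 \<Longrightarrow> restrict_to T f t = 0" "T < t \<Longrightarrow> restrict_to T f t = 0"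
  by (auto simp: restrict_to_def)

text \<open>
  The resolvent equation holds almost everywhere only, but after convolution with a bounded \<open>W\<close> the
  exceptional null set is integrated away and the identity holds at \<open>T\<close> itself.
\<close>

lemma resolvent_convolve:
  assumes F: "integrable lborel F" and Q: "integrable lborel Q"
    and res: "AE s in lborel. s \<in> {0..T} \<longrightarrow> Q s + convolve F Q s = F s"
    and W[measurable]: "W \<in> borel_measurable borel" and B: "\<And>s. norm (W s) \<le> B"
    and supp: "\<And>s. s \<notin> {0..T} \<Longrightarrow> W s = 0"
  shows "convolve (convolve F Q) W T = convolve F W T - convolve Q W T"
proof -
  have [measurable]: "F \<in> borel_measurable borel" "Q \<in> borel_measurable borel" "convolve F Q \<in> borel_measurable borel"
    using F Q integrable_convolve[OF F Q] by (auto dest: borel_measurable_integrable)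
  have "convolve (convolve F Q) W T = (LINT s|lborel. W (T - s) * convolve F Q s)"
    by (subst convolve_commute) (simp add: convolve_def[of W])
  also have "\<dots> = (LINT s|lborel. W (T - s) * F s - W (T - s) * Q s)"
  proof (rule integral_cong_AE)
    show "AE s in lborel. W (T - s) * convolve F Q s = W (T - s) * F s - W (T - s) * Q s"
      using res
    proof eventually_elim
      case (elim s)
      show ?case
      proof (cases "s \<in> {0..T}")
        case True
        then have "convolve F Q s = F s - Q s" using elim by (simp add: algebra_simps)
        then show ?thesis by (simp add: right_diff_distrib)
      next
        case False
        then have "T - s \<notin> {0..T}" by auto
        then show ?thesis by (simp add: supp)
      qed
    qed
  qed measurable
  also have "\<dots> = convolve W F T - convolve W Q T"
    using integrable_convolve_at(2)[OF F W B] integrable_convolve_at(2)[OF Q W B] by (simp add: convolve_def)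
  finally show ?thesis by (simp add: convolve_commute[of W])
qed

text \<open>
  Both directions use \<open>k * q = k - q\<close>. If \<open>\<eta> + k * \<eta> = u\<close>, then
  \<open>q * u = q * \<eta> + (q * k) * \<eta> = k * \<eta>\<close>; and if \<open>\<eta> = u - q * u\<close>, then
  \<open>k * \<eta> = k * u - (k * q) * u = q * u\<close>.
\<close>

theorem volterra_solution_iff_resolvent:
  fixes k q u \<eta> :: "real \<Rightarrow> complex"
  assumes km[measurable]: "k \<in> borel_measurable borel" and kB: "\<And>t. norm (k t) \<le> B"
    and q: "\<And>T. T \<ge> 0 \<Longrightarrow> set_integrable lborel {0..T} q"
    and res: "AE t in lborel. t \<ge> 0 \<longrightarrow> q t + conv k q t = k t"
    and u: "continuous_on UNIV u"
  shows "volterra_solution k u \<eta> \<longleftrightarrow> (\<forall>t\<ge>0. \<eta> t = u t - conv q u t)"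
proof -
  have [measurable]: "u \<in> borel_measurable borel" using u by (rule borel_measurable_continuous_onI)
  let ?F = "\<lambda>T. restrict_to T k" and ?Q = "\<lambda>T. restrict_to T q" and ?U = "\<lambda>T. restrict_to T u"
  have Fm[measurable]: "?F T \<in> borel_measurable borel" "?U T \<in> borel_measurable borel" for T
    unfolding restrict_to_def[abs_def] by measurable
  have B0: "B \<ge> 0" using order_trans[OF norm_ge_zero kB] .
  have FB: "norm (?F T s) \<le> B" for T s using kB B0 by (auto simp: restrict_to_def indicator_def)
  have bounded_integrable: "integrable lborel g"
    if g: "g \<in> borel_measurable borel" and b: "\<And>s. norm (g s) \<le> C" and s: "\<And>s. s \<notin> {0..T} \<Longrightarrow> g s = 0"
    for g :: "real \<Rightarrow> complex" and C T
  proof (rule Bochner_Integration.integrable_bound)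
    show "integrable lborel (\<lambda>s. indicator {0..T} s *\<^sub>R C)" by (simp add: integrable_indicator_iff emeasure_lborel_Icc_eq)
    show "AE s in lborel. norm (g s) \<le> norm (indicator {0..T} s *\<^sub>R C)"
      using b s by (intro AE_I2) (auto simp: indicator_def intro: order_trans[OF _ abs_ge_self])
  qed (use g in simp)
  have UB: "\<exists>C. \<forall>s. norm (?U T s) \<le> C" for T
  proof -
    have "bounded (u ` {0..T})"
      by (intro compact_imp_bounded compact_continuous_image continuous_on_subset[OF u]) auto
    then obtain C where "\<forall>w\<in>u ` {0..T}. norm w \<le> C"
      unfolding bounded_iff by blast
    then have "norm (?U T s) \<le> max 0 C" for s by (auto simp: restrict_to_def indicator_def intro: max.coboundedI2)
    then show ?thesis by blast
  qed
  have F: "integrable lborel (?F T)" for T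
    by (rule bounded_integrable[OF Fm(1) FB, where T = T]) (simp add: restrict_to_def)
  have U: "integrable lborel (?U T)" for T
  proof -
    obtain C where C: "\<And>s. norm (?U T s) \<le> C" using UB by blast
    show ?thesis by (rule bounded_integrable[OF Fm(2) C, where T = T]) (simp add: restrict_to_def)
  qed
  have Q: "integrable lborel (?Q T)" if "T \<ge> 0" for T
    using q[OF that] by (simp add: restrict_to_def[abs_def] set_integrable_def)
  have res': "AE s in lborel. s \<in> {0..T} \<longrightarrow> ?Q T s + convolve (?F T) (?Q T) s = ?F T s" for T
    using res
  proof eventually_elim
    case (elim s)
    show ?case
    proof
      assume s: "s \<in> {0..T}"
      then have "conv k q s = convolve (?F T) (?Q T) s" by (intro conv_eq_convolve) auto
      then show "?Q T s + convolve (?F T) (?Q T) s = ?F T s" using elim s by simp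
    qed
  qed
  show ?thesis
  proof
    assume sol: "volterra_solution k u \<eta>"
    show "\<forall>t\<ge>0. \<eta> t = u t - conv q u t"
    proof (intro allI impI)
      fix T :: real assume T: "T \<ge> 0"
      define H where "H = restrict_to T \<eta>"
      have H: "integrable lborel H"
        using sol T by (simp add: volterra_solution_def H_def restrict_to_def[abs_def] set_integrable_def)
      have Hm: "H \<in> borel_measurable borel" using H by (auto dest: borel_measurable_integrable)
      have eq: "u s = H s + convolve (?F T) H s" if s: "s \<in> {0..T}" for s
      proof -
        have "conv k \<eta> s = convolve (?F T) H s" unfolding H_def using s by (intro conv_eq_convolve) auto
        then show ?thesis using sol s by (auto simp: volterra_solution_def H_def)
      qed
      obtain C where C: "\<And>s. norm (?U T s) \<le> C" using UB by blast
      define D where "D = C + B * (LINT s|lborel. norm (H s))"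
      have cB: "norm (convolve (?F T) H s) \<le> B * (LINT s|lborel. norm (H s))" for s
        by (rule norm_convolve_le[OF H Fm(1) FB])
      have HD: "norm (H s) \<le> D" for s
      proof (cases "s \<in> {0..T}")
        case True
        then have "H s = ?U T s - convolve (?F T) H s" using eq[OF True] by simp
        then show ?thesis using C[of s] cB[of s] norm_triangle_ineq4[of "?U T s" "convolve (?F T) H s"] by (simp add: D_def)
      next
        case False
        then have "H s = 0" by (auto simp: H_def restrict_to_def)
        moreover have "0 \<le> C" using order_trans[OF norm_ge_zero C] .
        moreover have "0 \<le> B * (LINT s|lborel. norm (H s))" using order_trans[OF norm_ge_zero cB] .
        ultimately show ?thesis by (simp add: D_def)
      qed
      have cm: "convolve (?F T) H \<in> borel_measurable borel"
        using integrable_convolve[OF F H] by (auto dest: borel_measurable_integrable)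
      have "conv q u T = convolve (?Q T) (?U T) T" using T by (intro conv_eq_convolve) auto
      also have "\<dots> = (LINT s|lborel. ?Q T (T - s) * H s + ?Q T (T - s) * convolve (?F T) H s)"
        unfolding convolve_def[of "?Q T"]
      proof (intro Bochner_Integration.integral_cong refl)
        fix s
        consider "s < 0" | "s \<in> {0..T}" | "s > T" by force
        then show "?Q T (T - s) * ?U T s = ?Q T (T - s) * H s + ?Q T (T - s) * convolve (?F T) H s"
        proof cases
          case 2 then show ?thesis by (simp add: eq distrib_left)
        qed simp_all
      qed
      also have "\<dots> = convolve (?Q T) H T + convolve (?Q T) (convolve (?F T) H) T"
        using integrable_convolve_at(1)[OF Q[OF T] Hm HD] integrable_convolve_at(1)[OF Q[OF T] cm cB]
        by (simp add: convolve_def[of "?Q T"])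
      also have "convolve (?Q T) (convolve (?F T) H) T = convolve (convolve (?Q T) (?F T)) H T"
        by (rule convolve_assoc[OF Q[OF T] H Fm(1) FB])
      also have "\<dots> = convolve (convolve (?F T) (?Q T)) H T" by (simp only: convolve_commute[of "?Q T" "?F T"])
      also have "\<dots> = convolve (?F T) H T - convolve (?Q T) H T"
        by (rule resolvent_convolve[OF F Q[OF T] res' Hm HD]) (auto simp: H_def restrict_to_def)
      finally have "conv q u T = convolve (?F T) H T" by simp
      then show "\<eta> T = u T - conv q u T" using eq[of T] T by (simp add: H_def)
    qed
  next
    assume form: "\<forall>t\<ge>0. \<eta> t = u t - conv q u t"
    have eq: "\<eta> s = ?U T s - convolve (?Q T) (?U T) s" if s: "s \<in> {0..T}" for s T
    proof -
      have "conv q u s = convolve (?Q T) (?U T) s" using s by (intro conv_eq_convolve) auto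
      then show ?thesis using form s by simp
    qed
    have int: "set_integrable lborel {0..T} \<eta>" if T: "T \<ge> 0" for T
    proof -
      have "integrable lborel (\<lambda>s. indicator {0..T} s *\<^sub>R (?U T s - convolve (?Q T) (?U T) s))"
        using U integrable_convolve[OF Q[OF T] U] by (intro integrable_mult_indicator) auto
      moreover have "indicator {0..T} s *\<^sub>R (?U T s - convolve (?Q T) (?U T) s) = indicator {0..T} s *\<^sub>R \<eta> s" for s
        using eq[of s T] by (auto simp: indicator_def)
      ultimately show ?thesis unfolding set_integrable_def by (simp only:)
    qed
    have "\<eta> T + conv k \<eta> T = u T" if T: "T \<ge> 0" for T
    proof -
      obtain C where C: "\<And>s. norm (?U T s) \<le> C" using UB by blast
      have "conv k \<eta> T = convolve (?F T) (restrict_to T \<eta>) T" using T by (intro conv_eq_convolve) auto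
      also have "\<dots> = (LINT s|lborel. ?F T (T - s) * ?U T s - ?F T (T - s) * convolve (?Q T) (?U T) s)"
        unfolding convolve_def[of "?F T"]
      proof (intro Bochner_Integration.integral_cong refl)
        fix s
        consider "s < 0" | "s \<in> {0..T}" | "s > T" by force
        then show "?F T (T - s) * restrict_to T \<eta> s = ?F T (T - s) * ?U T s - ?F T (T - s) * convolve (?Q T) (?U T) s"
        proof cases
          case 1
          then have "convolve (?Q T) (?U T) s = 0" by (intro convolve_negative) auto
          then show ?thesis using 1 by simp
        next
          case 2 then show ?thesis using eq[OF 2] by (simp add: right_diff_distrib)
        qed simp
      qed
      also have "\<dots> = convolve (?F T) (?U T) T - convolve (?F T) (convolve (?Q T) (?U T)) T"
        using integrable_convolve_at(2)[OF U Fm(1) FB] integrable_convolve_at(2)[OF integrable_convolve[OF Q[OF T] U] Fm(1) FB]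
        by (simp add: convolve_def[of "?F T"])
      also have "convolve (?F T) (convolve (?Q T) (?U T)) T = convolve (convolve (?F T) (?Q T)) (?U T) T"
      proof -
        have "convolve (?F T) (convolve (?Q T) (?U T)) T = convolve (convolve (?Q T) (?U T)) (?F T) T"
          by (simp only: convolve_commute[of "?F T" "convolve (?Q T) (?U T)"])
        also have "\<dots> = convolve (?Q T) (convolve (?U T) (?F T)) T"
          by (rule convolve_assoc[OF Q[OF T] F Fm(2) C, symmetric])
        also have "\<dots> = convolve (?Q T) (convolve (?F T) (?U T)) T"
          by (simp only: convolve_commute[of "?U T" "?F T"])
        also have "\<dots> = convolve (convolve (?Q T) (?F T)) (?U T) T"
          by (rule convolve_assoc[OF Q[OF T] U Fm(1) FB])
        finally show ?thesis by (simp only: convolve_commute[of "?Q T" "?F T"])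
      qed
      also have "\<dots> = convolve (?F T) (?U T) T - convolve (?Q T) (?U T) T"
        by (rule resolvent_convolve[OF F Q[OF T] res' Fm(2) C]) (auto simp: restrict_to_def)
      finally have "conv k \<eta> T = convolve (?Q T) (?U T) T" by simp
      then show ?thesis using eq[of T T] T by simp
    qed
    with int show "volterra_solution k u \<eta>" by (simp add: volterra_solution_def)
  qed
qed

text \<open>
  The hypothesis says that \<open>q + k * q - k\<close>, weighted by \<open>exp (- \<sigma> t)\<close>, has vanishing Fourier
  transform.
\<close>

lemma resolvent_from_transform:
  assumes km[measurable]: "k \<in> borel_measurable borel" and qm[measurable]: "q \<in> borel_measurable borel"
    and k: "set_integrable lborel {0..} (\<lambda>t. norm (k t) * exp (- \<sigma> * t))"
    and q: "set_integrable lborel {0..} (\<lambda>t. norm (q t) * exp (- \<sigma> * t))"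
    and L: "\<And>z. Re z = \<sigma> \<Longrightarrow> (1 + laplace k z) * (1 - laplace q z) = 1"
  shows "AE t in lborel. t \<ge> 0 \<longrightarrow> q t + conv k q t = k t"
proof -
  define e where "e t = exp (complex_of_real (- \<sigma> * t))" for t
  have [measurable]: "e \<in> borel_measurable borel" unfolding e_def[abs_def] by measurable
  define F where "F t = indicator {0..} t *\<^sub>R (k t * e t)" for t
  define Q where "Q t = indicator {0..} t *\<^sub>R (q t * e t)" for t
  have int: "integrable lborel (\<lambda>t. indicator {0..} t *\<^sub>R (h t * e t))"
    if [measurable]: "h \<in> borel_measurable borel" and h: "set_integrable lborel {0..} (\<lambda>t. norm (h t) * exp (- \<sigma> * t))" for h
  proof -
    have "set_integrable lborel {0..} (\<lambda>t. h t * e t)"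
    proof (rule set_integrable_bound[OF h])
      show "set_borel_measurable lborel {0..} (\<lambda>t. h t * e t)" unfolding set_borel_measurable_def by measurable
    qed (auto simp: e_def norm_mult)
    then show ?thesis by (simp add: set_integrable_def)
  qed
  have F: "integrable lborel F" unfolding F_def[abs_def] by (rule int[OF km k])
  have Q: "integrable lborel Q" unfolding Q_def[abs_def] by (rule int[OF qm q])
  have C: "integrable lborel (convolve F Q)" by (rule integrable_convolve[OF F Q])
  have four: "fourier (\<lambda>t. indicator {0..} t *\<^sub>R (h t * e t)) \<omega> = laplace h (Complex \<sigma> \<omega>)" for h \<omega>
  proof -
    have "laplace (\<lambda>t. h t * e t) (Complex 0 \<omega>) = laplace h (Complex 0 \<omega> - of_real (- \<sigma>))"
      unfolding e_def[abs_def] by (rule laplace_shift)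
    also have "Complex 0 \<omega> - of_real (- \<sigma>) = Complex \<sigma> \<omega>" by (simp add: complex_eq_iff)
    finally show ?thesis by (simp only: laplace_eq_fourier)
  qed
  define d where "d t = Q t + convolve F Q t - F t" for t
  have "AE t in lborel. d t = 0"
  proof (rule fourier_inj)
    show "integrable lborel d" unfolding d_def[abs_def] using F Q C by simp
    fix \<omega>
    have "fourier d \<omega> = fourier Q \<omega> + fourier (convolve F Q) \<omega> - fourier F \<omega>"
      using integrable_mult_cis[OF F, of "-\<omega>"] integrable_mult_cis[OF Q, of "-\<omega>"] integrable_mult_cis[OF C, of "-\<omega>"]
      by (simp add: fourier_def d_def distrib_right left_diff_distrib)
    also have "\<dots> = laplace q (Complex \<sigma> \<omega>) + laplace k (Complex \<sigma> \<omega>) * laplace q (Complex \<sigma> \<omega>) - laplace k (Complex \<sigma> \<omega>)"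
      unfolding fourier_convolve[OF F Q] unfolding F_def[abs_def] Q_def[abs_def] four ..
    also have "\<dots> = 0" using L[of "Complex \<sigma> \<omega>"] by (simp add: algebra_simps)
    finally show "fourier d \<omega> = 0" .
  qed
  then show ?thesis
  proof eventually_elim
    case (elim t)
    show ?case
    proof
      assume t: "t \<ge> 0"
      have "convolve F Q t = conv (\<lambda>t. k t * e t) (\<lambda>t. q t * e t) t"
        by (rule conv_eq_convolve[symmetric]) (auto simp: F_def Q_def)
      also have "\<dots> = (LINT s:{0..t}|lborel. (k (t - s) * q s) * e t)"
      proof -
        have "e (t - s) * e s = e t" for s by (simp add: e_def algebra_simps flip: exp_add of_real_add)
        then show ?thesis unfolding conv_def
          by (intro set_lebesgue_integral_cong) (auto simp: mult_ac)
      qed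
      also have "\<dots> = conv k q t * e t" by (simp add: conv_def)
      finally have "e t * (q t + conv k q t - k t) = 0"
        using elim t by (simp add: d_def F_def Q_def algebra_simps)
      then show "q t + conv k q t = k t" by (simp add: e_def)
    qed
  qed
qed

lemma polar_part_laplace:
  fixes c :: "complex \<Rightarrow> nat \<Rightarrow> complex" and p :: "complex \<Rightarrow> nat"
  assumes z: "\<And>\<mu>. \<mu> \<in> Z \<Longrightarrow> Re \<mu> < Re z"
  defines "P \<equiv> \<lambda>t. \<Sum>\<mu>\<in>Z. \<Sum>j<p \<mu>. c \<mu> j * of_real t ^ j * exp (\<mu> * of_real t)"
  shows "set_integrable lborel {0..} (\<lambda>t. P t * exp (- (of_real t * z)))"
    and "laplace P z = (\<Sum>\<mu>\<in>Z. \<Sum>j<p \<mu>. c \<mu> j * fact j / (z - \<mu>) ^ Suc j)"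
proof -
  let ?g = "\<lambda>\<mu> j t. indicator {0..} t *\<^sub>R (of_real t ^ j * exp (- (complex_of_real t * (z - \<mu>))))"
  have eq: "indicator {0..} t *\<^sub>R (P t * exp (- (of_real t * z))) = (\<Sum>\<mu>\<in>Z. \<Sum>j<p \<mu>. c \<mu> j * ?g \<mu> j t)" for t
    unfolding P_def sum_distrib_right scaleR_sum_right
    by (intro sum.cong refl) (simp add: algebra_simps flip: exp_add)
  have i: "integrable lborel (?g \<mu> j)" if "\<mu> \<in> Z" for \<mu> j
    using power_cexp_ray_integrable[of "z - \<mu>" j] z[OF that] by (simp add: set_integrable_def)
  show "set_integrable lborel {0..} (\<lambda>t. P t * exp (- (of_real t * z)))"
    unfolding set_integrable_def eq using i by (intro Bochner_Integration.integrable_sum integrable_mult_right)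
  have "laplace P z = (\<Sum>\<mu>\<in>Z. LINT t|lborel. (\<Sum>j<p \<mu>. c \<mu> j * ?g \<mu> j t))"
    unfolding laplace_def set_lebesgue_integral_def eq
    by (intro Bochner_Integration.integral_sum Bochner_Integration.integrable_sum integrable_mult_right i)
  also have "\<dots> = (\<Sum>\<mu>\<in>Z. \<Sum>j<p \<mu>. LINT t|lborel. c \<mu> j * ?g \<mu> j t)"
    by (intro sum.cong refl Bochner_Integration.integral_sum integrable_mult_right i)
  also have "\<dots> = (\<Sum>\<mu>\<in>Z. \<Sum>j<p \<mu>. c \<mu> j * fact j / (z - \<mu>) ^ Suc j)"
  proof (intro sum.cong refl)
    fix \<mu> j assume "\<mu> \<in> Z"
    then have "(LINT t|lborel. ?g \<mu> j t) = fact j / (z - \<mu>) ^ Suc j"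
      using power_cexp_ray_integral[of "z - \<mu>" j] z by (simp add: set_lebesgue_integral_def)
    then show "(LINT t|lborel. c \<mu> j * ?g \<mu> j t) = c \<mu> j * fact j / (z - \<mu>) ^ Suc j"
      by (simp only: integral_mult_right_zero times_divide_eq_right)
  qed
  finally show "laplace P z = (\<Sum>\<mu>\<in>Z. \<Sum>j<p \<mu>. c \<mu> j * fact j / (z - \<mu>) ^ Suc j)" .
qed

section \<open>The solution formula\<close>

theorem theorem6:
  fixes g :: "real measure" and K a :: real
  assumes "real_distribution g"
    and "K \<ge> 0"
    and "set_integrable lborel {0..} (\<lambda>\<xi>. norm (char g \<xi>) * exp (a * \<xi>))"
    and "\<And>z. Re z = - a \<Longrightarrow> laplace (coupling_kernel K g) z \<noteq> - 1"
  shows "finite (char_zeros (coupling_kernel K g) a) \<and>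
    (\<exists>(r\<^sub>s :: real \<Rightarrow> complex) (q :: real \<Rightarrow> complex).
       r\<^sub>s \<in> borel_measurable borel \<and>
       (\<forall>t<0. r\<^sub>s t = 0) \<and>
       set_integrable lborel {0..} (\<lambda>t. norm (r\<^sub>s t) * exp (a * t)) \<and>
       (\<forall>t\<ge>0. q t = r\<^sub>s t +
          (\<Sum>\<mu>\<in>char_zeros (coupling_kernel K g) a. \<Sum>j<zero_mult (coupling_kernel K g) \<mu>.
             pole_coeff (coupling_kernel K g) \<mu> j * of_real t ^ j * exp (\<mu> * of_real t))) \<and>
       (\<forall>t<0. q t = 0) \<and>
       (\<forall>u\<^sub>i\<^sub>n :: nat \<times> real \<Rightarrow> complex. continuous_on ({1..} \<times> UNIV) u\<^sub>i\<^sub>n \<longrightarrow>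
          (\<forall>\<eta>. volterra_solution (coupling_kernel K g) (\<lambda>t. u\<^sub>i\<^sub>n (1, t)) \<eta> \<longleftrightarrow>
             (\<forall>t\<ge>0. \<eta> t = u\<^sub>i\<^sub>n (1, t) -
                (LINT s:{0..}|lborel. q (t - s) * u\<^sub>i\<^sub>n (1, s))))))"
proof -
  interpret g: real_distribution g by fact
  define k where "k = coupling_kernel K g"
  have km[measurable]: "k \<in> borel_measurable borel"
    unfolding k_def coupling_kernel_def[abs_def] using g.char_measurable by measurable
  have kc: "continuous_on {0..} k"
    unfolding k_def coupling_kernel_def[abs_def] using g.isCont_char
    by (intro continuous_intros continuous_at_imp_continuous_on) auto
  have kB: "norm (k t) \<le> K / 2" for t
    using g.cmod_char_le_1[of t] \<open>K \<ge> 0\<close> mult_left_mono[of "norm (char g t)" 1 "K / 2"]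
    by (simp add: k_def coupling_kernel_def norm_mult)
  have k: "set_integrable lborel {0..} (\<lambda>t. norm (k t) * exp (a * t))"
  proof -
    have "norm (k t) * exp (a * t) = K / 2 * (norm (char g t) * exp (a * t))" for t
      using \<open>K \<ge> 0\<close> by (simp add: k_def coupling_kernel_def norm_mult)
    then show ?thesis using assms(3) by (simp only: set_integrable_mult_right)
  qed
  have nz: "\<And>z. Re z = - a \<Longrightarrow> laplace k z \<noteq> - 1" using assms(4) by (simp add: k_def)
  define Z where "Z = char_zeros k a"
  have fin: "finite Z" unfolding Z_def by (rule finite_char_zeros[OF km kc k nz])
  define f where "f = (\<lambda>z. 1 + laplace k z)"
  obtain r where rm[measurable]: "r \<in> borel_measurable borel" and r0: "\<And>t. t < 0 \<Longrightarrow> r t = 0"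
    and ri: "set_integrable lborel {0..} (\<lambda>t. norm (r t) * exp (a * t))"
    and r': "\<And>z. Re z > - a \<Longrightarrow> 1 + laplace k z \<noteq> 0 \<Longrightarrow>
      inverse (1 + laplace k z) = 1 + principal_parts (\<lambda>z. 1 + laplace k z) (char_zeros k a) z + laplace r z"
    by (rule inverse_symbol_decomposition[OF km kc k nz]) (assumption, rule that)
  have r: "inverse (f z) = 1 + principal_parts f Z z + laplace r z" if "Re z > - a" "f z \<noteq> 0" for z
    using r'[of z] that by (simp add: f_def Z_def)
  define P where "P t = (\<Sum>\<mu>\<in>Z. \<Sum>j<zero_mult k \<mu>. pole_coeff k \<mu> j * of_real t ^ j * exp (\<mu> * of_real t))" for t
  have [measurable]: "P \<in> borel_measurable borel" unfolding P_def[abs_def] by measurable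
  define q where "q t = (if t < 0 then 0 else - r t + P t)" for t
  have qm[measurable]: "q \<in> borel_measurable borel" unfolding q_def[abs_def] by measurable
  obtain b where b: "\<And>\<mu>. \<mu> \<in> Z \<Longrightarrow> norm \<mu> \<le> b"
    using finite_imp_bounded[OF fin] unfolding bounded_iff by blast
  (* Any abscissa to the right of 0, of the line Re z = - a and of all zeros serves. *)
  define \<sigma> where "\<sigma> = 1 + \<bar>a\<bar> + \<bar>b\<bar>"
  have \<sigma>: "\<sigma> > 0" "\<sigma> > - a" by (auto simp: \<sigma>_def)
  have \<sigma>Z: "Re \<mu> < \<sigma>" if "\<mu> \<in> Z" for \<mu>
    using b[OF that] abs_Re_le_cmod[of \<mu>] by (simp add: \<sigma>_def)
  have transform: "set_integrable lborel {0..} (\<lambda>t. q t * exp (- (of_real t * z)))"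
    "(1 + laplace k z) * (1 - laplace q z) = 1" if z: "Re z = \<sigma>" for z
  proof -
    have zZ: "\<And>\<mu>. \<mu> \<in> Z \<Longrightarrow> Re \<mu> < Re z" using \<sigma>Z z by simp
    have Pi: "set_integrable lborel {0..} (\<lambda>t. P t * exp (- (of_real t * z)))"
      unfolding P_def by (rule polar_part_laplace(1)[OF zZ])
    have PL: "laplace P z = (\<Sum>\<mu>\<in>Z. \<Sum>j<zero_mult k \<mu>. pole_coeff k \<mu> j * fact j / (z - \<mu>) ^ Suc j)"
      unfolding P_def[abs_def] by (rule polar_part_laplace(2)[OF zZ])
    have rz: "set_integrable lborel {0..} (\<lambda>t. r t * exp (- (of_real t * z)))"
      by (rule laplace_integrable[OF rm ri]) (use z \<sigma> in simp)
    have eq: "indicator {0..} t *\<^sub>R (q t * exp (- (complex_of_real t * z))) =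
        indicator {0..} t *\<^sub>R (P t * exp (- (complex_of_real t * z))) - indicator {0..} t *\<^sub>R (r t * exp (- (complex_of_real t * z)))" for t
      by (simp add: q_def indicator_def algebra_simps)
    show "set_integrable lborel {0..} (\<lambda>t. q t * exp (- (of_real t * z)))"
      using Pi rz unfolding set_integrable_def eq by (rule Bochner_Integration.integrable_diff)
    have "laplace q z = laplace P z - laplace r z"
      using Pi rz unfolding laplace_def set_lebesgue_integral_def set_integrable_def eq
      by (rule Bochner_Integration.integral_diff)
    moreover have "laplace P z = - principal_parts f Z z"
      unfolding PL principal_parts_def sum_negf[symmetric] zero_mult_def pole_coeff_def f_def
      by (intro sum.cong refl) (simp add: sum_negf[symmetric])
    ultimately have Lq: "laplace q z = - (principal_parts f Z z + laplace r z)" by simp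
    have "z \<notin> Z" using zZ by blast
    then have f0: "f z \<noteq> 0" using z \<sigma> by (auto simp: Z_def char_zeros_def f_def)
    have "1 - laplace q z = inverse (f z)" using r[of z] f0 z \<sigma> Lq by simp
    then show "(1 + laplace k z) * (1 - laplace q z) = 1" using f0 by (simp add: f_def)
  qed
  have q\<sigma>: "set_integrable lborel {0..} (\<lambda>t. norm (q t) * exp (- \<sigma> * t))"
    using set_integrable_norm[OF transform(1)[of "of_real \<sigma>"]] by (simp add: norm_mult mult.commute)
  have k\<sigma>: "set_integrable lborel {0..} (\<lambda>t. norm (k t) * exp (- \<sigma> * t))"
  proof (rule set_integrable_bound)
    show "set_integrable lborel {0..} (\<lambda>t. K / 2 * exp (- (t * \<sigma>)))"
      using exp_ray_integrable[OF \<sigma>(1)] by (intro set_integrable_mult_right) auto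
    show "set_borel_measurable lborel {0..} (\<lambda>t. norm (k t) * exp (- \<sigma> * t))"
      unfolding set_borel_measurable_def by measurable
    show "AE t in lborel. t \<in> {0..} \<longrightarrow> norm (norm (k t) * exp (- \<sigma> * t)) \<le> norm (K / 2 * exp (- (t * \<sigma>)))"
      using kB \<open>K \<ge> 0\<close> by (auto simp: mult.commute intro!: mult_left_mono)
  qed
  have res: "AE t in lborel. t \<ge> 0 \<longrightarrow> q t + conv k q t = k t"
    by (rule resolvent_from_transform[OF km qm k\<sigma> q\<sigma> transform(2)])
  have qT: "set_integrable lborel {0..T} q" for T
  proof (rule set_integrable_bound)
    have "set_integrable lborel {0..T} (\<lambda>t. norm (q t) * exp (- \<sigma> * t))"
      by (rule set_integrable_subset[OF q\<sigma>]) auto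
    then show "set_integrable lborel {0..T} (\<lambda>t. exp (\<sigma> * T) * (norm (q t) * exp (- \<sigma> * t)))"
      by (intro set_integrable_mult_right) auto
    show "set_borel_measurable lborel {0..T} q" unfolding set_borel_measurable_def by measurable
    have "norm (q t) \<le> exp (\<sigma> * T) * (norm (q t) * exp (- \<sigma> * t))" if "t \<in> {0..T}" for t
    proof -
      have le: "1 \<le> exp (\<sigma> * T) * exp (- \<sigma> * t)"
        using that \<sigma>(1) by (simp add: mult_left_mono flip: exp_add)
      show ?thesis
        using mult_left_mono[OF le norm_ge_zero[of "q t"]] by (simp only: mult_ac mult_1_left mult_1_right)
    qed
    then show "AE t in lborel. t \<in> {0..T} \<longrightarrow> norm (q t) \<le> norm (exp (\<sigma> * T) * (norm (q t) * exp (- \<sigma> * t)))"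
      by simp
  qed
  have solution: "volterra_solution k (\<lambda>t. u (1, t)) \<eta> \<longleftrightarrow>
      (\<forall>t\<ge>0. \<eta> t = u (1, t) - (LINT s:{0..}|lborel. q (t - s) * u (1, s)))"
    if u: "continuous_on ({1..} \<times> UNIV) u" for u :: "nat \<times> real \<Rightarrow> complex" and \<eta>
  proof -
    have "continuous_on UNIV (\<lambda>t. u (1, t))"
      by (rule continuous_on_compose2[OF u]) (auto intro!: continuous_intros)
    then have "volterra_solution k (\<lambda>t. u (1, t)) \<eta> \<longleftrightarrow> (\<forall>t\<ge>0. \<eta> t = u (1, t) - conv q (\<lambda>t. u (1, t)) t)"
      by (rule volterra_solution_iff_resolvent[OF km kB qT res])
    moreover have "conv q (\<lambda>t. u (1, t)) t = (LINT s:{0..}|lborel. q (t - s) * u (1, s))" for t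
      unfolding conv_def set_lebesgue_integral_def
      by (intro Bochner_Integration.integral_cong refl) (auto simp: indicator_def q_def)
    ultimately show ?thesis by simp
  qed
  show ?thesis
    unfolding k_def[symmetric] Z_def[symmetric]
  proof (rule conjI[OF fin], rule exI[of _ "\<lambda>t. - r t"], rule exI[of _ q], intro conjI)
    show "\<forall>t\<ge>0. q t = - r t + (\<Sum>\<mu>\<in>Z. \<Sum>j<zero_mult k \<mu>. pole_coeff k \<mu> j * of_real t ^ j * exp (\<mu> * of_real t))"
      by (simp add: q_def P_def)
    show "\<forall>t<0. q t = 0" by (simp add: q_def)
  qed (use r0 ri solution in \<open>auto simp del: of_real_mult\<close>)
qed

end
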